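(* Let $p\ge 0$ be an integer. If property $N_p$ holds for a canonical binary curve $\tilde C\subset\mathbb{P}^{g-2}$ of genus $g-1$, then property $N_p$ holds for the canonical binary curve $C\subset\mathbb{P}^{g-1}$ of genus $g$ for a generic choice of its parameters $a_{i,j}$ ($1\le i\le g$, $j=1,2$).
   Context: We work over $\mathbb{C}$. A binary curve of genus $g$ is a stable curve consisting of two smooth rational components $C_1,C_2$ meeting transversally at $g+1$ points. Koszul cohomology: for a projective curve $C$ and a line bundle $L$ on $C$, $K_{p,q}(C,L)$ is the cohomology at the middle term of $$\Lambda^{p+1}H^0(L)\otimes H^0(L^{q-1})\to \Lambda^{p}H^0(L)\otimes H^0(L^{q})\to \Lambda^{p-1}H^0(L)\otimes H^0(L^{q+1}),$$ where the maps are $s_1\wedge\dots\wedge s_m\otimes u\mapsto\sum_{l}(-1)^l s_1\wedge\dots\wedge\hat{s_l}\wedge\dots\wedge s_m\otimes(s_lu)$. Property $N_p$ for a canonically embedded curve $C$ means $K_{i,j}(C,\omega_C)=0$ for all $0\le i\le p$ and all $j\ge 2$ (for $0\le p\le g-3$, with $g$ the genus of $C$, this is equivalent to $K_{p,2}(C,\omega_C)=0$). Canonical binary curves of genus $g\ge 3$ (the same construction is used for every genus at least $3$; for genus $g-1$ replace $g$ by $g-1$ throughout): let $a_{i,j}\in\mathbb{C}$ ($1\le i\le g$, $j=1,2$) be parameters, $M_j(t,u)=\prod_{r=1}^{g}(t-a_{r,j}u)$, and for $j=1,2$ let $C_j$ be the image of $$\phi_j:\mathbb{P}^1\to\mathbb{P}^{g-1},\qquad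 \phi_j(t,u)=\Big[\tfrac{M_j(t,u)}{t-a_{1,j}u},\dots,\tfrac{M_j(t,u)}{t-a_{g,j}u}\Big].$$ Then $\phi_1,\phi_2$ both send $[a_{l,j},1]$ to the $l$-th coordinate point $P_l$ ($1\le l\le g$) and $[1,0]$ to $P_{g+1}=[1,\dots,1]$. For generic $a_{i,j}$ the curve $C=C_1\cup C_2$ is a binary curve of genus $g$ with nodes $P_1,\dots,P_{g+1}$, embedded by $|\omega_C|$; such a curve is called here a canonical binary curve of genus $g$. "Generic choice of the parameters" means for all parameters in a nonempty Zariski open subset of the parameter space $\mathbb{C}^{2g}$. *)

theory Defs
  imports
    "HOL-Analysis.Analysis"
    "HOL-Computational_Algebra.Polynomial"
    "HOL-Library.Poly_Mapping"
begin

section \<open>The parameter space and its Zariski topology\<close>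

text \<open>A choice of parameters is a function \<open>a\<close> on index pairs; \<open>a (i, j)\<close> is $a_{i,j}$.\<close>

type_synonym params = "nat \<times> nat \<Rightarrow> complex"

definition param_index :: "nat \<Rightarrow> (nat \<times> nat) set" where
  "param_index g = {1..g} \<times> {1, 2}"

definition param_space :: "nat \<Rightarrow> params set" where
  "param_space g = param_index g \<rightarrow>\<^sub>E UNIV"

text \<open>Multivariate polynomials: finitely supported families of coefficients indexed by
  monomials, which are finitely supported families of exponents.\<close>

type_synonym mpolynomial = "((nat \<times> nat) \<Rightarrow>\<^sub>0 nat) \<Rightarrow>\<^sub>0 complex"

definition mpoly_eval :: "mpolynomial \<Rightarrow> params \<Rightarrow> complex" where
  "mpoly_eval P a =
     (\<Sum>m\<in>Poly_Mapping.keys P. Poly_Mapping.lookup P m *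
        (\<Prod>v\<in>Poly_Mapping.keys m. a v ^ Poly_Mapping.lookup m v))"

definition mpoly_vars :: "mpolynomial \<Rightarrow> (nat \<times> nat) set" where
  "mpoly_vars P = (\<Union>m\<in>Poly_Mapping.keys P. Poly_Mapping.keys m)"

definition zariski_open :: "nat \<Rightarrow> params set \<Rightarrow> bool" where
  "zariski_open g U \<longleftrightarrow>
     (\<exists>Ps. (\<forall>P\<in>Ps. mpoly_vars P \<subseteq> param_index g) \<and>
           U = param_space g - {a \<in> param_space g. \<forall>P\<in>Ps. mpoly_eval P a = 0})"


section \<open>The two rational curves in projective space\<close>

text \<open>A point of $\mathbb{P}^{g-1}$ is the set of nonzero multiples of a nonzero vector with
  coordinates indexed by \<open>{1..g}\<close>; a point of $\mathbb{P}^1$ is given by a nonzero pair \<open>(t, u)\<close>.\<close>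

definition proj_point :: "nat \<Rightarrow> (nat \<Rightarrow> complex) \<Rightarrow> (nat \<Rightarrow> complex) set" where
  "proj_point g v = {\<lambda>i\<in>{1..g}. c * v i | c. c \<noteq> 0}"

text \<open>The product below is the polynomial $M_j(t,u)/(t-a_{i,j}u)$.\<close>

definition phi :: "nat \<Rightarrow> params \<Rightarrow> nat \<Rightarrow> complex \<times> complex \<Rightarrow> nat \<Rightarrow> complex" where
  "phi g a j z = (\<lambda>i\<in>{1..g}. \<Prod>r\<in>{1..g} - {i}. (fst z - a (r, j) * snd z))"

definition curve :: "nat \<Rightarrow> params \<Rightarrow> nat \<Rightarrow> (nat \<Rightarrow> complex) set set" where
  "curve g a j = {proj_point g (phi g a j z) | z. z \<noteq> (0, 0)}"

definition node :: "nat \<Rightarrow> nat \<Rightarrow> (nat \<Rightarrow> complex) set" where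
  "node g l = proj_point g (\<lambda>i. if l = g + 1 \<or> i = l then 1 else 0)"

definition phi_dt :: "nat \<Rightarrow> params \<Rightarrow> nat \<Rightarrow> complex \<times> complex \<Rightarrow> nat \<Rightarrow> complex" where
  "phi_dt g a j z = (\<lambda>i\<in>{1..g}. deriv (\<lambda>t. phi g a j (t, snd z) i) (fst z))"

definition phi_du :: "nat \<Rightarrow> params \<Rightarrow> nat \<Rightarrow> complex \<times> complex \<Rightarrow> nat \<Rightarrow> complex" where
  "phi_du g a j z = (\<lambda>i\<in>{1..g}. deriv (\<lambda>u. phi g a j (fst z, u) i) (snd z))"

text \<open>By Euler's formula the span of the two partial derivatives contains \<open>phi g a j z\<close>; if the
  partial derivatives are independent, it is the affine cone over the projective tangent line
  of \<open>curve g a j\<close> at the image of \<open>z\<close>.\<close>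

definition tangent_plane :: "nat \<Rightarrow> params \<Rightarrow> nat \<Rightarrow> complex \<times> complex \<Rightarrow> (nat \<Rightarrow> complex) set" where
  "tangent_plane g a j z =
     {\<lambda>i\<in>{1..g}. \<alpha> * phi_dt g a j z i + \<beta> * phi_du g a j z i | \<alpha> \<beta>. True}"

text \<open>\<open>phi g a j\<close> is a closed embedding of $\mathbb{P}^1$: it is everywhere defined, injective on
  points and injective on tangent vectors.\<close>

definition embeds_P1 :: "nat \<Rightarrow> params \<Rightarrow> nat \<Rightarrow> bool" where
  "embeds_P1 g a j \<longleftrightarrow>
     (\<forall>z. z \<noteq> (0, 0) \<longrightarrow> (\<exists>i\<in>{1..g}. phi g a j z i \<noteq> 0)) \<and>
     (\<forall>z w. z \<noteq> (0, 0) \<and> w \<noteq> (0, 0) \<and>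
            proj_point g (phi g a j z) = proj_point g (phi g a j w)
            \<longrightarrow> fst z * snd w = fst w * snd z) \<and>
     (\<forall>z \<alpha> \<beta>. z \<noteq> (0, 0) \<and> (\<forall>i\<in>{1..g}. \<alpha> * phi_dt g a j z i + \<beta> * phi_du g a j z i = 0)
            \<longrightarrow> \<alpha> = 0 \<and> \<beta> = 0)"

text \<open>The union of the two curves is a binary curve of genus \<open>g\<close> with the prescribed nodes.
  It is stable because each component is smooth rational and carries \<open>g + 1 \<ge> 3\<close> nodes.\<close>

definition binary_curve :: "nat \<Rightarrow> params \<Rightarrow> bool" where
  "binary_curve g a \<longleftrightarrow>
     embeds_P1 g a 1 \<and> embeds_P1 g a 2 \<and>
     curve g a 1 \<inter> curve g a 2 = node g ` {1..g + 1} \<and>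
     card (node g ` {1..g + 1}) = g + 1 \<and>
     (\<forall>z w. z \<noteq> (0, 0) \<and> w \<noteq> (0, 0) \<and>
            proj_point g (phi g a 1 z) = proj_point g (phi g a 2 w)
            \<longrightarrow> tangent_plane g a 1 z \<noteq> tangent_plane g a 2 w)"


section \<open>Sections of powers of the dualizing sheaf\<close>

text \<open>A section of $\omega_C^q$ is a pair of meromorphic \<open>q\<close>-fold differentials on the two
  components (in the coordinate $t$, with $u = 1$), with poles of order at most \<open>q\<close> at the points
  over the nodes and no others, whose coefficients at the two points over each node differ by the
  factor $(-1)^q$.  For $q = 1$ this is the usual condition that the residues on the two branches
  are opposite.

  Such a differential is $F(t)\,(dt)^q / M_j(t,1)^q$ with \<open>F\<close> a polynomial, and the condition
  at $t = \infty$ is $\deg F \le q(g-1)$.  We store the pair of numerators \<open>F\<close>.\<close>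

type_synonym sect = "complex poly \<times> complex poly"

definition sect_scale :: "complex \<Rightarrow> sect \<Rightarrow> sect" where
  "sect_scale c s = (smult c (fst s), smult c (snd s))"

definition sect_mult :: "sect \<Rightarrow> sect \<Rightarrow> sect" where
  "sect_mult s s' = (fst s * fst s', snd s * snd s')"

global_interpretation sect: vector_space sect_scale
  by unfold_locales
     (auto simp: sect_scale_def smult_add_right smult_add_left)

text \<open>The coefficient of $F(t)\,(dt)^q / M_j(t,1)^q$ at the point of the \<open>j\<close>-th component over the
  node \<open>l\<close>, i.e. the coefficient of $(dx/x)^q$ for a local parameter $x$ there: $x = t - a_{l,j}$ for
  \<open>l \<le> g\<close>, and $x = 1/t$ for \<open>l = g + 1\<close>, where $dt = -dx/x^2$ gives the sign.  For $q = 1$ it is the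
  residue.\<close>

definition node_coeff :: "nat \<Rightarrow> params \<Rightarrow> nat \<Rightarrow> nat \<Rightarrow> nat \<Rightarrow> complex poly \<Rightarrow> complex" where
  "node_coeff g a q j l F =
     (if l \<le> g then poly F (a (l, j)) / (\<Prod>r\<in>{1..g} - {l}. (a (l, j) - a (r, j))) ^ q
      else (-1) ^ q * coeff F (q * (g - 1)))"

definition H0_omega :: "nat \<Rightarrow> params \<Rightarrow> nat \<Rightarrow> sect set" where
  "H0_omega g a q =
     {(F1, F2). degree F1 \<le> q * (g - 1) \<and> degree F2 \<le> q * (g - 1) \<and>
        (\<forall>l\<in>{1..g + 1}. node_coeff g a q 1 l F1 = (-1) ^ q * node_coeff g a q 2 l F2)}"

text \<open>The \<open>i\<close>-th homogeneous coordinate, pulled back to the \<open>j\<close>-th component, with $u = 1$.\<close>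

definition phi_poly :: "nat \<Rightarrow> params \<Rightarrow> nat \<Rightarrow> nat \<Rightarrow> complex poly" where
  "phi_poly g a j i = (\<Prod>r\<in>{1..g} - {i}. [:- a (r, j), 1:])"

text \<open>The embedding is given by the complete linear system of $\omega_C$: some isomorphism
  $\mathcal{O}_C(1) \cong \omega_C$ takes the homogeneous coordinates to a basis of $H^0(\omega_C)$.
  On each component both bundles have degree \<open>g - 1\<close>, so the isomorphism is a nonzero scalar
  \<open>\<kappa>\<^sub>j\<close> there.\<close>

definition embedded_by_omega :: "nat \<Rightarrow> params \<Rightarrow> bool" where
  "embedded_by_omega g a \<longleftrightarrow>
     (\<exists>\<kappa>\<^sub>1 \<kappa>\<^sub>2. \<kappa>\<^sub>1 \<noteq> 0 \<and> \<kappa>\<^sub>2 \<noteq> 0 \<and>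
        (let x = (\<lambda>i. (smult \<kappa>\<^sub>1 (phi_poly g a 1 i), smult \<kappa>\<^sub>2 (phi_poly g a 2 i)))
         in inj_on x {1..g} \<and> sect.independent (x ` {1..g}) \<and>
            sect.span (x ` {1..g}) = H0_omega g a 1))"

definition canonical_binary_curve :: "nat \<Rightarrow> params \<Rightarrow> bool" where
  "canonical_binary_curve g a \<longleftrightarrow>
     3 \<le> g \<and> a \<in> param_space g \<and> binary_curve g a \<and> embedded_by_omega g a"


section \<open>Koszul cohomology\<close>

text \<open>For subspaces \<open>V\<close>, \<open>W\<close> of \<open>sect\<close>, the space $\Lambda^p V \otimes W$ is the quotient of the vector
  space \<open>chains V W p\<close> on the symbols $s_1 \wedge \dots \wedge s_p \otimes u$ (\<open>gen [s\<^sub>1, \<dots>, s\<^sub>p] u\<close>, with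
  entries in \<open>V\<close> and \<open>u\<close> in \<open>W\<close>) by the subspace \<open>relations V W p\<close>.\<close>

type_synonym chain = "(sect list \<times> sect) \<Rightarrow>\<^sub>0 complex"

definition chain_scale :: "complex \<Rightarrow> chain \<Rightarrow> chain" where
  "chain_scale c f = Poly_Mapping.map ((*) c) f"

lemma lookup_chain_scale:
  "Poly_Mapping.lookup (chain_scale c f) x = c * Poly_Mapping.lookup f x"
  by (simp add: chain_scale_def map.rep_eq when_def)

global_interpretation chain: vector_space chain_scale
  by unfold_locales
     (auto simp: lookup_chain_scale algebra_simps lookup_add intro!: poly_mapping_eqI)

definition gen :: "sect list \<Rightarrow> sect \<Rightarrow> chain" where
  "gen ss u = Poly_Mapping.single (ss, u) 1"

definition symbols :: "sect set \<Rightarrow> sect set \<Rightarrow> nat \<Rightarrow> (sect list \<times> sect) set" where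
  "symbols V W p = {(ss, u). length ss = p \<and> set ss \<subseteq> V \<and> u \<in> W}"

definition chains :: "sect set \<Rightarrow> sect set \<Rightarrow> nat \<Rightarrow> chain set" where
  "chains V W p = {f. Poly_Mapping.keys f \<subseteq> symbols V W p}"

definition relations :: "sect set \<Rightarrow> sect set \<Rightarrow> nat \<Rightarrow> chain set" where
  "relations V W p = chain.span
    ({gen (ss[k := sect_scale c x + y]) u
        - chain_scale c (gen (ss[k := x]) u) - gen (ss[k := y]) u
        | ss u k c x y. (ss, u) \<in> symbols V W p \<and> k < p \<and> x \<in> V \<and> y \<in> V}
     \<union> {gen ss (sect_scale c u + w) - chain_scale c (gen ss u) - gen ss w
        | ss u w c. (ss, u) \<in> symbols V W p \<and> w \<in> W}
     \<union> {gen ss u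
        | ss u k l. (ss, u) \<in> symbols V W p \<and> k < l \<and> l < p \<and> ss ! k = ss ! l})"

text \<open>List positions start at 0, which shifts the exponent of the sign by one.\<close>

definition koszul_gen :: "sect list \<Rightarrow> sect \<Rightarrow> chain" where
  "koszul_gen ss u =
     (\<Sum>l<length ss. chain_scale ((-1) ^ Suc l)
        (gen (take l ss @ drop (Suc l) ss) (sect_mult (ss ! l) u)))"

definition koszul_d :: "chain \<Rightarrow> chain" where
  "koszul_d f =
     (\<Sum>(ss, u)\<in>Poly_Mapping.keys f. chain_scale (Poly_Mapping.lookup f (ss, u)) (koszul_gen ss u))"

text \<open>Exactness of
  $\Lambda^{p+1} V \otimes W_0 \to \Lambda^p V \otimes W_1 \to \Lambda^{p-1} V \otimes W_2$ at the middle term,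
  expressed on representatives.  For \<open>p = 0\<close> the last space is zero; there \<open>koszul_d f = 0\<close>, so
  the premise holds for every \<open>f\<close>, as it should, although \<open>p - 1 = 0\<close>.\<close>

definition koszul_exact :: "sect set \<Rightarrow> sect set \<Rightarrow> sect set \<Rightarrow> sect set \<Rightarrow> nat \<Rightarrow> bool" where
  "koszul_exact V W\<^sub>0 W\<^sub>1 W\<^sub>2 p \<longleftrightarrow>
     (\<forall>f\<in>chains V W\<^sub>1 p. koszul_d f \<in> relations V W\<^sub>2 (p - 1) \<longrightarrow>
        (\<exists>h\<in>chains V W\<^sub>0 (p + 1). f - koszul_d h \<in> relations V W\<^sub>1 p))"

text \<open>Vanishing of $K_{p,q}(C, L)$, where \<open>S q\<close> is $H^0(C, L^q)$.  The case distinction puts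
  $H^0(C, L^{-1}) = 0$, as for bundles \<open>L\<close> of positive degree on each component.\<close>

definition koszul_vanishes :: "(nat \<Rightarrow> sect set) \<Rightarrow> nat \<Rightarrow> nat \<Rightarrow> bool" where
  "koszul_vanishes S p q \<longleftrightarrow>
     koszul_exact (S 1) (if q = 0 then {0} else S (q - 1)) (S q) (S (q + 1)) p"

definition property_N :: "nat \<Rightarrow> nat \<Rightarrow> params \<Rightarrow> bool" where
  "property_N p g a \<longleftrightarrow> (\<forall>i\<le>p. \<forall>j\<ge>2. koszul_vanishes (H0_omega g a) i j)"

end

theory Submission
  imports Defs
begin

text \<open>
  Write $n$ for the genus of a canonical binary curve and \<open>V\<close> for the space of its homogeneous
  coordinates $x_1, \dots, x_n$.  Let $C_1, C_2$ be its components and \<open>\<Gamma>\<close> the set of its nodes,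
  that is, the coordinate points and $[1, \dots, 1]$.  A section on the curve is a pair of sections on
  $C_1$ and $C_2$ that agree on \<open>\<Gamma>\<close>.

  Rational normal curves have $K_{p,q} = 0$ for $q \ge 2$ and all \<open>p\<close>
  (\<open>rational_normal_curve_exact\<close>).  Hence a cycle in $\Lambda^p V \otimes H^0(\omega^2)$ has
  primitives on $C_1$ and on $C_2$, both in $\Lambda^{p+1} V \otimes V$, and their difference is a cycle
  for the coordinate ring of \<open>\<Gamma>\<close>.  It follows that $K_{p,2} = 0$ if and only if every cycle for
  \<open>\<Gamma>\<close> in $\Lambda^{p+1} V \otimes V$ is the sum of a cycle for $C_1$ and a cycle for $C_2$
  (\<open>tame_split_if_vanishing\<close>, \<open>vanishing_if_tame_split\<close>).

  Up to boundaries, the cycles for \<open>\<Gamma>\<close> are spanned by the tensors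
  $x_I \otimes (x_m - x_{m'})$ with $|I| = p + 1$ and $m, m' \notin I$.  These do not depend on the
  parameters, and they involve only $p + 3$ of the coordinates.  If $p + 3 < n$, there is a node
  $P_l$ whose coordinate is not involved.  The projection from $P_l$ maps the curve to the canonical
  binary curve of genus $n - 1$ for the remaining parameters, and a decomposition of the tensor there
  pulls back to one on the original curve.  So $K_{p,2}$ vanishes for the curve as soon as it
  vanishes for all its projections from coordinate points (\<open>tame_split_from_projections\<close>).

  The condition that all the tensors decompose is open: the cycles for $C_j$ are carried along when
  the parameters move, since they are given by one fixed space of tensors of polynomials in \<open>t\<close>,
  and expressing the moved decompositions in the tensors themselves gives a square matrix that is
  regular in the parameters and invertible where one starts (\<open>tame_split_open\<close>).  The given curve of
  genus $g - 1$ therefore makes the condition generic for each of the \<open>g\<close> projections of a curve of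
  genus \<open>g\<close>, and finitely many generic conditions hold together generically.

  The groups $K_{p,q}$ with $q \ge 3$ vanish for every curve of genus \<open>n\<close> if $p \le n - 3$
  (\<open>vanishing_high_degree\<close>), and $K_{n-2,3}$ does not vanish (\<open>top_nonvanishing\<close>), so that the
  hypothesis forces $p \le g - 4$.  Finally the curves with general parameters are canonical binary
  curves: it is enough that the points $(a_{i,1}, a_{i,2})$ of the plane have distinct first and
  distinct second coordinates and that the first three of them are not on a line (\<open>canonical_if_general\<close>).

  All this is done in coordinates: a chain modulo the relations is determined by its coefficients
  with respect to the wedge products of basis vectors (\<open>koszul_exact_iff\<close>).
\<close>

section \<open>The Koszul complex in coordinates\<close>

text \<open>An element of $\Lambda^\bullet V \otimes M$, where \<open>V\<close> has a basis indexed by a set of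
  numbers, is stored as the function taking a finite set of indices to the coefficient of the wedge
  product of the corresponding basis vectors in increasing order.  The next function is the sign
  of moving the \<open>l\<close>-th basis vector to its place.\<close>

definition pos_sign :: "nat \<Rightarrow> nat set \<Rightarrow> 'a::comm_ring_1" where
  "pos_sign l J = (-1) ^ card {j\<in>J. j < l}"

definition contract :: "nat \<Rightarrow> (nat set \<Rightarrow> 'a::comm_ring_1) \<Rightarrow> nat set \<Rightarrow> 'a" where
  "contract l \<phi> J = (if l \<in> J then 0 else pos_sign l J * \<phi> (insert l J))"

definition extend :: "nat \<Rightarrow> (nat set \<Rightarrow> 'a::comm_ring_1) \<Rightarrow> nat set \<Rightarrow> 'a" where
  "extend l \<phi> J = (if l \<in> J then pos_sign l J * \<phi> (J - {l}) else 0)"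

definition kd :: "nat set \<Rightarrow> (nat \<Rightarrow> 'a) \<Rightarrow> (nat set \<Rightarrow> 'a::comm_ring_1) \<Rightarrow> nat set \<Rightarrow> 'a" where
  "kd L x \<phi> J = (\<Sum>l\<in>L. x l * contract l \<phi> J)"

definition supported :: "nat set \<Rightarrow> (nat set \<Rightarrow> 'a::zero) \<Rightarrow> bool" where
  "supported L \<phi> \<longleftrightarrow> (\<forall>J. \<not> J \<subseteq> L \<longrightarrow> \<phi> J = 0)"

definition form :: "nat set \<Rightarrow> nat \<Rightarrow> (nat set \<Rightarrow> 'a::zero) \<Rightarrow> bool" where
  "form L p \<phi> \<longleftrightarrow> (\<forall>J. \<not> (J \<subseteq> L \<and> card J = p) \<longrightarrow> \<phi> J = 0)"

lemma pos_sign_sq [simp]: "pos_sign l J * pos_sign l J = (1::'a::comm_ring_1)"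
  by (simp add: pos_sign_def flip: power_mult_distrib)

lemma pos_sign_sq_left [simp]: "pos_sign l J * (pos_sign l J * c) = (c::'a::comm_ring_1)"
  by (simp flip: mult.assoc)

lemma pos_sign_insert:
  assumes "m \<notin> J"
  shows "pos_sign l (insert m J) = (if m < l then - pos_sign l J else pos_sign l J :: 'a::comm_ring_1)"
proof -
  have "{j \<in> insert m J. j < l} = (if m < l then insert m {j\<in>J. j < l} else {j\<in>J. j < l})" by auto
  moreover have "finite {j\<in>J. j < l}" by (rule finite_subset[of _ "{..<l}"]) auto
  ultimately show ?thesis using assms by (simp add: pos_sign_def)
qed

lemma pos_sign_remove:
  assumes "m \<in> J"
  shows "pos_sign l (J - {m}) = (if m < l then - pos_sign l J else pos_sign l J :: 'a::comm_ring_1)"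
  using pos_sign_insert[of m "J - {m}" l, where ?'a='a] assms by (simp add: insert_absorb split: if_splits)

lemma contract_contract: "contract l (contract m \<phi>) J = - contract m (contract l \<phi>) J"
  by (auto simp: contract_def pos_sign_insert insert_commute mult.left_commute)

lemma extend_extend: "extend l (extend m \<phi>) J = - extend m (extend l \<phi>) J"
  by (auto simp: extend_def pos_sign_remove Diff_insert2[symmetric] insert_commute mult.left_commute)

lemma contract_twice [simp]: "contract l (contract l \<phi>) = (\<lambda>J. 0)"
  by (auto simp: contract_def)

lemma contract_extend_same: "contract l (extend l \<phi>) J = \<phi> J - extend l (contract l \<phi>) J"
  by (auto simp: contract_def extend_def pos_sign_insert pos_sign_remove insert_absorb)

lemma contract_extend_diff:
  assumes "l \<noteq> m"
  shows "contract l (extend m \<phi>) J = - extend m (contract l \<phi>) J"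
proof -
  have "insert l J - {m} = insert l (J - {m})" using assms by auto
  then show ?thesis using assms
    by (auto simp: contract_def extend_def pos_sign_insert pos_sign_remove mult.left_commute)
qed

lemma contract_add: "contract l (\<lambda>J. \<phi> J + \<psi> J) J = contract l \<phi> J + contract l \<psi> J"
  and contract_diff: "contract l (\<lambda>J. \<phi> J - \<psi> J) J = contract l \<phi> J - contract l \<psi> J"
  and contract_mult: "contract l (\<lambda>J. c * \<phi> J) J = c * contract l \<phi> J"
  and contract_zero [simp]: "contract l (\<lambda>J. 0) J = 0"
  by (auto simp: contract_def algebra_simps)

lemma contract_sum: "contract l (\<lambda>J. \<Sum>i\<in>A. \<phi> i J) J = (\<Sum>i\<in>A. contract l (\<phi> i) J)"
  by (auto simp: contract_def sum_distrib_left)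

lemma extend_add: "extend l (\<lambda>J. \<phi> J + \<psi> J) J = extend l \<phi> J + extend l \<psi> J"
  and extend_mult: "extend l (\<lambda>J. c * \<phi> J) J = c * extend l \<phi> J"
  and extend_zero [simp]: "extend l (\<lambda>J. 0) J = 0"
  by (auto simp: extend_def algebra_simps)

lemma extend_sum: "extend l (\<lambda>J. \<Sum>i\<in>A. \<phi> i J) J = (\<Sum>i\<in>A. extend l (\<phi> i) J)"
  by (auto simp: extend_def sum_distrib_left)

lemma kd_add: "kd L x (\<lambda>J. \<phi> J + \<psi> J) J = kd L x \<phi> J + kd L x \<psi> J"
  by (simp add: kd_def contract_add algebra_simps sum.distrib)

lemma kd_diff: "kd L x (\<lambda>J. \<phi> J - \<psi> J) J = kd L x \<phi> J - kd L x \<psi> J"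
  by (simp add: kd_def contract_diff algebra_simps sum_subtractf)

lemma kd_mult: "kd L x (\<lambda>J. c * \<phi> J) J = c * kd L x \<phi> J"
  by (simp add: kd_def contract_mult algebra_simps sum_distrib_left)

lemma kd_zero [simp]: "kd L x (\<lambda>J. 0) J = 0"
  by (simp add: kd_def)

lemma kd_sum: "kd L x (\<lambda>J. \<Sum>i\<in>A. \<phi> i J) J = (\<Sum>i\<in>A. kd L x (\<phi> i) J)"
  unfolding kd_def contract_sum sum_distrib_left by (rule sum.swap)

lemma kd_cong: "(\<And>l. l \<in> L \<Longrightarrow> x l = y l) \<Longrightarrow> kd L x \<phi> J = kd L y \<phi> J"
  unfolding kd_def by (rule sum.cong) auto

lemma kd_scale_vars: "kd L (\<lambda>l. c * x l) \<phi> J = c * kd L x \<phi> J"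
  by (simp add: kd_def sum_distrib_left mult.assoc)

lemma contract_kd: "contract m (kd L x \<phi>) J = - kd L x (contract m \<phi>) J"
proof -
  have "contract m (kd L x \<phi>) J = contract m (\<lambda>J. \<Sum>l\<in>L. x l * contract l \<phi> J) J"
    by (simp add: kd_def[abs_def])
  also have "\<dots> = (\<Sum>l\<in>L. x l * contract m (contract l \<phi>) J)"
    by (simp add: contract_sum contract_mult)
  also have "\<dots> = - kd L x (contract m \<phi>) J"
    by (subst contract_contract) (simp add: kd_def sum_negf)
  finally show ?thesis .
qed

lemma kd_extend:
  assumes "finite L" "m \<in> L"
  shows "kd L x (extend m \<phi>) J = x m * \<phi> J - extend m (kd L x \<phi>) J"
proof -
  have ex: "extend m (kd L x \<phi>) J = (\<Sum>l\<in>L. x l * extend m (contract l \<phi>) J)"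
    by (simp add: kd_def[abs_def] extend_sum extend_mult)
  have "kd L x (extend m \<phi>) J
      = (\<Sum>l\<in>L. (if l = m then x m * \<phi> J else 0) - x l * extend m (contract l \<phi>) J)"
    unfolding kd_def
    by (rule sum.cong) (auto simp: contract_extend_same contract_extend_diff algebra_simps)
  then show ?thesis using assms by (simp add: ex sum_subtractf)
qed

text \<open>The cross terms cancel in pairs because contractions anticommute; the argument avoids
  dividing by two, so that it holds over every commutative ring.\<close>

lemma kd_kd:
  assumes "finite L"
  shows "kd L x (kd L x \<phi>) J = 0"
  using assms
proof (induction L)
  case empty
  then show ?case by (simp add: kd_def)
next
  case (insert m L)
  have spl: "kd (insert m L) x \<psi> = (\<lambda>J. x m * contract m \<psi> J + kd L x \<psi> J)" for \<psi>
    using insert by (auto simp: kd_def)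
  have "kd (insert m L) x (kd (insert m L) x \<phi>) J
     = x m * contract m (kd (insert m L) x \<phi>) J + kd L x (kd (insert m L) x \<phi>) J"
    by (subst spl) simp
  also have "\<dots> = x m * (x m * contract m (contract m \<phi>) J + contract m (kd L x \<phi>) J)
      + (x m * kd L x (contract m \<phi>) J + kd L x (kd L x \<phi>) J)"
    by (simp only: spl contract_add contract_mult kd_add kd_mult)
  finally show ?case using insert by (simp add: contract_kd)
qed

lemma supportedD: "supported L \<phi> \<Longrightarrow> \<not> J \<subseteq> L \<Longrightarrow> \<phi> J = 0"
  by (simp add: supported_def)

lemma formD: "form L p \<phi> \<Longrightarrow> \<not> (J \<subseteq> L \<and> card J = p) \<Longrightarrow> \<phi> J = 0"
  unfolding form_def by blast

lemma form_supported: "form L p \<phi> \<Longrightarrow> supported L \<phi>"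
  by (simp add: form_def supported_def)

lemma form_contract:
  assumes "form L (Suc p) \<phi>" "finite L"
  shows "form L p (contract l \<phi>)"
  unfolding form_def
proof (intro allI impI)
  fix J assume J: "\<not> (J \<subseteq> L \<and> card J = p)"
  show "contract l \<phi> J = 0"
  proof (cases "l \<in> J \<or> \<not> insert l J \<subseteq> L")
    case True
    then have "l \<in> J \<or> \<phi> (insert l J) = 0" using formD[OF assms(1)] by blast
    then show ?thesis by (auto simp: contract_def)
  next
    case False
    then have "finite J" using assms(2) by (meson finite_subset insert_subset)
    then have "card (insert l J) \<noteq> Suc p" using J False by auto
    then show ?thesis using formD[OF assms(1), of "insert l J"] by (auto simp: contract_def)
  qed
qed

lemma form_extend:
  assumes "form L p \<phi>" "finite L" "l \<in> L"
  shows "form L (Suc p) (extend l \<phi>)"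
  unfolding form_def
proof (intro allI impI)
  fix J assume J: "\<not> (J \<subseteq> L \<and> card J = Suc p)"
  show "extend l \<phi> J = 0"
  proof (cases "l \<in> J \<and> J \<subseteq> L")
    case True
    then have "finite J" using assms(2) finite_subset by blast
    then have "card (J - {l}) \<noteq> p" using J True card_Suc_Diff1 by metis
    then show ?thesis using formD[OF assms(1), of "J - {l}"] by (auto simp: extend_def)
  next
    case False
    then have "l \<notin> J \<or> \<not> J - {l} \<subseteq> L" using assms(3) by auto
    then show ?thesis using formD[OF assms(1), of "J - {l}"] by (auto simp: extend_def)
  qed
qed

lemma form_kd:
  assumes "form L (Suc p) \<phi>" "finite L"
  shows "form L p (kd L x \<phi>)"
  using form_contract[OF assms] unfolding form_def kd_def by (auto intro!: sum.neutral)

lemma form_add: "form L p \<phi> \<Longrightarrow> form L p \<psi> \<Longrightarrow> form L p (\<lambda>J. \<phi> J + \<psi> J :: 'a::comm_ring_1)"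
  and form_diff: "form L p \<phi> \<Longrightarrow> form L p \<psi> \<Longrightarrow> form L p (\<lambda>J. \<phi> J - \<psi> J :: 'a::comm_ring_1)"
  and form_mult: "form L p \<phi> \<Longrightarrow> form L p (\<lambda>J. c * \<phi> J :: 'a::comm_ring_1)"
  by (auto simp: form_def)

lemma form_map: "form L p \<phi> \<Longrightarrow> f 0 = 0 \<Longrightarrow> form L p (\<lambda>J. f (\<phi> J))"
  by (auto simp: form_def)

lemma form_zero [simp]: "form L p (\<lambda>J. 0)"
  by (auto simp: form_def)

lemma form_sum: "(\<And>i. i \<in> A \<Longrightarrow> form L p (\<phi> i)) \<Longrightarrow> form L p (\<lambda>J. \<Sum>i\<in>A. \<phi> i J :: 'a::comm_ring_1)"
  unfolding form_def by (auto intro!: sum.neutral)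

lemma kd_subset:
  assumes "supported L' \<phi>" "L' \<subseteq> L" "finite L"
  shows "kd L x \<phi> J = kd L' x \<phi> J"
proof -
  have "contract l \<phi> J = 0" if "l \<in> L - L'" for l
    using that supportedD[OF assms(1), of "insert l J"] by (auto simp: contract_def)
  then show ?thesis unfolding kd_def using assms by (intro sum.mono_neutral_right) auto
qed

lemma supported_kd:
  assumes "supported L \<phi>" shows "supported L (kd L x \<phi>)"
  unfolding supported_def
proof (intro allI impI)
  fix J assume J: "\<not> J \<subseteq> L"
  then have "contract l \<phi> J = 0" for l
    using supportedD[OF assms, of "insert l J"] by (auto simp: contract_def)
  then show "kd L x \<phi> J = 0" by (simp add: kd_def)
qed

text \<open>The differential has degree \<open>-1\<close>, so a primitive of a form may be replaced by its
  homogeneous part.\<close>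

lemma homogeneous_primitive:
  assumes "finite L" "form L p \<phi>" "supported L \<psi>" "\<And>J. kd L x \<psi> J = \<phi> J"
  shows "kd L x (\<lambda>J. if card J = Suc p then \<psi> J else 0) J = \<phi> J"
proof (cases "J \<subseteq> L \<and> card J = p")
  case True
  then have "finite J" using assms(1) finite_subset by blast
  then have "contract l (\<lambda>J. if card J = Suc p then \<psi> J else 0) J = contract l \<psi> J" for l
    using True by (simp add: contract_def)
  then show ?thesis using assms(4)[of J] by (simp add: kd_def)
next
  case False
  have "form L (Suc p) (\<lambda>J. if card J = Suc p then \<psi> J else 0)"
    using assms(3) by (auto simp: form_def supported_def)
  from form_kd[OF this assms(1)] show ?thesis using False assms(2) by (auto simp: form_def)
qed

section \<open>Rational normal curves\<close>

definition lag :: "nat set \<Rightarrow> (nat \<Rightarrow> complex) \<Rightarrow> nat \<Rightarrow> complex poly" where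
  "lag L \<alpha> l = (\<Prod>r\<in>L - {l}. [:- \<alpha> r, 1:])"

lemma lag_insert:
  assumes "finite L" "g \<notin> L" "l \<in> L"
  shows "lag (insert g L) \<alpha> l = [:- \<alpha> g, 1:] * lag L \<alpha> l"
proof -
  have "insert g L - {l} = insert g (L - {l})" using assms by auto
  then show ?thesis using assms by (simp add: lag_def)
qed

lemma degree_lag:
  assumes "finite L" "l \<in> L"
  shows "degree (lag L \<alpha> l) = card L - 1"
  using assms by (simp add: lag_def degree_prod_eq_sum_degree)

lemma coeff_lag:
  assumes "finite L" "l \<in> L"
  shows "coeff (lag L \<alpha> l) (card L - 1) = 1"
proof -
  have "lead_coeff (lag L \<alpha> l) = 1" by (simp add: lag_def lead_coeff_prod)
  then show ?thesis by (simp only: degree_lag[OF assms])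
qed

lemma poly_lag: "poly (lag L \<alpha> l) c = (\<Prod>r\<in>L - {l}. c - \<alpha> r)"
  by (simp add: lag_def poly_prod)

lemma degree_mult_bound: "degree p \<le> a \<Longrightarrow> degree q \<le> b \<Longrightarrow> a + b \<le> c \<Longrightarrow> degree (p * q) \<le> c"
  using degree_mult_le[of p q] by linarith

lemma degree_contract: "(\<And>J. degree (\<phi> J) \<le> m) \<Longrightarrow> degree (contract l \<phi> J :: complex poly) \<le> m"
  by (simp add: contract_def pos_sign_def minus_one_power_iff)

lemma degree_extend: "(\<And>J. degree (\<phi> J) \<le> m) \<Longrightarrow> degree (extend l \<phi> J :: complex poly) \<le> m"
  by (simp add: extend_def pos_sign_def minus_one_power_iff)

lemma degree_kd:
  assumes "finite L" "\<And>l. l \<in> L \<Longrightarrow> degree (x l) \<le> a" "\<And>J. degree (\<phi> J) \<le> b" "a + b \<le> c"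
  shows "degree (kd L x \<phi> J :: complex poly) \<le> c"
  unfolding kd_def
  by (rule degree_sum_le[OF assms(1)])
    (rule degree_mult_bound[OF assms(2) degree_contract[OF assms(3)] assms(4)])

lemma poly_contract: "poly (contract l \<phi> J) c = contract l (\<lambda>J. poly (\<phi> J) c) J"
  by (auto simp: contract_def pos_sign_def minus_one_power_iff)

lemma poly_kd: "poly (kd L x \<phi> J) c = kd L (\<lambda>l. poly (x l) c) (\<lambda>J. poly (\<phi> J) c) J"
  by (simp add: kd_def poly_sum poly_contract)

lemma lag_at_node:
  assumes "finite L" "l \<in> L" "m \<in> L" "l \<noteq> m"
  shows "poly (lag L \<alpha> l) (\<alpha> m) = 0"
  using assms by (auto simp: poly_lag intro!: prod_zero)

lemma lag_at_self:
  assumes "finite L" "inj_on \<alpha> L" "l \<in> L"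
  shows "poly (lag L \<alpha> l) (\<alpha> l) \<noteq> 0"
  using assms by (auto simp: poly_lag inj_on_def)

lemma dvd_linear_family:
  fixes \<phi> :: "nat set \<Rightarrow> complex poly"
  assumes "\<And>J. poly (\<phi> J) c = 0" "\<And>J. degree (\<phi> J) \<le> Suc m" "supported L \<phi>"
  obtains \<psi> where "\<And>J. \<phi> J = [:- c, 1:] * \<psi> J" "\<And>J. degree (\<psi> J) \<le> m" "supported L \<psi>"
proof -
  have "\<forall>J. \<exists>q. \<phi> J = [:- c, 1:] * q \<and> degree q \<le> m \<and> (\<phi> J = 0 \<longrightarrow> q = 0)"
  proof
    fix J
    obtain q where q: "\<phi> J = [:- c, 1:] * q" using assms(1)[of J] by (metis dvdE poly_eq_0_iff_dvd)
    have "q \<noteq> 0 \<Longrightarrow> degree (\<phi> J) = Suc (degree q)"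
      unfolding q by (subst degree_mult_eq) auto
    then have "degree q \<le> m" using assms(2)[of J] by (cases "q = 0") auto
    moreover have "\<phi> J = 0 \<longrightarrow> q = 0" unfolding q mult_eq_0_iff by simp
    ultimately show "\<exists>q. \<phi> J = [:- c, 1:] * q \<and> degree q \<le> m \<and> (\<phi> J = 0 \<longrightarrow> q = 0)"
      using q by blast
  qed
  then obtain \<psi> where "\<And>J. \<phi> J = [:- c, 1:] * \<psi> J \<and> degree (\<psi> J) \<le> m \<and> (\<phi> J = 0 \<longrightarrow> \<psi> J = 0)"
    by metis
  then show ?thesis using that[of \<psi>] assms(3) unfolding supported_def by blast
qed

text \<open>This is the vanishing $H^1(\mathbb{P}^1, \Lambda^{p+1} M(m - n + 1)) = 0$, where $M$ is the kernel
  bundle of the rational normal curve of degree $n - 1$; it holds because $M$ is a sum of line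
  bundles of degree $-1$ and $\Lambda^n M = 0$.  The proof is an induction on the number of points.  Since all basis
  polynomials but the one of \<open>g\<close> are divisible by $t - \alpha_g$, the coefficient \<open>\<beta>\<close> of \<open>g\<close> in a
  cycle is divisible by $t - \alpha_g$, and the quotient is a cycle for one point less.  A primitive
  of it removes \<open>\<beta>\<close> from the cycle.  The rest is made divisible by $t - \alpha_g$ by
  subtracting the boundary of \<open>extend g \<delta>\<close>, where \<open>\<delta>\<close> is a boundary with the right value at
  $\alpha_g$; that \<open>\<delta>\<close> can be found in low degree is where \<open>m\<close> has to be large.\<close>

theorem rational_normal_curve_exact:
  fixes \<alpha> :: "nat \<Rightarrow> complex"
  assumes "finite L" "L \<noteq> {}" "inj_on \<alpha> L" "2 * card L \<le> m + 3"
    and "supported L \<phi>" "\<And>J. degree (\<phi> J) \<le> m" "\<And>J. kd L (lag L \<alpha>) \<phi> J = 0"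
  shows "\<exists>\<psi>. supported L \<psi> \<and> (\<forall>J. degree (\<psi> J) \<le> m + 1 - card L) \<and> (\<forall>J. kd L (lag L \<alpha>) \<psi> J = \<phi> J)"
  using assms
proof (induction L arbitrary: \<phi> m rule: finite_ne_induct)
  case (singleton g)
  have x: "lag {g} \<alpha> g = 1" by (simp add: lag_def)
  have "kd {g} (lag {g} \<alpha>) (extend g \<phi>) J = \<phi> J" for J
  proof -
    have z: "kd {g} (lag {g} \<alpha>) \<phi> = (\<lambda>J. 0)" using singleton by auto
    show ?thesis by (simp add: kd_extend x z)
  qed
  moreover have "supported {g} (extend g \<phi>)"
    unfolding supported_def
  proof (intro allI impI)
    fix J assume "\<not> J \<subseteq> {g}"
    then have "\<phi> (J - {g}) = 0" using singleton(3) by (intro supportedD) auto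
    then show "extend g \<phi> J = 0" by (simp add: extend_def)
  qed
  moreover have "degree (extend g \<phi> J) \<le> m" for J by (rule degree_extend) (rule singleton)
  ultimately show ?case by (intro exI[of _ "extend g \<phi>"]) auto
next
  case (insert g L)
  define n where "n = card L"
  define \<tau> where "\<tau> = [:- \<alpha> g, 1:]"
  define x where "x = lag (insert g L) \<alpha>"
  define y where "y = lag L \<alpha>"
  have n: "1 \<le> n" using insert by (simp add: n_def card_gt_0_iff Suc_le_eq)
  have card: "card (insert g L) = Suc n" using insert by (simp add: n_def)
  have m: "2 * n \<le> m + 1" using insert.prems card by simp
  then have m1: "1 \<le> m" using n by simp
  have xL: "x l = \<tau> * y l" if "l \<in> L" for l
    using that lag_insert insert by (simp add: x_def y_def \<tau>_def)
  have degx: "degree (x g) = n" using degree_lag[of "insert g L" g \<alpha>] insert card by (simp add: x_def)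
  have degy: "degree (y l) \<le> n - 1" if "l \<in> L" for l
    using degree_lag[of L l \<alpha>] insert that by (simp add: y_def n_def)
  have xg: "poly (x g) (\<alpha> g) \<noteq> 0" unfolding x_def by (rule lag_at_self) (use insert in auto)
  have inj: "inj_on \<alpha> L" using insert by auto
  have \<tau>0: "\<tau> \<noteq> 0" by (simp add: \<tau>_def)
  have spl: "kd (insert g L) x \<psi> J = x g * contract g \<psi> J + \<tau> * kd L y \<psi> J" for \<psi> J
  proof -
    have "kd L x \<psi> J = \<tau> * kd L y \<psi> J"
      unfolding kd_scale_vars[symmetric] by (rule kd_cong) (rule xL)
    moreover have "kd (insert g L) x \<psi> J = x g * contract g \<psi> J + kd L x \<psi> J"
      using insert.hyps by (simp add: kd_def)
    ultimately show ?thesis by simp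
  qed
  have noext: "contract g \<psi> J = 0" if "supported L \<psi>" for \<psi> :: "nat set \<Rightarrow> complex poly" and J
    using supportedD[OF that, of "insert g J"] insert.hyps by (auto simp: contract_def)
  have spl0: "kd (insert g L) x \<psi> J = \<tau> * kd L y \<psi> J" if "supported L \<psi>" for \<psi> J
    by (simp add: spl noext[OF that])
  have fin: "finite (insert g L)" using insert by simp
  have IH: "\<exists>\<psi>. supported L \<psi> \<and> (\<forall>J. degree (\<psi> J) \<le> k + 1 - n) \<and> (\<forall>J. kd L y \<psi> J = \<phi>' J)"
    if "2 * n \<le> k + 3" "supported L \<phi>'" "\<And>J. degree (\<phi>' J) \<le> k" "\<And>J. kd L y \<phi>' J = 0" for k \<phi>'
    using insert.IH[of k \<phi>'] that inj by (simp add: y_def n_def)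
  have \<phi>c: "kd (insert g L) x \<phi> J = 0" for J using insert.prems by (simp add: x_def)

  define \<beta> where "\<beta> = contract g \<phi>"
  have \<beta>supp: "supported L \<beta>"
    unfolding supported_def
  proof (intro allI impI)
    fix J assume "\<not> J \<subseteq> L"
    then have "g \<in> J \<or> \<not> insert g J \<subseteq> insert g L" by auto
    then have "g \<in> J \<or> \<phi> (insert g J) = 0" using supportedD[OF insert.prems(3)] by blast
    then show "\<beta> J = 0" by (auto simp: \<beta>_def contract_def)
  qed
  have \<beta>deg: "degree (\<beta> J) \<le> m" for J unfolding \<beta>_def by (rule degree_contract) (rule insert.prems)
  have \<beta>cyc: "kd L y \<beta> J = 0" for J
  proof -
    have "kd (insert g L) x \<beta> J = - contract g (kd (insert g L) x \<phi>) J"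
      by (simp add: \<beta>_def contract_kd)
    also have "\<dots> = 0" using \<phi>c by (simp add: contract_def)
    finally have "\<tau> * kd L y \<beta> J = 0" using spl0[OF \<beta>supp] by simp
    then show ?thesis using \<tau>0 by simp
  qed
  have "poly (\<beta> J) (\<alpha> g) = 0" for J
  proof -
    have "poly (x g * \<beta> J + \<tau> * kd L y \<phi> J) (\<alpha> g) = 0" using \<phi>c[of J] unfolding spl \<beta>_def by simp
    then show ?thesis using xg by (simp add: \<tau>_def)
  qed
  then obtain \<beta>' where \<beta>': "\<And>J. \<beta> J = \<tau> * \<beta>' J" "\<And>J. degree (\<beta>' J) \<le> m - 1" "supported L \<beta>'"
    using dvd_linear_family[of \<beta> "\<alpha> g" "m - 1" L] \<beta>deg \<beta>supp m1 by (auto simp: \<tau>_def)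
  have "kd L y \<beta>' J = 0" for J
  proof -
    have "\<tau> * kd L y \<beta>' J = kd L y \<beta> J" by (simp add: kd_mult[symmetric] \<beta>'(1)[symmetric])
    then show ?thesis using \<beta>cyc \<tau>0 by simp
  qed
  then obtain \<gamma> where \<gamma>: "supported L \<gamma>" "\<And>J. degree (\<gamma> J) \<le> m - n" "\<And>J. kd L y \<gamma> J = \<beta>' J"
    using IH[of "m - 1" \<beta>'] \<beta>' m m1 n by (auto simp: le_diff_conv)
  have d\<gamma>: "kd (insert g L) x \<gamma> = \<beta>" by (rule ext) (simp add: spl0[OF \<gamma>(1)] \<gamma>(3) \<beta>'(1))

  define \<phi>2 where "\<phi>2 = (\<lambda>J. \<phi> J + kd (insert g L) x (extend g \<gamma>) J)"
  have \<phi>2_eq: "\<phi>2 J = \<phi> J - extend g \<beta> J + x g * \<gamma> J" for J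
    using fin by (simp add: \<phi>2_def kd_extend d\<gamma>)
  have \<phi>2supp: "supported L \<phi>2"
    unfolding supported_def
  proof (intro allI impI)
    fix J assume J: "\<not> J \<subseteq> L"
    show "\<phi>2 J = 0"
    proof (cases "g \<in> J")
      case True
      then have "extend g \<beta> J = \<phi> J"
        by (auto simp: \<beta>_def extend_def contract_def pos_sign_remove insert_absorb)
      then show ?thesis using supportedD[OF \<gamma>(1) J] by (simp add: \<phi>2_eq)
    next
      case False
      then have "\<not> J \<subseteq> insert g L" using J by auto
      then have "\<phi> J = 0" using insert.prems(3) by (simp add: supported_def)
      then show ?thesis using False supportedD[OF \<gamma>(1) J] by (simp add: \<phi>2_eq extend_def)
    qed
  qed
  have \<phi>2deg: "degree (\<phi>2 J) \<le> m" for J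
  proof -
    have "degree (x g * \<gamma> J) \<le> m" by (rule degree_mult_bound[of _ n _ "m - n"]) (use degx \<gamma> m n in auto)
    moreover have "degree (extend g \<beta> J) \<le> m" by (rule degree_extend) (rule \<beta>deg)
    ultimately show ?thesis unfolding \<phi>2_eq using insert.prems(4)
      by (intro degree_add_le degree_diff_le) auto
  qed
  have \<phi>2cyc: "kd L y \<phi>2 J = 0" for J
  proof -
    have "kd (insert g L) x \<phi>2 J = 0" unfolding \<phi>2_def kd_add using \<phi>c kd_kd[OF fin] by simp
    then show ?thesis using spl0[OF \<phi>2supp] \<tau>0 by simp
  qed
  then obtain \<eta> where \<eta>: "supported L \<eta>" "\<And>J. kd L y \<eta> J = \<phi>2 J"
    using IH[of m \<phi>2] \<phi>2supp \<phi>2deg m by auto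

  \<comment> \<open>The values of \<open>\<eta>\<close> at the removed point, as constants, give a boundary \<open>\<delta>\<close> for which
     \<open>\<phi>2 - x g * \<delta>\<close> vanishes at that point.\<close>
  define \<epsilon> where "\<epsilon> J = [:poly (\<eta> J) (\<alpha> g) / poly (x g) (\<alpha> g):]" for J
  define \<delta> where "\<delta> = kd L y \<epsilon>"
  have \<epsilon>supp: "supported L \<epsilon>" using \<eta>(1) by (auto simp: supported_def \<epsilon>_def)
  have \<delta>supp: "supported L \<delta>" unfolding \<delta>_def by (rule supported_kd[OF \<epsilon>supp])
  have \<delta>deg: "degree (\<delta> J) \<le> n - 1" for J
    unfolding \<delta>_def using insert.hyps degy by (intro degree_kd[of _ _ "n - 1" _ 0]) (auto simp: \<epsilon>_def)
  have \<delta>val: "poly (x g) (\<alpha> g) * poly (\<delta> J) (\<alpha> g) = poly (\<phi>2 J) (\<alpha> g)" for J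
  proof -
    have "poly (x g) (\<alpha> g) * poly (\<delta> J) (\<alpha> g)
       = kd L (\<lambda>l. poly (y l) (\<alpha> g)) (\<lambda>J. poly (x g) (\<alpha> g) * poly (\<epsilon> J) (\<alpha> g)) J"
      unfolding \<delta>_def poly_kd by (simp only: kd_mult)
    also have "\<dots> = poly (kd L y \<eta> J) (\<alpha> g)" unfolding poly_kd \<epsilon>_def using xg by simp
    finally show ?thesis by (simp add: \<eta>(2))
  qed
  have d\<delta>: "kd (insert g L) x (extend g \<delta>) J = x g * \<delta> J" for J
  proof -
    have "kd (insert g L) x \<delta> = (\<lambda>J. 0)"
      using spl0[OF \<delta>supp] kd_kd[of L y \<epsilon>] insert.hyps by (auto simp: \<delta>_def)
    then show ?thesis using fin by (simp add: kd_extend)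
  qed
  define \<phi>3 where "\<phi>3 = (\<lambda>J. \<phi>2 J - x g * \<delta> J)"
  have \<phi>3supp: "supported L \<phi>3" using \<phi>2supp \<delta>supp by (auto simp: supported_def \<phi>3_def)
  have \<phi>3deg: "degree (\<phi>3 J) \<le> Suc (m - 1)" for J
  proof -
    have "degree (x g * \<delta> J) \<le> m" by (rule degree_mult_bound[of _ n _ "n - 1"]) (use degx \<delta>deg m n in auto)
    then show ?thesis unfolding \<phi>3_def using \<phi>2deg[of J] m1 by (intro degree_diff_le) auto
  qed
  have "poly (\<phi>3 J) (\<alpha> g) = 0" for J by (simp add: \<phi>3_def \<delta>val)
  then obtain \<phi>4 where \<phi>4: "\<And>J. \<phi>3 J = \<tau> * \<phi>4 J" "\<And>J. degree (\<phi>4 J) \<le> m - 1" "supported L \<phi>4"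
    using dvd_linear_family[of \<phi>3 "\<alpha> g" "m - 1" L] \<phi>3deg \<phi>3supp by (auto simp: \<tau>_def)
  have "kd L y \<phi>4 J = 0" for J
  proof -
    have "\<tau> * kd L y \<phi>4 J = kd L y \<phi>3 J" by (simp add: kd_mult[symmetric] \<phi>4(1)[symmetric])
    also have "\<dots> = kd L y \<phi>2 J - x g * kd L y \<delta> J" by (simp add: \<phi>3_def kd_diff kd_mult)
    also have "\<dots> = 0" using \<phi>2cyc kd_kd[of L y \<epsilon>] insert.hyps by (simp add: \<delta>_def)
    finally show ?thesis using \<tau>0 by simp
  qed
  then obtain \<zeta> where \<zeta>: "supported L \<zeta>" "\<And>J. degree (\<zeta> J) \<le> m - n" "\<And>J. kd L y \<zeta> J = \<phi>4 J"
    using IH[of "m - 1" \<phi>4] \<phi>4 m m1 n by (auto simp: le_diff_conv)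

  define \<psi> where "\<psi> = (\<lambda>J. \<zeta> J + extend g \<delta> J - extend g \<gamma> J)"
  have "kd (insert g L) x \<psi> J = \<phi> J" for J
  proof -
    have "kd (insert g L) x \<psi> J = \<tau> * \<phi>4 J + x g * \<delta> J - kd (insert g L) x (extend g \<gamma>) J"
      unfolding \<psi>_def kd_diff kd_add d\<delta> by (simp add: spl0[OF \<zeta>(1)] \<zeta>(3))
    also have "\<dots> = \<phi>2 J - kd (insert g L) x (extend g \<gamma>) J"
      by (simp add: \<phi>4(1)[symmetric] \<phi>3_def)
    finally show ?thesis by (simp add: \<phi>2_def)
  qed
  moreover have "supported (insert g L) \<psi>"
    unfolding supported_def
  proof (intro allI impI)
    fix J assume J: "\<not> J \<subseteq> insert g L"
    then have "\<not> J \<subseteq> L" "\<not> J - {g} \<subseteq> L" by auto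
    then show "\<psi> J = 0"
      using supportedD[OF \<zeta>(1)] supportedD[OF \<delta>supp] supportedD[OF \<gamma>(1)]
      by (simp add: \<psi>_def extend_def)
  qed
  moreover have "degree (\<psi> J) \<le> m + 1 - card (insert g L)" for J
  proof -
    have "degree (extend g \<delta> J) \<le> m - n"
      by (rule order_trans[OF degree_extend[OF \<delta>deg]]) (use m in simp)
    moreover have "degree (extend g \<gamma> J) \<le> m - n" by (rule degree_extend) (rule \<gamma>)
    ultimately show ?thesis unfolding \<psi>_def card using \<zeta>(2)
      by (intro degree_add_le degree_diff_le) auto
  qed
  ultimately show ?case unfolding x_def by blast
qed

section \<open>Chains modulo relations in coordinates\<close>

text \<open>Maps out of the space of chains are prescribed on symbols and extended linearly.\<close>

definition lin :: "(complex \<Rightarrow> 'v \<Rightarrow> 'v) \<Rightarrow> (sect list \<times> sect \<Rightarrow> 'v) \<Rightarrow> chain \<Rightarrow> 'v::ab_group_add" where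
  "lin s h f = (\<Sum>k\<in>Poly_Mapping.keys f. s (Poly_Mapping.lookup f k) (h k))"

lemma lin_superset:
  assumes "vector_space s" "finite A" "Poly_Mapping.keys f \<subseteq> A"
  shows "lin s h f = (\<Sum>k\<in>A. s (Poly_Mapping.lookup f k) (h k))"
proof -
  interpret vector_space s by fact
  show ?thesis unfolding lin_def using assms(2,3)
    by (intro sum.mono_neutral_left) (auto simp: in_keys_iff)
qed

lemma lin_add:
  assumes "vector_space s"
  shows "lin s h (f + g) = lin s h f + lin s h g"
proof -
  interpret vector_space s by fact
  let ?A = "Poly_Mapping.keys f \<union> Poly_Mapping.keys g"
  have "Poly_Mapping.keys (f + g) \<subseteq> ?A" by (rule Poly_Mapping.keys_add)
  then show ?thesis
    by (simp add: lin_superset[OF assms, of ?A] lookup_add scale_left_distrib sum.distrib)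
qed

lemma lin_scale:
  assumes "vector_space s"
  shows "lin s h (chain_scale c f) = s c (lin s h f)"
proof -
  interpret vector_space s by fact
  have "Poly_Mapping.keys (chain_scale c f) \<subseteq> Poly_Mapping.keys f"
    by (auto simp: in_keys_iff lookup_chain_scale)
  then show ?thesis
    by (simp add: lin_superset[OF assms, of "Poly_Mapping.keys f"] lookup_chain_scale scale_sum_right)
qed

lemma lin_gen:
  assumes "vector_space s"
  shows "lin s h (gen ss u) = h (ss, u)"
proof -
  interpret vector_space s by fact
  show ?thesis by (simp add: lin_def gen_def)
qed

lemma lin_zero [simp]: "lin s h 0 = 0"
  by (simp add: lin_def)

lemma lin_uminus:
  assumes "vector_space s" shows "lin s h (- f) = - lin s h f"
  using lin_add[OF assms, of h f "- f"] by (simp add: eq_neg_iff_add_eq_0 add.commute)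

lemma lin_diff:
  assumes "vector_space s" shows "lin s h (f - g) = lin s h f - lin s h g"
  using lin_add[OF assms, of h f "- g"] lin_uminus[OF assms, of h g] by simp

lemma lin_sum:
  assumes "vector_space s"
  shows "lin s h (\<Sum>i\<in>A. f i) = (\<Sum>i\<in>A. lin s h (f i))"
  by (induction A rule: infinite_finite_induct) (auto simp: lin_add[OF assms])

lemma koszul_d_lin: "koszul_d = lin chain_scale (\<lambda>(ss, u). koszul_gen ss u)"
  by (rule ext) (simp add: koszul_d_def lin_def case_prod_beta)

lemmas lin_chain = lin_add[OF chain.vector_space_axioms] lin_scale[OF chain.vector_space_axioms]
  lin_gen[OF chain.vector_space_axioms] lin_uminus[OF chain.vector_space_axioms]
  lin_diff[OF chain.vector_space_axioms] lin_sum[OF chain.vector_space_axioms]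

lemmas lin_sect = lin_add[OF sect.vector_space_axioms] lin_scale[OF sect.vector_space_axioms]
  lin_gen[OF sect.vector_space_axioms] lin_uminus[OF sect.vector_space_axioms]
  lin_diff[OF sect.vector_space_axioms] lin_sum[OF sect.vector_space_axioms]

lemma chain_decompose: "f = (\<Sum>k\<in>Poly_Mapping.keys f. chain_scale (Poly_Mapping.lookup f k) (gen (fst k) (snd k)))"
proof (rule poly_mapping_eqI)
  fix k
  have "Poly_Mapping.lookup (\<Sum>k\<in>Poly_Mapping.keys f. chain_scale (Poly_Mapping.lookup f k) (gen (fst k) (snd k))) k
      = (\<Sum>k'\<in>Poly_Mapping.keys f. if k' = k then Poly_Mapping.lookup f k' else 0)"
    unfolding lookup_sum by (rule sum.cong) (auto simp: lookup_chain_scale gen_def lookup_single when_def)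
  then show "Poly_Mapping.lookup f k = Poly_Mapping.lookup
      (\<Sum>k\<in>Poly_Mapping.keys f. chain_scale (Poly_Mapping.lookup f k) (gen (fst k) (snd k))) k"
    by (simp add: in_keys_iff)
qed

lemma chains_subspace: "chain.subspace (chains V W p)"
proof -
  have sc: "Poly_Mapping.keys (chain_scale c f) \<subseteq> Poly_Mapping.keys f" for c f
    by (auto simp: in_keys_iff lookup_chain_scale)
  show ?thesis unfolding chain.subspace_def chains_def
  proof (intro conjI ballI allI)
    fix f g :: chain
    assume "f \<in> {f. Poly_Mapping.keys f \<subseteq> symbols V W p}" "g \<in> {f. Poly_Mapping.keys f \<subseteq> symbols V W p}"
    then show "f + g \<in> {f. Poly_Mapping.keys f \<subseteq> symbols V W p}"
      using Poly_Mapping.keys_add[of f g] by blast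
  qed (use sc in auto)
qed

lemma gen_in_chains: "length ss = p \<Longrightarrow> set ss \<subseteq> V \<Longrightarrow> u \<in> W \<Longrightarrow> gen ss u \<in> chains V W p"
  by (auto simp: gen_def chains_def symbols_def)

lemma chains_induct [consumes 1, case_names subspace gen]:
  assumes "f \<in> chains V W p" "chain.subspace S"
    and "\<And>ss u. length ss = p \<Longrightarrow> set ss \<subseteq> V \<Longrightarrow> u \<in> W \<Longrightarrow> gen ss u \<in> S"
  shows "f \<in> S"
proof -
  have "chain_scale (Poly_Mapping.lookup f k) (gen (fst k) (snd k)) \<in> S" if "k \<in> Poly_Mapping.keys f" for k
  proof -
    obtain ss u where k: "k = (ss, u)" by (cases k)
    then have "(ss, u) \<in> symbols V W p" using that assms(1) by (auto simp: chains_def)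
    then show ?thesis by (intro chain.subspace_scale[OF assms(2)] assms(3)) (auto simp: symbols_def k)
  qed
  then show ?thesis by (subst chain_decompose) (rule chain.subspace_sum[OF assms(2)])
qed

lemma relations_subspace: "chain.subspace (relations V W p)"
  by (simp add: relations_def)

lemmas rel_zero = chain.subspace_0[OF relations_subspace]
  and rel_add = chain.subspace_add[OF relations_subspace]
  and rel_diff = chain.subspace_diff[OF relations_subspace]
  and rel_scale = chain.subspace_scale[OF relations_subspace]
  and rel_neg = chain.subspace_neg[OF relations_subspace]
  and rel_sum = chain.subspace_sum[OF relations_subspace]

lemma rel_multilinear:
  "\<lbrakk>length ss = p; set ss \<subseteq> V; u \<in> W; k < p; v \<in> V; w \<in> V\<rbrakk> \<Longrightarrow>
   gen (ss[k := sect_scale c v + w]) u - chain_scale c (gen (ss[k := v]) u) - gen (ss[k := w]) u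
     \<in> relations V W p"
  unfolding relations_def symbols_def by (rule chain.span_base) blast

lemma rel_linear:
  "\<lbrakk>length ss = p; set ss \<subseteq> V; u \<in> W; w \<in> W\<rbrakk> \<Longrightarrow>
   gen ss (sect_scale c u + w) - chain_scale c (gen ss u) - gen ss w \<in> relations V W p"
  unfolding relations_def symbols_def by (rule chain.span_base) blast

lemma rel_alternating:
  "\<lbrakk>length ss = p; set ss \<subseteq> V; u \<in> W; k < l; l < p; ss ! k = ss ! l\<rbrakk> \<Longrightarrow>
   gen ss u \<in> relations V W p"
  unfolding relations_def symbols_def by (rule chain.span_base) blast

lemma relations_induct [consumes 1, case_names subspace multilinear linear alternating]:
  assumes "f \<in> relations V W p" "chain.subspace S"
    and "\<And>ss u k c v w. \<lbrakk>length ss = p; set ss \<subseteq> V; u \<in> W; k < p; v \<in> V; w \<in> V\<rbrakk> \<Longrightarrow>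
      gen (ss[k := sect_scale c v + w]) u - chain_scale c (gen (ss[k := v]) u) - gen (ss[k := w]) u \<in> S"
    and "\<And>ss u w c. \<lbrakk>length ss = p; set ss \<subseteq> V; u \<in> W; w \<in> W\<rbrakk> \<Longrightarrow>
      gen ss (sect_scale c u + w) - chain_scale c (gen ss u) - gen ss w \<in> S"
    and "\<And>ss u k l. \<lbrakk>length ss = p; set ss \<subseteq> V; u \<in> W; k < l; l < p; ss ! k = ss ! l\<rbrakk> \<Longrightarrow>
      gen ss u \<in> S"
  shows "f \<in> S"
proof -
  have "relations V W p \<subseteq> S"
    unfolding relations_def
  proof (rule chain.span_minimal[OF _ assms(2)], intro Un_least subsetI)
  qed (use assms(3-5) in \<open>auto simp: symbols_def\<close>)
  then show ?thesis using assms(1) by blast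
qed

definition wedge_left :: "sect \<Rightarrow> chain \<Rightarrow> chain" where
  "wedge_left s = lin chain_scale (\<lambda>(ss, u). gen (s # ss) u)"

lemma wedge_left_relations:
  assumes "f \<in> relations V W p" "s \<in> V"
  shows "wedge_left s f \<in> relations V W (Suc p)"
proof -
  let ?S = "{f. wedge_left s f \<in> relations V W (Suc p)}"
  have "f \<in> ?S" using assms(1)
  proof (induction rule: relations_induct)
    case subspace
    show ?case unfolding chain.subspace_def
      by (auto simp: wedge_left_def lin_chain rel_zero rel_add rel_scale)
  next
    case (multilinear ss u k c v w)
    then show ?case using rel_multilinear[of "s # ss" "Suc p" V u W "Suc k" v w c] assms(2)
      by (simp add: wedge_left_def lin_chain)
  next
    case (linear ss u w c)
    then show ?case using rel_linear[of "s # ss" "Suc p" V u W w c] assms(2)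
      by (simp add: wedge_left_def lin_chain)
  next
    case (alternating ss u k l)
    then show ?case using rel_alternating[of "s # ss" "Suc p" V u W "Suc k" "Suc l"] assms(2)
      by (simp add: wedge_left_def lin_chain)
  qed
  then show ?thesis by simp
qed

primrec wedge :: "nat set \<Rightarrow> (nat \<Rightarrow> sect \<Rightarrow> complex) \<Rightarrow> sect list \<Rightarrow> nat set \<Rightarrow> complex" where
  "wedge L c [] = (\<lambda>J. if J = {} then 1 else 0)"
| "wedge L c (s # ss) = (\<lambda>J. \<Sum>l\<in>L. c l s * extend l (wedge L c ss) J)"

text \<open>The coefficients of the class of a chain in $\Lambda^p V \otimes W$, for the coordinate
  functions \<open>c\<close> on \<open>V\<close>.\<close>

definition coords :: "nat set \<Rightarrow> (nat \<Rightarrow> sect \<Rightarrow> complex) \<Rightarrow> chain \<Rightarrow> nat set \<Rightarrow> sect" where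
  "coords L c f J = lin sect_scale (\<lambda>(ss, u). sect_scale (wedge L c ss J) u) f"

definition skd :: "nat set \<Rightarrow> (nat \<Rightarrow> sect) \<Rightarrow> (nat set \<Rightarrow> sect) \<Rightarrow> nat set \<Rightarrow> sect" where
  "skd L x \<phi> J = (kd L (\<lambda>l. fst (x l)) (\<lambda>J. fst (\<phi> J)) J, kd L (\<lambda>l. snd (x l)) (\<lambda>J. snd (\<phi> J)) J)"

lemma form_wedge: "finite L \<Longrightarrow> form L (length ss) (wedge L c ss)"
proof (induction ss)
  case Nil
  then show ?case by (auto simp: form_def)
next
  case (Cons s ss)
  then show ?case unfolding wedge.simps length_Cons
    by (intro form_sum form_mult form_extend) auto
qed

lemma wedge_anticommute:
  "(\<Sum>l\<in>L. c l s * extend l (\<lambda>J. \<Sum>m\<in>L. c m t * extend m \<phi> J) J)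
     = - (\<Sum>l\<in>L. c l t * extend l (\<lambda>J. \<Sum>m\<in>L. c m s * extend m \<phi> J) J)"
proof -
  have "(\<Sum>l\<in>L. c l s * extend l (\<lambda>J. \<Sum>m\<in>L. c m t * extend m \<phi> J) J)
      = (\<Sum>l\<in>L. \<Sum>m\<in>L. c l s * (c m t * extend l (extend m \<phi>) J))"
    by (simp add: extend_sum extend_mult sum_distrib_left)
  also have "\<dots> = (\<Sum>m\<in>L. \<Sum>l\<in>L. - (c m t * (c l s * extend m (extend l \<phi>) J)))"
    by (subst sum.swap, intro sum.cong refl, subst extend_extend) simp
  finally show ?thesis by (simp add: extend_sum extend_mult sum_distrib_left sum_negf)
qed

lemma wedge_member_zero:
  assumes "s \<in> set ss"
  shows "wedge L c (s # ss) J = (0::complex)"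
  using assms
proof (induction ss arbitrary: J)
  case (Cons t ss)
  show ?case
  proof (cases "s = t")
    case True
    have "wedge L c (t # t # ss) J = - wedge L c (t # t # ss) J"
      using wedge_anticommute[of c t t "wedge L c ss" L J] by simp
    then show ?thesis using True by (simp add: eq_neg_iff_add_eq_0)
  next
    case False
    then have "wedge L c (s # ss) = (\<lambda>J. 0)" using Cons by auto
    then have "wedge L c (t # s # ss) J = 0" by (subst wedge.simps) (simp del: wedge.simps)
    then show ?thesis using wedge_anticommute[of c s t "wedge L c ss" L J] by simp
  qed
qed auto

lemma wedge_alternating:
  assumes "k < l" "l < length ss" "ss ! k = ss ! l"
  shows "wedge L c ss J = 0"
  using assms
proof (induction ss arbitrary: k l J)
  case (Cons s ss)
  show ?case
  proof (cases k)
    case 0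
    then have "s \<in> set ss" using Cons.prems by (cases l) auto
    then show ?thesis by (rule wedge_member_zero)
  next
    case (Suc k')
    then obtain l' where "l = Suc l'" using Cons.prems by (cases l) auto
    then have "wedge L c ss = (\<lambda>J. 0)" using Cons Suc by auto
    then show ?thesis by simp
  qed
qed auto

lemma smult_sum_right: "smult r (\<Sum>i\<in>A. f i) = (\<Sum>i\<in>A. smult r (f i))"
  by (induction A rule: infinite_finite_induct) (auto simp: smult_add_right)

text \<open>The locale serves for the sections of the dualizing sheaf, and for the polynomials on one
  component alone.\<close>

locale frame =
  fixes L :: "nat set" and V :: "sect set" and x :: "nat \<Rightarrow> sect" and c :: "nat \<Rightarrow> sect \<Rightarrow> complex"
  assumes finite_L: "finite L"
    and V_subspace: "sect.subspace V"
    and x_in_V: "l \<in> L \<Longrightarrow> x l \<in> V"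
    and c_add: "c l (v + w) = c l v + c l w"
    and c_scale: "c l (sect_scale r v) = r * c l v"
    and c_x: "l \<in> L \<Longrightarrow> m \<in> L \<Longrightarrow> c l (x m) = (if l = m then 1 else 0)"
    and V_expand: "v \<in> V \<Longrightarrow> v = (\<Sum>l\<in>L. sect_scale (c l v) (x l))"
begin

lemma wedge_multilinear:
  "k < length ss \<Longrightarrow> wedge L c (ss[k := sect_scale r v + w]) J
     = r * wedge L c (ss[k := v]) J + wedge L c (ss[k := w]) J"
proof (induction ss arbitrary: k J)
  case (Cons s ss)
  show ?case
  proof (cases k)
    case 0
    then show ?thesis
      by (simp add: c_add c_scale distrib_right sum.distrib sum_distrib_left mult.assoc)
  next
    case (Suc k')
    then have "wedge L c (ss[k' := sect_scale r v + w])
        = (\<lambda>J. r * wedge L c (ss[k' := v]) J + wedge L c (ss[k' := w]) J)"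
      using Cons by auto
    then show ?thesis using Suc
      by (simp add: extend_add extend_mult distrib_left sum.distrib sum_distrib_left mult.left_commute)
  qed
qed auto

lemma coords_relations:
  assumes "f \<in> relations V W p"
  shows "coords L c f J = 0"
proof -
  have "f \<in> {f. coords L c f J = 0}" using assms
  proof (induction rule: relations_induct)
    case subspace
    show ?case unfolding chain.subspace_def by (auto simp: coords_def lin_sect)
  next
    case (multilinear ss u k r v w)
    then show ?case
      by (simp add: coords_def lin_sect wedge_multilinear sect.scale_left_distrib)
  next
    case (linear ss u w r)
    then show ?case
      by (simp add: coords_def lin_sect sect.scale_right_distrib mult.commute)
  next
    case (alternating ss u k l)
    then show ?case by (simp add: coords_def lin_sect wedge_alternating)
  qed
  then show ?thesis by simp
qed

lemma coords_chains:
  assumes "f \<in> chains V W p" "sect.subspace W"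
  shows "coords L c f J \<in> W" "form L p (coords L c f)"
proof -
  have "f \<in> {f. coords L c f J \<in> W}" using assms(1)
  proof (induction rule: chains_induct)
    case subspace
    show ?case using assms(2) unfolding chain.subspace_def
      by (auto simp: coords_def lin_sect sect.subspace_0 sect.subspace_add sect.subspace_scale)
  next
    case (gen ss u)
    then show ?case using assms(2) by (simp add: coords_def lin_sect sect.subspace_scale)
  qed
  then show "coords L c f J \<in> W" by simp
  have "f \<in> {f. form L p (coords L c f)}" using assms(1)
  proof (induction rule: chains_induct)
    case subspace
    show ?case unfolding chain.subspace_def by (auto simp: form_def coords_def lin_sect)
  next
    case (gen ss u)
    then show ?case using form_wedge[OF finite_L, of ss c] by (auto simp: coords_def lin_sect form_def)
  qed
  then show "form L p (coords L c f)" by simp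
qed

text \<open>Contraction with the coordinates is an antiderivation that takes a section \<open>s\<close> to
  multiplication by \<open>s\<close>.  The exponents of the signs start at zero here, but at one in
  \<open>koszul_gen\<close>; so \<open>kd\<close> will be the negative of the Koszul differential.\<close>

lemma kd_wedge:
  fixes \<pi> :: "sect \<Rightarrow> complex poly"
  assumes \<pi>: "\<And>v w. \<pi> (v + w) = \<pi> v + \<pi> w" "\<And>r v. \<pi> (sect_scale r v) = smult r (\<pi> v)"
    and "set ss \<subseteq> V"
  shows "kd L (\<lambda>l. \<pi> (x l)) (\<lambda>J. smult (wedge L c ss J) P) J
     = (\<Sum>l<length ss. smult ((-1) ^ l * wedge L c (take l ss @ drop (Suc l) ss) J) (\<pi> (ss ! l) * P))"
  using assms(3)
proof (induction ss arbitrary: J)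
  case Nil
  then show ?case by (auto simp: kd_def contract_def intro!: sum.neutral)
next
  case (Cons s ss)
  let ?\<psi> = "\<lambda>J. smult (wedge L c ss J) P"
  have \<pi>0: "\<pi> 0 = 0" using \<pi>(1)[of 0 0] by simp
  have \<pi>sum: "\<pi> (sum f A) = (\<Sum>a\<in>A. \<pi> (f a))" for f and A :: "nat set"
    by (induction A rule: infinite_finite_induct) (auto simp: \<pi> \<pi>0)
  have "\<pi> s = \<pi> (\<Sum>m\<in>L. sect_scale (c m s) (x m))"
    using V_expand[of s] Cons.prems by (intro arg_cong[where f = \<pi>]) simp
  then have s: "\<pi> s = (\<Sum>m\<in>L. smult (c m s) (\<pi> (x m)))" by (simp only: \<pi>sum \<pi>(2))
  have ext: "extend m (\<lambda>J. smult (r * f J) Q) J = smult (r * extend m f J) Q"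
    for m r f and J :: "nat set" and Q :: "complex poly"
    by (auto simp: extend_def pos_sign_def minus_one_power_iff)
  have eq: "(\<lambda>J. smult (wedge L c (s # ss) J) P) = (\<lambda>J. \<Sum>m\<in>L. [:c m s:] * extend m ?\<psi> J)"
    using ext[of _ 1 "wedge L c ss" P] by (auto simp: smult_sum mult.commute)
  have "kd L (\<lambda>l. \<pi> (x l)) (\<lambda>J. smult (wedge L c (s # ss) J) P) J
     = (\<Sum>m\<in>L. [:c m s:] * (\<pi> (x m) * ?\<psi> J - extend m (kd L (\<lambda>l. \<pi> (x l)) ?\<psi>) J))"
    unfolding eq kd_sum kd_mult using finite_L by (intro sum.cong refl) (simp add: kd_extend)
  also have "\<dots> = (\<Sum>m\<in>L. smult (c m s) (\<pi> (x m)) * ?\<psi> J)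
      - (\<Sum>m\<in>L. smult (c m s) (extend m (kd L (\<lambda>l. \<pi> (x l)) ?\<psi>) J))"
    by (simp add: sum_subtractf[symmetric] smult_diff_right mult.commute)
  also have "(\<Sum>m\<in>L. smult (c m s) (\<pi> (x m)) * ?\<psi> J) = \<pi> s * ?\<psi> J"
    unfolding s by (rule sum_distrib_right[symmetric])
  also have "kd L (\<lambda>l. \<pi> (x l)) ?\<psi>
     = (\<lambda>J. \<Sum>l<length ss. smult ((-1) ^ l * wedge L c (take l ss @ drop (Suc l) ss) J) (\<pi> (ss ! l) * P))"
    using Cons by auto
  also have "(\<Sum>m\<in>L. smult (c m s) (extend m \<dots> J))
     = (\<Sum>m\<in>L. \<Sum>l<length ss. smult ((-1) ^ l * (c m s * extend m (wedge L c (take l ss @ drop (Suc l) ss)) J))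
         (\<pi> (ss ! l) * P))"
    unfolding extend_sum ext by (simp add: smult_sum_right mult.left_commute)
  also have "\<dots> = (\<Sum>l<length ss. smult ((-1) ^ l * wedge L c (s # take l ss @ drop (Suc l) ss) J) (\<pi> (ss ! l) * P))"
    by (subst sum.swap) (simp only: wedge.simps sum_distrib_left smult_sum)
  finally show ?case
    by (simp add: sum.lessThan_Suc_shift sum_negf del: wedge.simps sum.lessThan_Suc)
qed

lemma coords_koszul_gen:
  fixes \<pi> :: "sect \<Rightarrow> complex poly"
  assumes \<pi>: "\<And>v w. \<pi> (v + w) = \<pi> v + \<pi> w" "\<And>r v. \<pi> (sect_scale r v) = smult r (\<pi> v)"
    "\<And>v w. \<pi> (sect_mult v w) = \<pi> v * \<pi> w"
    and "set ss \<subseteq> V"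
  shows "\<pi> (coords L c (koszul_gen ss u) J) = - kd L (\<lambda>l. \<pi> (x l)) (\<lambda>J. \<pi> (coords L c (gen ss u) J)) J"
proof -
  have \<pi>0: "\<pi> 0 = 0" using \<pi>(1)[of 0 0] by simp
  have \<pi>sum: "\<pi> (sum f A) = (\<Sum>a\<in>A. \<pi> (f a))" for f and A :: "nat set"
    by (induction A rule: infinite_finite_induct) (auto simp: \<pi> \<pi>0)
  have "\<pi> (coords L c (koszul_gen ss u) J)
    = (\<Sum>l<length ss. - smult ((-1) ^ l * wedge L c (take l ss @ drop (Suc l) ss) J) (\<pi> (ss ! l) * \<pi> u))"
    unfolding koszul_gen_def coords_def lin_sect \<pi>sum
    by (simp add: \<pi> flip: sect.scale_minus_left)
  also have "\<dots> = - kd L (\<lambda>l. \<pi> (x l)) (\<lambda>J. smult (wedge L c ss J) (\<pi> u)) J"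
    by (subst kd_wedge[OF \<pi>(1,2) assms(4)]) (auto simp: sum_negf)
  finally show ?thesis by (simp add: coords_def lin_sect \<pi>)
qed

lemma coords_koszul_d:
  assumes "f \<in> chains V W p"
  shows "coords L c (koszul_d f) J = - skd L x (coords L c f) J"
proof -
  have "f \<in> {f. coords L c (koszul_d f) J = - skd L x (coords L c f) J}" using assms
  proof (induction rule: chains_induct)
    case subspace
    show ?case unfolding chain.subspace_def
    proof (intro conjI allI ballI)
      show "0 \<in> {f. coords L c (koszul_d f) J = - skd L x (coords L c f) J}"
        by (simp add: koszul_d_lin coords_def skd_def zero_prod_def)
    next
      fix f g assume fg: "f \<in> {f. coords L c (koszul_d f) J = - skd L x (coords L c f) J}"
        "g \<in> {f. coords L c (koszul_d f) J = - skd L x (coords L c f) J}"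
      have "coords L c (koszul_d (f + g)) J = coords L c (koszul_d f) J + coords L c (koszul_d g) J"
        by (simp add: koszul_d_lin coords_def lin_chain lin_sect)
      moreover have "coords L c (f + g) = (\<lambda>J. coords L c f J + coords L c g J)"
        by (auto simp: coords_def lin_sect)
      ultimately show "f + g \<in> {f. coords L c (koszul_d f) J = - skd L x (coords L c f) J}"
        using fg by (simp add: skd_def kd_add)
    next
      fix r f assume f: "f \<in> {f. coords L c (koszul_d f) J = - skd L x (coords L c f) J}"
      have "coords L c (koszul_d (chain_scale r f)) J = sect_scale r (coords L c (koszul_d f) J)"
        by (simp add: koszul_d_lin coords_def lin_chain lin_sect)
      moreover have e: "coords L c (chain_scale r f) = (\<lambda>J. sect_scale r (coords L c f J))"
        by (auto simp: coords_def lin_sect)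
      moreover have "skd L x (coords L c (chain_scale r f)) J = sect_scale r (skd L x (coords L c f) J)"
        using kd_mult[of L _ "[:r:]"] unfolding e by (simp add: skd_def sect_scale_def)
      ultimately show "chain_scale r f \<in> {f. coords L c (koszul_d f) J = - skd L x (coords L c f) J}"
        using f by simp
    qed
  next
    case (gen ss u)
    have "koszul_d (gen ss u) = koszul_gen ss u" by (simp add: koszul_d_lin lin_chain)
    moreover have "fst (coords L c (koszul_gen ss u) J) = - kd L (\<lambda>l. fst (x l)) (\<lambda>J. fst (coords L c (gen ss u) J)) J"
      "snd (coords L c (koszul_gen ss u) J) = - kd L (\<lambda>l. snd (x l)) (\<lambda>J. snd (coords L c (gen ss u) J)) J"
      using gen by (intro coords_koszul_gen; simp add: sect_scale_def sect_mult_def)+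
    ultimately show ?case by (simp add: skd_def prod_eq_iff)
  qed
  then show ?thesis by simp
qed

end

text \<open>Transposing the first two entries changes the sign modulo the relations: expand the symbol
  with the sum of both entries at both places.\<close>

lemma rel_transpose:
  assumes "sect.subspace V" "length r + 2 = p" "set r \<subseteq> V" "v \<in> V" "w \<in> V" "u \<in> W"
  shows "gen (v # w # r) u + gen (w # v # r) u \<in> relations V W p"
proof -
  let ?R = "relations V W p"
  have vw: "v + w \<in> V" using assms by (simp add: sect.subspace_add)
  have 1: "gen ((v + w) # (v + w) # r) u - gen (v # (v + w) # r) u - gen (w # (v + w) # r) u \<in> ?R"
    using rel_multilinear[of "v # (v + w) # r" p V u W 0 v w 1] assms vw by simp
  have 2: "gen (s # (v + w) # r) u - gen (s # v # r) u - gen (s # w # r) u \<in> ?R" if "s \<in> V" for s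
    using rel_multilinear[of "s # v # r" p V u W 1 v w 1] assms that by simp
  have 3: "gen (s # s # r) u \<in> ?R" if "s \<in> V" for s
    using rel_alternating[of "s # s # r" p V u W 0 1] assms that by simp
  have "gen (v # w # r) u + gen (w # v # r) u =
     gen ((v + w) # (v + w) # r) u
     - (gen ((v + w) # (v + w) # r) u - gen (v # (v + w) # r) u - gen (w # (v + w) # r) u)
     - (gen (v # (v + w) # r) u - gen (v # v # r) u - gen (v # w # r) u)
     - (gen (w # (v + w) # r) u - gen (w # v # r) u - gen (w # w # r) u)
     - gen (v # v # r) u - gen (w # w # r) u"
    by (simp add: algebra_simps)
  also have "\<dots> \<in> ?R" by (intro rel_diff 1 2 3 vw assms)
  finally show ?thesis .
qed

context frame
begin

definition normal_chain :: "nat \<Rightarrow> (nat set \<Rightarrow> sect) \<Rightarrow> chain" where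
  "normal_chain p \<psi> = (\<Sum>I\<in>{I. I \<subseteq> L \<and> card I = p}. gen (map x (sorted_list_of_set I)) (\<psi> I))"

lemma index_sets_finite [simp]: "finite {I. I \<subseteq> L \<and> card I = p}"
  by (rule finite_subset[of _ "Pow L"]) (use finite_L in auto)

lemma basis_list:
  assumes "I \<subseteq> L" "card I = p"
  shows "length (map x (sorted_list_of_set I)) = p" "set (map x (sorted_list_of_set I)) \<subseteq> V"
  using assms finite_subset[OF assms(1) finite_L] x_in_V by auto

lemma normal_chain_in_chains:
  assumes "\<And>I. \<psi> I \<in> W" shows "normal_chain p \<psi> \<in> chains V W p"
  unfolding normal_chain_def
proof (rule chain.subspace_sum[OF chains_subspace])
  fix I assume "I \<in> {I. I \<subseteq> L \<and> card I = p}"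
  then show "gen (map x (sorted_list_of_set I)) (\<psi> I) \<in> chains V W p"
    using basis_list[of I p] assms by (intro gen_in_chains) auto
qed

lemma wedge_basis:
  "sorted is \<Longrightarrow> distinct is \<Longrightarrow> set is \<subseteq> L \<Longrightarrow>
   wedge L c (map x is) J = (if J = set is then 1 else 0)"
proof (induction "is" arbitrary: J)
  case (Cons i "is")
  then have w: "wedge L c (map x is) = (\<lambda>J. if J = set is then 1 else 0)" by auto
  have i: "i \<in> L" "\<And>k. k \<in> set is \<Longrightarrow> i < k" "i \<notin> set is"
    using Cons.prems by (auto simp: order.strict_iff_order)
  have "wedge L c (map x (i # is)) J = (\<Sum>l\<in>L. if l = i then extend i (wedge L c (map x is)) J else 0)"
    unfolding list.map wedge.simps using i c_x by (intro sum.cong) auto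
  also have "\<dots> = extend i (wedge L c (map x is)) J" using i finite_L by simp
  also have "\<dots> = (if J = set (i # is) then 1 else 0)"
  proof (cases "i \<in> J \<and> J - {i} = set is")
    case True
    then have J: "J = insert i (set is)" by auto
    have e: "{j \<in> J. j < i} = {}" using J i by force
    have "pos_sign i J = (1::complex)" unfolding pos_sign_def e by simp
    then show ?thesis using True J i by (simp add: extend_def w)
  next
    case False
    then show ?thesis using i by (auto simp: extend_def w)
  qed
  finally show ?case .
qed auto

lemma coords_normal_chain:
  assumes "form L p \<psi>"
  shows "coords L c (normal_chain p \<psi>) J = \<psi> J"
proof -
  have "coords L c (normal_chain p \<psi>) J
    = (\<Sum>I\<in>{I. I \<subseteq> L \<and> card I = p}. if I = J then \<psi> J else 0)"
    unfolding normal_chain_def coords_def lin_sect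
  proof (rule sum.cong[OF refl])
    fix I assume "I \<in> {I. I \<subseteq> L \<and> card I = p}"
    then have "I \<subseteq> L" "finite I" using finite_subset[OF _ finite_L] by auto
    then show "(case (map x (sorted_list_of_set I), \<psi> I) of (ss, u) \<Rightarrow> sect_scale (wedge L c ss J) u)
      = (if I = J then \<psi> J else 0)"
      by (simp add: wedge_basis)
  qed
  also have "\<dots> = \<psi> J" using formD[OF assms, of J] by auto
  finally show ?thesis .
qed

text \<open>It is enough to know that every chain is congruent to some normal chain, with unspecified
  coefficients, since the coefficients can then be read off from its coordinates.  This spares the
  computation of signs in the following reduction.\<close>

definition reducible :: "sect set \<Rightarrow> nat \<Rightarrow> chain set" where
  "reducible W p = {f. \<exists>\<psi>. (\<forall>I. \<psi> I \<in> W) \<and> f - normal_chain p \<psi> \<in> relations V W p}"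

lemma normal_chain_scale_add:
  assumes "\<And>I. \<phi> I \<in> W" "\<And>I. \<psi> I \<in> W"
  shows "normal_chain p (\<lambda>I. sect_scale r (\<phi> I) + \<psi> I)
     - (chain_scale r (normal_chain p \<phi>) + normal_chain p \<psi>) \<in> relations V W p"
proof -
  have "normal_chain p (\<lambda>I. sect_scale r (\<phi> I) + \<psi> I)
     - (chain_scale r (normal_chain p \<phi>) + normal_chain p \<psi>)
   = (\<Sum>I\<in>{I. I \<subseteq> L \<and> card I = p}.
        gen (map x (sorted_list_of_set I)) (sect_scale r (\<phi> I) + \<psi> I)
        - chain_scale r (gen (map x (sorted_list_of_set I)) (\<phi> I))
        - gen (map x (sorted_list_of_set I)) (\<psi> I))"
    by (simp add: normal_chain_def chain.scale_sum_right sum_subtractf sum.distrib algebra_simps)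
  also have "\<dots> \<in> relations V W p"
    using basis_list assms by (intro rel_sum rel_linear) auto
  finally show ?thesis .
qed

lemma reducible_scale_add:
  assumes "sect.subspace W" "f \<in> reducible W p" "g \<in> reducible W p"
  shows "chain_scale r f + g \<in> reducible W p"
proof -
  obtain \<phi> \<psi> where *: "\<And>I. \<phi> I \<in> W" "f - normal_chain p \<phi> \<in> relations V W p"
    "\<And>I. \<psi> I \<in> W" "g - normal_chain p \<psi> \<in> relations V W p"
    using assms(2,3) by (auto simp: reducible_def)
  have "chain_scale r (f - normal_chain p \<phi>) + (g - normal_chain p \<psi>)
     - (normal_chain p (\<lambda>I. sect_scale r (\<phi> I) + \<psi> I)
        - (chain_scale r (normal_chain p \<phi>) + normal_chain p \<psi>)) \<in> relations V W p"
    by (intro rel_add rel_diff rel_scale normal_chain_scale_add *)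
  then have "chain_scale r f + g - normal_chain p (\<lambda>I. sect_scale r (\<phi> I) + \<psi> I) \<in> relations V W p"
    by (simp add: algebra_simps)
  then show ?thesis unfolding reducible_def
    using * assms(1) by (intro CollectI exI[of _ "\<lambda>I. sect_scale r (\<phi> I) + \<psi> I"])
      (auto simp: sect.subspace_add sect.subspace_scale)
qed

lemma relations_reducible:
  assumes "sect.subspace W" "f \<in> relations V W p" shows "f \<in> reducible W p"
proof -
  have 0: "0 \<in> W" using assms(1) by (rule sect.subspace_0)
  have "normal_chain p (\<lambda>I. 0) - (chain_scale 1 (normal_chain p (\<lambda>I. 0)) + normal_chain p (\<lambda>I. 0))
     \<in> relations V W p"
    using normal_chain_scale_add[of "\<lambda>I. 0" W "\<lambda>I. 0" p 1] 0 by simp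
  then have "f + (normal_chain p (\<lambda>I. 0)
     - (chain_scale 1 (normal_chain p (\<lambda>I. 0)) + normal_chain p (\<lambda>I. 0))) \<in> relations V W p"
    using assms(2) by (intro rel_add)
  then show ?thesis using 0 by (auto simp: reducible_def intro!: exI[of _ "\<lambda>I. 0"])
qed

lemma reducible_subspace: "sect.subspace W \<Longrightarrow> chain.subspace (reducible W p)"
  using reducible_scale_add[of W _ p _ 1] reducible_scale_add[of W _ p 0]
    relations_reducible[of W 0 p] rel_zero[of V W p]
  unfolding chain.subspace_def by auto

lemma reducible_cong:
  assumes "sect.subspace W" "f - g \<in> relations V W p" "g \<in> reducible W p"
  shows "f \<in> reducible W p"
  using chain.subspace_add[OF reducible_subspace[OF assms(1)] relations_reducible[OF assms(1,2)] assms(3)]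
  by simp

lemma insort_sign:
  assumes "u \<in> W" "length is + 1 = p" "set is \<subseteq> L" "i \<in> L"
  shows "\<exists>r. gen (map x (i # is)) u - chain_scale r (gen (map x (insort i is)) u) \<in> relations V W p"
  using assms
proof (induction "is" arbitrary: p)
  case Nil
  then show ?case by (intro exI[of _ 1]) (simp add: rel_zero)
next
  case (Cons k "is")
  show ?case
  proof (cases "i \<le> k")
    case True
    then show ?thesis by (intro exI[of _ 1]) (simp add: rel_zero)
  next
    case False
    let ?R = "relations V W p"
    obtain r where "gen (map x (i # is)) u - chain_scale r (gen (map x (insort i is)) u)
       \<in> relations V W (p - 1)"
      using Cons.IH[of "p - 1"] Cons.prems by auto
    then have "wedge_left (x k) (gen (map x (i # is)) u - chain_scale r (gen (map x (insort i is)) u)) \<in> ?R"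
      using wedge_left_relations[of _ V W "p - 1" "x k"] Cons.prems x_in_V by auto
    then have 1: "gen (x k # x i # map x is) u - chain_scale r (gen (x k # map x (insort i is)) u) \<in> ?R"
      by (simp add: wedge_left_def lin_chain)
    have 2: "gen (x i # x k # map x is) u + gen (x k # x i # map x is) u \<in> ?R"
      using Cons.prems x_in_V by (intro rel_transpose V_subspace) auto
    have "(gen (x i # x k # map x is) u + gen (x k # x i # map x is) u)
      - (gen (x k # x i # map x is) u - chain_scale r (gen (x k # map x (insort i is)) u)) \<in> ?R"
      by (rule rel_diff[OF 2 1])
    then show ?thesis using False by (intro exI[of _ "- r"]) (simp add: algebra_simps)
  qed
qed

lemma reducible_basis:
  assumes W: "sect.subspace W" and u: "u \<in> W" and I: "I \<subseteq> L" "card I = p"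
  shows "gen (map x (sorted_list_of_set I)) u \<in> reducible W p"
proof -
  let ?b = "\<lambda>I. map x (sorted_list_of_set I)"
  have 0: "0 \<in> W" using W by (rule sect.subspace_0)
  have z: "gen (?b J) 0 \<in> relations V W p" if "J \<subseteq> L" "card J = p" for J
    using rel_neg[OF rel_linear[of "?b J" p V 0 W 0 1]] basis_list[OF that] 0 by simp
  have "normal_chain p (\<lambda>J. if J = I then u else 0)
     = gen (?b I) u + (\<Sum>J\<in>{J. J \<subseteq> L \<and> card J = p} - {I}. gen (?b J) 0)"
    unfolding normal_chain_def using I by (subst sum.remove[of _ I]) auto
  then have "gen (?b I) u - normal_chain p (\<lambda>J. if J = I then u else 0)
     = - (\<Sum>J\<in>{J. J \<subseteq> L \<and> card J = p} - {I}. gen (?b J) 0)" by simp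
  also have "\<dots> \<in> relations V W p" using z by (intro rel_neg rel_sum) auto
  finally show ?thesis using u 0
    by (auto simp: reducible_def intro!: exI[of _ "\<lambda>J. if J = I then u else 0"])
qed

lemma reducible_cons_basis:
  assumes W: "sect.subspace W" and u: "u \<in> W" and I: "I \<subseteq> L" "card I = p" and i: "i \<in> L"
  shows "gen (x i # map x (sorted_list_of_set I)) u \<in> reducible W (Suc p)"
proof -
  let ?l = "sorted_list_of_set I"
  have fin: "finite I" using I finite_L finite_subset by blast
  show ?thesis
  proof (cases "i \<in> I")
    case True
    then obtain k where "k < length ?l" "?l ! k = i" using fin by (metis in_set_conv_nth set_sorted_list_of_set)
    then have "gen (x i # map x ?l) u \<in> relations V W (Suc p)"
      using basis_list[OF I] i u x_in_V fin I
      by (intro rel_alternating[of _ _ _ _ _ 0 "Suc k"]) auto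
    then show ?thesis by (rule relations_reducible[OF W])
  next
    case False
    obtain r where r: "gen (map x (i # ?l)) u - chain_scale r (gen (map x (insort i ?l)) u) \<in> relations V W (Suc p)"
      using insort_sign[of u W ?l "Suc p" i] u I i fin by auto
    have "insort i ?l = sorted_list_of_set (insert i I)" using False fin by simp
    moreover have "gen (map x (sorted_list_of_set (insert i I))) u \<in> reducible W (Suc p)"
      using False fin I i by (intro reducible_basis W u) auto
    ultimately have "chain_scale r (gen (map x (insort i ?l)) u) \<in> reducible W (Suc p)"
      using chain.subspace_scale[OF reducible_subspace[OF W]] by simp
    then show ?thesis using reducible_cong[OF W r] by simp
  qed
qed

lemma reducible_cons:
  assumes W: "sect.subspace W" and u: "u \<in> W" and I: "I \<subseteq> L" "card I = p" and s: "s \<in> V"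
  shows "gen (s # map x (sorted_list_of_set I)) u \<in> reducible W (Suc p)"
proof -
  let ?r = "map x (sorted_list_of_set I)"
  note b = basis_list[OF I]
  have V0: "0 \<in> V" using V_subspace by (rule sect.subspace_0)
  have "gen ((\<Sum>l\<in>A. sect_scale (c l s) (x l)) # ?r) u \<in> reducible W (Suc p)" if "A \<subseteq> L" for A
    using finite_subset[OF that finite_L] that
  proof (induction A rule: finite_induct)
    case empty
    have "- gen (0 # ?r) u \<in> relations V W (Suc p)"
      using rel_multilinear[of "0 # ?r" "Suc p" V u W 0 0 0 1] V0 b u by simp
    then have "- (- gen (0 # ?r) u) \<in> relations V W (Suc p)" by (rule rel_neg)
    then show ?case using relations_reducible[OF W] by simp
  next
    case (insert l A)
    let ?v = "\<Sum>l\<in>A. sect_scale (c l s) (x l)"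
    have v: "?v \<in> V" using insert.prems x_in_V
      by (intro sect.subspace_sum[OF V_subspace] sect.subspace_scale[OF V_subspace]) auto
    have "gen ((sect_scale (c l s) (x l) + ?v) # ?r) u
       - (chain_scale (c l s) (gen (x l # ?r) u) + gen (?v # ?r) u) \<in> relations V W (Suc p)"
      using rel_multilinear[of "0 # ?r" "Suc p" V u W 0 "x l" ?v "c l s"] V0 b u v x_in_V insert.prems
      by (simp add: algebra_simps)
    moreover have "chain_scale (c l s) (gen (x l # ?r) u) + gen (?v # ?r) u \<in> reducible W (Suc p)"
      using insert by (intro reducible_scale_add W reducible_cons_basis u I) auto
    ultimately show ?case using reducible_cong[OF W] insert.hyps by simp
  qed
  from this[of L] show ?thesis using V_expand[OF s] by simp
qed

lemma reducible_gen:
  assumes W: "sect.subspace W" and u: "u \<in> W"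
  shows "set ss \<subseteq> V \<Longrightarrow> gen ss u \<in> reducible W (length ss)"
proof (induction ss)
  case Nil
  then show ?case using reducible_basis[OF W u, of "{}" 0] by simp
next
  case (Cons s ss)
  let ?p = "length ss"
  obtain \<psi> where \<psi>: "\<And>I. \<psi> I \<in> W" "gen ss u - normal_chain ?p \<psi> \<in> relations V W ?p"
    using Cons by (auto simp: reducible_def)
  have "gen (s # ss) u - (\<Sum>I\<in>{I. I \<subseteq> L \<and> card I = ?p}. gen (s # map x (sorted_list_of_set I)) (\<psi> I))
     \<in> relations V W (Suc ?p)"
    using wedge_left_relations[OF \<psi>(2), of s] Cons.prems
    by (simp add: wedge_left_def normal_chain_def lin_chain)
  moreover have "(\<Sum>I\<in>{I. I \<subseteq> L \<and> card I = ?p}. gen (s # map x (sorted_list_of_set I)) (\<psi> I))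
     \<in> reducible W (Suc ?p)"
    using Cons.prems by (intro chain.subspace_sum[OF reducible_subspace[OF W]] reducible_cons W \<psi>) auto
  ultimately show ?case using reducible_cong[OF W] by simp
qed

text \<open>The chain is congruent to a normal chain, whose coefficients are the coordinates of the
  chain, hence zero.\<close>

lemma relations_if_coords_zero:
  assumes W: "sect.subspace W" and f: "f \<in> chains V W p" and 0: "\<And>J. coords L c f J = 0"
  shows "f \<in> relations V W p"
proof -
  have "f \<in> reducible W p" using f
  proof (induction rule: chains_induct)
    case subspace
    show ?case by (rule reducible_subspace[OF W])
  next
    case (gen ss u)
    then show ?case using reducible_gen[OF W] by blast
  qed
  then obtain \<psi> where \<psi>: "\<And>I. \<psi> I \<in> W" "f - normal_chain p \<psi> \<in> relations V W p"
    by (auto simp: reducible_def)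
  define \<psi>' where "\<psi>' I = (if I \<subseteq> L \<and> card I = p then \<psi> I else 0)" for I
  have n: "normal_chain p \<psi>' = normal_chain p \<psi>"
    unfolding normal_chain_def \<psi>'_def by (rule sum.cong) auto
  have \<psi>'0: "\<psi>' J = 0" for J
  proof -
    have "coords L c (f - normal_chain p \<psi>') J = 0" using coords_relations \<psi>(2) n by metis
    moreover have "form L p \<psi>'" by (auto simp: form_def \<psi>'_def)
    ultimately show ?thesis using coords_normal_chain[of p \<psi>' J] 0[of J]
      by (simp add: coords_def lin_sect)
  qed
  have 0: "0 \<in> W" using W by (rule sect.subspace_0)
  have g0: "gen ss 0 \<in> relations V W p" if "length ss = p" "set ss \<subseteq> V" for ss
    using rel_neg[OF rel_linear[of ss p V 0 W 0 1]] that 0 by simp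
  have "normal_chain p \<psi>' \<in> relations V W p"
    unfolding normal_chain_def
  proof (rule rel_sum)
    fix I assume "I \<in> {I. I \<subseteq> L \<and> card I = p}"
    then show "gen (map x (sorted_list_of_set I)) (\<psi>' I) \<in> relations V W p"
      using g0 basis_list[of I p] \<psi>'0 by simp
  qed
  then have "(f - normal_chain p \<psi>) + normal_chain p \<psi> \<in> relations V W p"
    using rel_add[OF \<psi>(2)] n by metis
  then show ?thesis by simp
qed

lemma koszul_d_chains:
  assumes "f \<in> chains V W (Suc p)" "sect.subspace W'" "\<And>v u. v \<in> V \<Longrightarrow> u \<in> W \<Longrightarrow> sect_mult v u \<in> W'"
  shows "koszul_d f \<in> chains V W' p"
proof -
  have "f \<in> {f. koszul_d f \<in> chains V W' p}" using assms(1)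
  proof (induction rule: chains_induct)
    case subspace
    show ?case unfolding chain.subspace_def koszul_d_lin
      using chains_subspace[of V W' p]
      by (auto simp: lin_chain chain.subspace_0 chain.subspace_add chain.subspace_scale)
  next
    case (gen ss u)
    have "gen (take l ss @ drop (Suc l) ss) (sect_mult (ss ! l) u) \<in> chains V W' p" if "l < length ss" for l
    proof (rule gen_in_chains)
      show "length (take l ss @ drop (Suc l) ss) = p" using that gen by simp
      show "set (take l ss @ drop (Suc l) ss) \<subseteq> V"
        using gen set_take_subset[of l ss] set_drop_subset[of "Suc l" ss] by auto
      show "sect_mult (ss ! l) u \<in> W'" using that gen by (intro assms) auto
    qed
    then show ?case
      by (auto simp: koszul_d_lin lin_chain koszul_gen_def
          intro!: chain.subspace_sum[OF chains_subspace] chain.subspace_neg[OF chains_subspace]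
            chain.subspace_scale[OF chains_subspace])
  qed
  then show ?thesis by simp
qed

lemma koszul_d_0:
  assumes "f \<in> chains V W 0" shows "koszul_d f = 0"
proof -
  have "f \<in> {f. koszul_d f = 0}" using assms
  proof (induction rule: chains_induct)
    case subspace
    show ?case unfolding chain.subspace_def koszul_d_lin by (auto simp: lin_chain)
  next
    case (gen ss u)
    then show ?case by (simp add: koszul_d_lin lin_chain koszul_gen_def)
  qed
  then show ?thesis by simp
qed

lemma koszul_d_relations_iff:
  assumes f: "f \<in> chains V W p" and W': "sect.subspace W'"
    and mult: "\<And>v u. v \<in> V \<Longrightarrow> u \<in> W \<Longrightarrow> sect_mult v u \<in> W'"
  shows "koszul_d f \<in> relations V W' (p - 1) \<longleftrightarrow> (\<forall>J. skd L x (coords L c f) J = 0)"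
proof
  assume "koszul_d f \<in> relations V W' (p - 1)"
  then show "\<forall>J. skd L x (coords L c f) J = 0"
    using coords_relations[of "koszul_d f" W' "p - 1"] coords_koszul_d[OF f] by simp
next
  assume z: "\<forall>J. skd L x (coords L c f) J = 0"
  show "koszul_d f \<in> relations V W' (p - 1)"
  proof (cases p)
    case 0
    then show ?thesis using koszul_d_0 f rel_zero by simp
  next
    case (Suc q)
    then have "koszul_d f \<in> chains V W' q" using f by (intro koszul_d_chains[OF _ W' mult]) auto
    then show ?thesis using relations_if_coords_zero[OF W'] coords_koszul_d[OF f] z Suc by simp
  qed
qed

text \<open>Coordinates identify chains modulo relations with functions on index sets, and the Koszul
  differential with \<open>- skd\<close>.\<close>

theorem koszul_exact_iff:
  assumes W: "sect.subspace W\<^sub>0" "sect.subspace W\<^sub>1" "sect.subspace W\<^sub>2"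
    and mult: "\<And>v u. v \<in> V \<Longrightarrow> u \<in> W\<^sub>0 \<Longrightarrow> sect_mult v u \<in> W\<^sub>1"
      "\<And>v u. v \<in> V \<Longrightarrow> u \<in> W\<^sub>1 \<Longrightarrow> sect_mult v u \<in> W\<^sub>2"
  shows "koszul_exact V W\<^sub>0 W\<^sub>1 W\<^sub>2 p \<longleftrightarrow>
    (\<forall>\<phi>. form L p \<phi> \<and> (\<forall>J. \<phi> J \<in> W\<^sub>1) \<and> (\<forall>J. skd L x \<phi> J = 0) \<longrightarrow>
      (\<exists>\<psi>. form L (Suc p) \<psi> \<and> (\<forall>J. \<psi> J \<in> W\<^sub>0) \<and> (\<forall>J. skd L x \<psi> J = \<phi> J)))"
proof (intro iffI allI impI)
  fix \<phi> :: "nat set \<Rightarrow> sect"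
  assume ex: "koszul_exact V W\<^sub>0 W\<^sub>1 W\<^sub>2 p"
    and \<phi>: "form L p \<phi> \<and> (\<forall>J. \<phi> J \<in> W\<^sub>1) \<and> (\<forall>J. skd L x \<phi> J = 0)"
  let ?f = "normal_chain p \<phi>"
  have cf: "coords L c ?f = \<phi>" using coords_normal_chain \<phi> by blast
  have f: "?f \<in> chains V W\<^sub>1 p" using \<phi> by (intro normal_chain_in_chains) auto
  have "koszul_d ?f \<in> relations V W\<^sub>2 (p - 1)"
    using koszul_d_relations_iff[OF f W(3) mult(2)] \<phi> cf by simp
  then obtain h where h: "h \<in> chains V W\<^sub>0 (Suc p)" "?f - koszul_d h \<in> relations V W\<^sub>1 p"
    using ex f by (auto simp: koszul_exact_def)
  define \<psi> where "\<psi> J = sect_scale (- 1) (coords L c h J)" for J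
  have "skd L x \<psi> J = \<phi> J" for J
  proof -
    have "coords L c (?f - koszul_d h) J = 0" using coords_relations h(2) by blast
    then have "coords L c ?f J = coords L c (koszul_d h) J" by (simp add: coords_def lin_sect)
    then have "\<phi> J = coords L c (koszul_d h) J" by (simp only: cf)
    also have "\<dots> = - skd L x (coords L c h) J" by (rule coords_koszul_d[OF h(1)])
    also have "\<dots> = skd L x \<psi> J"
      using kd_mult[of L _ "- 1 :: complex poly"] by (simp add: skd_def \<psi>_def sect_scale_def)
    finally show ?thesis by simp
  qed
  moreover have "form L (Suc p) \<psi>" unfolding \<psi>_def
    using coords_chains(2)[OF h(1) W(1)] by (auto simp: form_def)
  moreover have "\<psi> J \<in> W\<^sub>0" for J unfolding \<psi>_def
    by (rule sect.subspace_scale[OF W(1) coords_chains(1)[OF h(1) W(1)]])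
  ultimately show "\<exists>\<psi>. form L (Suc p) \<psi> \<and> (\<forall>J. \<psi> J \<in> W\<^sub>0) \<and> (\<forall>J. skd L x \<psi> J = \<phi> J)" by blast
next
  assume coh: "\<forall>\<phi>. form L p \<phi> \<and> (\<forall>J. \<phi> J \<in> W\<^sub>1) \<and> (\<forall>J. skd L x \<phi> J = 0) \<longrightarrow>
      (\<exists>\<psi>. form L (Suc p) \<psi> \<and> (\<forall>J. \<psi> J \<in> W\<^sub>0) \<and> (\<forall>J. skd L x \<psi> J = \<phi> J))"
  show "koszul_exact V W\<^sub>0 W\<^sub>1 W\<^sub>2 p"
    unfolding koszul_exact_def
  proof (intro ballI impI)
    fix f assume f: "f \<in> chains V W\<^sub>1 p" "koszul_d f \<in> relations V W\<^sub>2 (p - 1)"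
    have "\<forall>J. skd L x (coords L c f) J = 0"
      using koszul_d_relations_iff[OF f(1) W(3) mult(2)] f(2) by simp
    then obtain \<psi> where \<psi>: "form L (Suc p) \<psi>" "\<And>J. \<psi> J \<in> W\<^sub>0" "\<And>J. skd L x \<psi> J = coords L c f J"
      using coh coords_chains[OF f(1) W(2)] by blast
    define h where "h = chain_scale (- 1) (normal_chain (Suc p) \<psi>)"
    have n: "normal_chain (Suc p) \<psi> \<in> chains V W\<^sub>0 (Suc p)" by (rule normal_chain_in_chains[OF \<psi>(2)])
    then have h: "h \<in> chains V W\<^sub>0 (Suc p)" unfolding h_def by (rule chain.subspace_scale[OF chains_subspace])
    then have dh: "koszul_d h \<in> chains V W\<^sub>1 p" by (intro koszul_d_chains[OF _ W(2) mult(1)])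
    have "coords L c (koszul_d h) J = coords L c f J" for J
    proof -
      have "koszul_d h = - koszul_d (normal_chain (Suc p) \<psi>)"
        by (simp add: h_def koszul_d_lin lin_chain)
      then have "coords L c (koszul_d h) J = - coords L c (koszul_d (normal_chain (Suc p) \<psi>)) J"
        by (simp add: coords_def lin_sect)
      also have "\<dots> = skd L x (coords L c (normal_chain (Suc p) \<psi>)) J"
        by (simp add: coords_koszul_d[OF n])
      also have "coords L c (normal_chain (Suc p) \<psi>) = \<psi>" using coords_normal_chain[OF \<psi>(1)] by blast
      finally show ?thesis by (simp add: \<psi>(3))
    qed
    then have "f - koszul_d h \<in> relations V W\<^sub>1 p"
      using f(1) dh by (intro relations_if_coords_zero W chain.subspace_diff[OF chains_subspace])
        (auto simp: coords_def lin_sect)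
    then show "\<exists>h\<in>chains V W\<^sub>0 (p + 1). f - koszul_d h \<in> relations V W\<^sub>1 p" using h by auto
  qed
qed

end

section \<open>Sections on one component and their values at the nodes\<close>

text \<open>The two components are treated alike: on each of them the homogeneous coordinates are
  \<open>\<epsilon>\<close> times the basis polynomials, with \<open>\<epsilon> = 1\<close> on the first and \<open>\<epsilon> = -1\<close> on the second
  component, and the values at the nodes are normalised so that the coordinate of \<open>l\<close> has value
  one at the node \<open>l\<close> and at infinity, and value zero at the other nodes.\<close>

text \<open>The denominator in the coefficient of a differential at the node \<open>l\<close>.\<close>

definition wt :: "nat set \<Rightarrow> (nat \<Rightarrow> complex) \<Rightarrow> nat \<Rightarrow> complex" where
  "wt L \<alpha> l = (\<Prod>r\<in>L - {l}. \<alpha> l - \<alpha> r)"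

definition nval :: "nat set \<Rightarrow> (nat \<Rightarrow> complex) \<Rightarrow> complex \<Rightarrow> nat \<Rightarrow> nat \<Rightarrow> complex poly \<Rightarrow> complex" where
  "nval L \<alpha> \<epsilon> q l F = \<epsilon> ^ q * poly F (\<alpha> l) / wt L \<alpha> l ^ q"

definition ninf :: "nat set \<Rightarrow> complex \<Rightarrow> nat \<Rightarrow> complex poly \<Rightarrow> complex" where
  "ninf L \<epsilon> q F = \<epsilon> ^ q * coeff F (q * (card L - 1))"

definition bvar :: "nat set \<Rightarrow> (nat \<Rightarrow> complex) \<Rightarrow> complex \<Rightarrow> nat \<Rightarrow> complex poly" where
  "bvar L \<alpha> \<epsilon> l = smult \<epsilon> (lag L \<alpha> l)"

lemma nval_linear:
  "nval L \<alpha> \<epsilon> q l (F + G) = nval L \<alpha> \<epsilon> q l F + nval L \<alpha> \<epsilon> q l G"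
  "nval L \<alpha> \<epsilon> q l (F - G) = nval L \<alpha> \<epsilon> q l F - nval L \<alpha> \<epsilon> q l G"
  "nval L \<alpha> \<epsilon> q l (smult c F) = c * nval L \<alpha> \<epsilon> q l F"
  "nval L \<alpha> \<epsilon> q l 0 = 0"
  "nval L \<alpha> \<epsilon> q l (\<Sum>i\<in>A. f i) = (\<Sum>i\<in>A. nval L \<alpha> \<epsilon> q l (f i))"
  by (auto simp: nval_def poly_sum algebra_simps diff_divide_distrib add_divide_distrib
      sum_distrib_left sum_divide_distrib)

lemma ninf_linear:
  "ninf L \<epsilon> q (F + G) = ninf L \<epsilon> q F + ninf L \<epsilon> q G"
  "ninf L \<epsilon> q (F - G) = ninf L \<epsilon> q F - ninf L \<epsilon> q G"
  "ninf L \<epsilon> q (smult c F) = c * ninf L \<epsilon> q F"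
  "ninf L \<epsilon> q 0 = 0"
  "ninf L \<epsilon> q (\<Sum>i\<in>A. f i) = (\<Sum>i\<in>A. ninf L \<epsilon> q (f i))"
  by (auto simp: ninf_def coeff_sum algebra_simps sum_distrib_left)

lemma nval_mult: "nval L \<alpha> \<epsilon> (q + q') l (F * G) = nval L \<alpha> \<epsilon> q l F * nval L \<alpha> \<epsilon> q' l G"
  by (simp add: nval_def power_add)

lemma coeff_mult_top:
  assumes "degree F \<le> a" "degree G \<le> b"
  shows "coeff (F * G) (a + b) = coeff F a * (coeff G b :: complex)"
proof (cases "degree F = a \<and> degree G = b")
  case True
  then show ?thesis using coeff_mult_degree_sum[of F G] by auto
next
  case False
  then have "degree (F * G) < a + b" using degree_mult_le[of F G] assms by linarith
  moreover have "coeff F a = 0 \<or> coeff G b = 0" using False assms by (auto intro!: coeff_eq_0)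
  ultimately show ?thesis by (auto simp: coeff_eq_0)
qed

lemma ninf_mult:
  assumes "degree F \<le> q * (card L - 1)" "degree G \<le> q' * (card L - 1)"
  shows "ninf L \<epsilon> (q + q') (F * G) = ninf L \<epsilon> q F * ninf L \<epsilon> q' G"
  using coeff_mult_top[OF assms] by (simp add: ninf_def power_add add_mult_distrib)

locale component =
  fixes L :: "nat set" and \<alpha> :: "nat \<Rightarrow> complex" and \<epsilon> :: complex
  assumes finite_L: "finite L" and inj: "inj_on \<alpha> L" and eps: "\<epsilon> * \<epsilon> = 1" and L_ne: "L \<noteq> {}"
begin

lemma wt_nonzero: "l \<in> L \<Longrightarrow> wt L \<alpha> l \<noteq> 0"
  using finite_L inj by (auto simp: wt_def inj_on_def)

lemma degree_bvar: "l \<in> L \<Longrightarrow> degree (bvar L \<alpha> \<epsilon> l) \<le> card L - 1"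
  using degree_lag[OF finite_L, of l \<alpha>] degree_smult_le[of \<epsilon> "lag L \<alpha> l"] by (simp add: bvar_def)

lemma nval_bvar:
  assumes "l \<in> L" "m \<in> L"
  shows "nval L \<alpha> \<epsilon> 1 m (bvar L \<alpha> \<epsilon> l) = (if l = m then 1 else 0)"
  using assms wt_nonzero[OF assms(2)] lag_at_node[OF finite_L assms] eps
  by (auto simp: nval_def bvar_def poly_lag wt_def[symmetric] mult.assoc[symmetric])

lemma ninf_bvar: "l \<in> L \<Longrightarrow> ninf L \<epsilon> 1 (bvar L \<alpha> \<epsilon> l) = 1"
  using coeff_lag[OF finite_L] eps by (simp add: ninf_def bvar_def mult.assoc[symmetric])

lemma nval_power: "nval L \<alpha> \<epsilon> k l (F ^ k) = nval L \<alpha> \<epsilon> 1 l F ^ k"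
proof (induction k)
  case (Suc k)
  then show ?case using nval_mult[of L \<alpha> \<epsilon> 1 k l F "F ^ k"] by simp
qed (simp add: nval_def)

lemma degree_bvar_power: "l \<in> L \<Longrightarrow> degree (bvar L \<alpha> \<epsilon> l ^ k) \<le> k * (card L - 1)"
  using degree_power_le[of "bvar L \<alpha> \<epsilon> l" k] degree_bvar[of l]
  by (metis mult.commute mult_le_mono2 order_trans)

lemma ninf_power: "l \<in> L \<Longrightarrow> ninf L \<epsilon> k (bvar L \<alpha> \<epsilon> l ^ k) = 1"
proof (induction k)
  case (Suc k)
  then show ?case
    using ninf_mult[of "bvar L \<alpha> \<epsilon> l" 1 L "bvar L \<alpha> \<epsilon> l ^ k" k \<epsilon>] degree_bvar[of l]
      degree_bvar_power[of l k] ninf_bvar[of l] by simp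
qed (simp add: ninf_def)

lemma expand_linear:
  assumes "degree F \<le> card L - 1"
  shows "F = (\<Sum>l\<in>L. smult (nval L \<alpha> \<epsilon> 1 l F) (bvar L \<alpha> \<epsilon> l))"
proof (rule poly_eqI_degree[where A = "\<alpha> ` L"])
  have card: "card (\<alpha> ` L) = card L" "card L > 0" using inj finite_L L_ne by (auto simp: card_image card_gt_0_iff)
  show "card (\<alpha> ` L) > degree F" using assms card by simp
  have "degree (\<Sum>l\<in>L. smult (nval L \<alpha> \<epsilon> 1 l F) (bvar L \<alpha> \<epsilon> l)) \<le> card L - 1"
    using degree_bvar by (intro degree_sum_le finite_L) (metis degree_smult_le order_trans)
  then show "card (\<alpha> ` L) > degree (\<Sum>l\<in>L. smult (nval L \<alpha> \<epsilon> 1 l F) (bvar L \<alpha> \<epsilon> l))" using card by simp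
  have e: "\<epsilon> \<noteq> 0" using eps by auto
  fix z assume "z \<in> \<alpha> ` L"
  then obtain m where m: "m \<in> L" "z = \<alpha> m" by auto
  have "nval L \<alpha> \<epsilon> 1 m F = (\<Sum>l\<in>L. nval L \<alpha> \<epsilon> 1 l F * (if l = m then 1 else 0))"
  proof -
    have "(\<Sum>l\<in>L. nval L \<alpha> \<epsilon> 1 l F * (if l = m then 1 else 0)) = (\<Sum>l\<in>L. if l = m then nval L \<alpha> \<epsilon> 1 m F else 0)"
      by (rule sum.cong) auto
    then show ?thesis using m finite_L by simp
  qed
  also have "\<dots> = nval L \<alpha> \<epsilon> 1 m (\<Sum>l\<in>L. smult (nval L \<alpha> \<epsilon> 1 l F) (bvar L \<alpha> \<epsilon> l))"
    unfolding nval_linear using m nval_bvar by (intro sum.cong) auto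
  finally show "poly F z = poly (\<Sum>l\<in>L. smult (nval L \<alpha> \<epsilon> 1 l F) (bvar L \<alpha> \<epsilon> l)) z"
    using m e wt_nonzero[OF m(1)] by (simp add: nval_def)
qed

lemma ninf_sum_nval:
  assumes "degree F \<le> card L - 1"
  shows "ninf L \<epsilon> 1 F = (\<Sum>l\<in>L. nval L \<alpha> \<epsilon> 1 l F)"
proof -
  have "ninf L \<epsilon> 1 F = ninf L \<epsilon> 1 (\<Sum>l\<in>L. smult (nval L \<alpha> \<epsilon> 1 l F) (bvar L \<alpha> \<epsilon> l))"
    using expand_linear[OF assms] by (rule arg_cong)
  then show ?thesis unfolding ninf_linear using ninf_bvar by simp
qed

definition interp :: "nat \<Rightarrow> (nat \<Rightarrow> complex) \<Rightarrow> complex poly" where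
  "interp k y = (\<Sum>l\<in>L. smult (y l) (bvar L \<alpha> \<epsilon> l ^ k))"

lemma degree_interp: "degree (interp k y) \<le> k * (card L - 1)"
  unfolding interp_def using degree_bvar_power
  by (intro degree_sum_le finite_L) (metis degree_smult_le order_trans)

lemma nval_interp:
  assumes "k \<ge> 1" "m \<in> L"
  shows "nval L \<alpha> \<epsilon> k m (interp k y) = y m"
proof -
  have "nval L \<alpha> \<epsilon> k m (interp k y) = (\<Sum>l\<in>L. if l = m then y m else 0)"
    unfolding interp_def nval_linear nval_power using assms nval_bvar by (intro sum.cong) auto
  then show ?thesis using assms finite_L by simp
qed

lemma ninf_interp: "ninf L \<epsilon> k (interp k y) = (\<Sum>l\<in>L. y l)"
  unfolding interp_def ninf_linear using ninf_power by simp

lemma nval_contract: "nval L \<alpha> \<epsilon> q m (contract l \<phi> J) = contract l (\<lambda>J. nval L \<alpha> \<epsilon> q m (\<phi> J)) J"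
  by (auto simp: nval_def contract_def pos_sign_def minus_one_power_iff)

lemma ninf_contract: "ninf L \<epsilon> q (contract l \<phi> J) = contract l (\<lambda>J. ninf L \<epsilon> q (\<phi> J)) J"
  by (auto simp: ninf_def contract_def pos_sign_def minus_one_power_iff)

lemma nval_kd:
  assumes "m \<in> L"
  shows "nval L \<alpha> \<epsilon> (Suc q) m (kd L (bvar L \<alpha> \<epsilon>) \<phi> J) = contract m (\<lambda>J. nval L \<alpha> \<epsilon> q m (\<phi> J)) J"
proof -
  have "nval L \<alpha> \<epsilon> (Suc q) m (kd L (bvar L \<alpha> \<epsilon>) \<phi> J)
      = (\<Sum>l\<in>L. if l = m then contract m (\<lambda>J. nval L \<alpha> \<epsilon> q m (\<phi> J)) J else 0)"
    unfolding kd_def nval_linear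
  proof (rule sum.cong[OF refl])
    fix l assume "l \<in> L"
    then show "nval L \<alpha> \<epsilon> (Suc q) m (bvar L \<alpha> \<epsilon> l * contract l \<phi> J)
        = (if l = m then contract m (\<lambda>J. nval L \<alpha> \<epsilon> q m (\<phi> J)) J else 0)"
      using nval_mult[of L \<alpha> \<epsilon> 1 q m "bvar L \<alpha> \<epsilon> l" "contract l \<phi> J"] nval_bvar[of l m] assms
      by (simp add: nval_contract)
  qed
  then show ?thesis using assms finite_L by simp
qed

lemma ninf_kd:
  assumes "\<And>J. degree (\<phi> J) \<le> q * (card L - 1)"
  shows "ninf L \<epsilon> (Suc q) (kd L (bvar L \<alpha> \<epsilon>) \<phi> J) = kd L (\<lambda>_. 1) (\<lambda>J. ninf L \<epsilon> q (\<phi> J)) J"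
  unfolding kd_def ninf_linear
proof (rule sum.cong[OF refl])
  fix l assume l: "l \<in> L"
  have "degree (contract l \<phi> J) \<le> q * (card L - 1)" by (rule degree_contract) (rule assms)
  then show "ninf L \<epsilon> (Suc q) (bvar L \<alpha> \<epsilon> l * contract l \<phi> J) = 1 * contract l (\<lambda>J. ninf L \<epsilon> q (\<phi> J)) J"
    using ninf_mult[of "bvar L \<alpha> \<epsilon> l" 1 L "contract l \<phi> J" q \<epsilon>] ninf_bvar[OF l] degree_bvar[OF l]
    by (simp add: ninf_contract)
qed

lemma degree_kd_bvar:
  assumes "\<And>J. degree (\<phi> J) \<le> q * (card L - 1)"
  shows "degree (kd L (bvar L \<alpha> \<epsilon>) \<phi> J) \<le> Suc q * (card L - 1)"
  by (rule degree_kd[OF finite_L degree_bvar assms]) simp_all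

lemma kd_bvar: "kd L (bvar L \<alpha> \<epsilon>) \<phi> J = smult \<epsilon> (kd L (lag L \<alpha>) \<phi> J)"
proof -
  have "bvar L \<alpha> \<epsilon> = (\<lambda>l. [:\<epsilon>:] * lag L \<alpha> l)" by (auto simp: bvar_def)
  then show ?thesis using kd_scale_vars[of L "[:\<epsilon>:]" "lag L \<alpha>" \<phi> J] by simp
qed

text \<open>The sections of degree \<open>q\<close> restrict to polynomials of degree \<open>q (n - 1)\<close>, which is in the
  range of exactness as soon as \<open>q \<ge> 2\<close>.\<close>

lemma component_exact:
  assumes "2 \<le> q" "form L p \<phi>" "\<And>J. degree (\<phi> J) \<le> q * (card L - 1)"
    "\<And>J. kd L (bvar L \<alpha> \<epsilon>) \<phi> J = 0"
  obtains \<psi> where "form L (Suc p) \<psi>" "\<And>J. degree (\<psi> J) \<le> (q - 1) * (card L - 1)"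
    "\<And>J. kd L (bvar L \<alpha> \<epsilon>) \<psi> J = \<phi> J"
proof -
  have e: "\<epsilon> \<noteq> 0" using eps by auto
  have n: "card L \<ge> 1" using finite_L L_ne by (simp add: Suc_le_eq card_gt_0_iff)
  have "2 * (card L - 1) \<le> q * (card L - 1)" using assms(1) by simp
  then have "2 * card L \<le> q * (card L - 1) + 3" by linarith
  moreover have "kd L (lag L \<alpha>) \<phi> J = 0" for J using assms(4)[of J] e by (simp add: kd_bvar)
  ultimately obtain \<psi> where \<psi>: "supported L \<psi>" "\<And>J. degree (\<psi> J) \<le> q * (card L - 1) + 1 - card L"
    "\<And>J. kd L (lag L \<alpha>) \<psi> J = \<phi> J"
    using rational_normal_curve_exact[OF finite_L L_ne inj, of "q * (card L - 1)" \<phi>] assms(2,3) form_supported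
    by blast
  have d: "q * (card L - 1) + 1 - card L = (q - 1) * (card L - 1)" using n
    by (simp add: diff_mult_distrib)
  define \<psi>' where "\<psi>' J = (if card J = Suc p then \<psi> J else 0)" for J
  have 1: "form L (Suc p) \<psi>'" using \<psi>(1) by (auto simp: form_def supported_def \<psi>'_def)
  have 2: "kd L (lag L \<alpha>) \<psi>' J = \<phi> J" for J
    using homogeneous_primitive[OF finite_L assms(2) \<psi>(1,3)] by (simp add: \<psi>'_def[abs_def])
  show ?thesis
  proof (rule that[of "\<lambda>J. [:\<epsilon>:] * \<psi>' J"])
    show "form L (Suc p) (\<lambda>J. [:\<epsilon>:] * \<psi>' J)" by (rule form_mult[OF 1])
    show "degree ([:\<epsilon>:] * \<psi>' J) \<le> (q - 1) * (card L - 1)" for J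
      using \<psi>(2)[of J] degree_smult_le[of \<epsilon> "\<psi>' J"] unfolding d by (auto simp: \<psi>'_def)
    show "kd L (bvar L \<alpha> \<epsilon>) (\<lambda>J. [:\<epsilon>:] * \<psi>' J) J = \<phi> J" for J
      unfolding kd_mult kd_bvar 2 using eps by simp
  qed
qed

end

section \<open>Sections on the binary curve\<close>

definition secs :: "nat set \<Rightarrow> (nat \<Rightarrow> complex) \<Rightarrow> (nat \<Rightarrow> complex) \<Rightarrow> nat \<Rightarrow> sect set" where
  "secs L \<alpha> \<beta> q = {(F, G). degree F \<le> q * (card L - 1) \<and> degree G \<le> q * (card L - 1) \<and>
     (\<forall>l\<in>L. nval L \<alpha> 1 q l F = nval L \<beta> (- 1) q l G) \<and> ninf L 1 q F = ninf L (- 1) q G}"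

text \<open>A curve of genus \<open>n\<close> may be labelled by any set of \<open>n\<close> numbers.  For the projections of a
  curve of genus \<open>g\<close> these sets will be the complements of single labels in \<open>{1..g}\<close>.\<close>

lemma H0_omega_relabel:
  assumes "bij_betw \<tau> L {1..n}"
  shows "H0_omega n b q = secs L (\<lambda>i. b (\<tau> i, 1)) (\<lambda>i. b (\<tau> i, 2)) q"
proof -
  have card: "card L = n" using bij_betw_same_card[OF assms] by simp
  have im: "\<tau> ` L = {1..n}" and inj: "inj_on \<tau> L" using assms by (auto simp: bij_betw_def)
  have w: "wt L (\<lambda>i. b (\<tau> i, j)) l = (\<Prod>r\<in>{1..n} - {\<tau> l}. (b (\<tau> l, j) - b (r, j)))" if "l \<in> L" for l j
  proof -
    have "bij_betw \<tau> (L - {l}) ({1..n} - {\<tau> l})"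
      using that im inj by (auto simp: bij_betw_def inj_on_def)
    then show ?thesis unfolding wt_def by (rule prod.reindex_bij_betw)
  qed
  have sq: "(- 1) ^ q * ((- 1) ^ q * c) = c" for c :: complex
    by (simp add: power_mult_distrib[symmetric] mult.assoc[symmetric])
  have "(\<forall>l\<in>{1..n + 1}. node_coeff n b q 1 l F = (-1) ^ q * node_coeff n b q 2 l G) \<longleftrightarrow>
    (\<forall>l\<in>L. nval L (\<lambda>i. b (\<tau> i, 1)) 1 q l F = nval L (\<lambda>i. b (\<tau> i, 2)) (- 1) q l G) \<and>
    ninf L 1 q F = ninf L (- 1) q G" for F G
  proof -
    have "{1..n + 1} = insert (n + 1) (\<tau> ` L)" unfolding im by auto
    moreover have "node_coeff n b q 1 (\<tau> l) F = (-1) ^ q * node_coeff n b q 2 (\<tau> l) G \<longleftrightarrow>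
      nval L (\<lambda>i. b (\<tau> i, 1)) 1 q l F = nval L (\<lambda>i. b (\<tau> i, 2)) (- 1) q l G" if "l \<in> L" for l
    proof -
      have "\<tau> l \<le> n" using that im by auto
      then show ?thesis using that by (simp add: node_coeff_def nval_def w)
    qed
    moreover have "node_coeff n b q 1 (n + 1) F = (-1) ^ q * node_coeff n b q 2 (n + 1) G \<longleftrightarrow>
      ninf L 1 q F = ninf L (- 1) q G"
    proof -
      show ?thesis by (auto simp: node_coeff_def ninf_def card minus_one_power_iff)
    qed
    ultimately show ?thesis by auto
  qed
  then show ?thesis by (simp add: H0_omega_def secs_def card)
qed

lemma secs_subspace: "sect.subspace (secs L \<alpha> \<beta> q)"
  unfolding sect.subspace_def secs_def sect_scale_def
  by (auto simp: nval_linear ninf_linear zero_prod_def intro: degree_add_le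
      intro!: order_trans[OF degree_smult_le])

lemma secs_mult:
  assumes "v \<in> secs L \<alpha> \<beta> q" "u \<in> secs L \<alpha> \<beta> q'"
  shows "sect_mult v u \<in> secs L \<alpha> \<beta> (q + q')"
  using assms unfolding secs_def sect_mult_def
  by (auto simp: nval_mult ninf_mult add_mult_distrib intro: degree_mult_bound)

locale two_components =
  fixes L :: "nat set" and \<alpha> \<beta> :: "nat \<Rightarrow> complex"
  assumes finite_L: "finite L" and L_ne: "L \<noteq> {}" and inj_\<alpha>: "inj_on \<alpha> L" and inj_\<beta>: "inj_on \<beta> L"
begin

sublocale A: component L \<alpha> 1
  using finite_L L_ne inj_\<alpha> by unfold_locales auto

sublocale B: component L \<beta> "- 1"
  using finite_L L_ne inj_\<beta> by unfold_locales auto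

definition xs :: "nat \<Rightarrow> sect" where
  "xs l = (bvar L \<alpha> 1 l, bvar L \<beta> (- 1) l)"

lemma secsD:
  assumes "(F, G) \<in> secs L \<alpha> \<beta> q"
  shows "degree F \<le> q * (card L - 1)" "degree G \<le> q * (card L - 1)"
    "l \<in> L \<Longrightarrow> nval L \<alpha> 1 q l F = nval L \<beta> (- 1) q l G" "ninf L 1 q F = ninf L (- 1) q G"
  using assms by (auto simp: secs_def)

text \<open>In degree one the value at infinity is the sum of the values at the other nodes.\<close>

lemma linear_secs:
  "(F, G) \<in> secs L \<alpha> \<beta> 1 \<longleftrightarrow> degree F \<le> card L - 1 \<and> degree G \<le> card L - 1 \<and>
     (\<forall>l\<in>L. nval L \<alpha> 1 1 l F = nval L \<beta> (- 1) 1 l G)"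
  unfolding secs_def using A.ninf_sum_nval[of F] B.ninf_sum_nval[of G] by auto

lemma frame_xs: "frame L (secs L \<alpha> \<beta> 1) xs (\<lambda>l v. nval L \<alpha> 1 1 l (fst v))"
proof
  show "finite L" by (rule finite_L)
  show "sect.subspace (secs L \<alpha> \<beta> 1)" by (rule secs_subspace)
  show "xs l \<in> secs L \<alpha> \<beta> 1" if "l \<in> L" for l
    using that unfolding xs_def linear_secs
    by (auto simp: A.degree_bvar[simplified] B.degree_bvar[simplified] A.nval_bvar[simplified] B.nval_bvar[simplified])
  show "nval L \<alpha> 1 1 l (fst (v + w)) = nval L \<alpha> 1 1 l (fst v) + nval L \<alpha> 1 1 l (fst w)" for l v w
    by (simp add: nval_linear)
  show "nval L \<alpha> 1 1 l (fst (sect_scale r v)) = r * nval L \<alpha> 1 1 l (fst v)" for l r v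
    by (simp add: nval_linear sect_scale_def)
  show "nval L \<alpha> 1 1 l (fst (xs m)) = (if l = m then 1 else 0)" if "l \<in> L" "m \<in> L" for l m
    using A.nval_bvar[OF that(2,1)] by (auto simp: xs_def)
  show "v = (\<Sum>l\<in>L. sect_scale (nval L \<alpha> 1 1 l (fst v)) (xs l))" if "v \<in> secs L \<alpha> \<beta> 1" for v
  proof -
    obtain F G where v: "v = (F, G)" by (cases v)
    have FG: "degree F \<le> card L - 1" "degree G \<le> card L - 1"
      "\<And>l. l \<in> L \<Longrightarrow> nval L \<alpha> 1 1 l F = nval L \<beta> (- 1) 1 l G"
      using that unfolding v linear_secs by auto
    have "fst (\<Sum>l\<in>L. sect_scale (nval L \<alpha> 1 1 l F) (xs l)) = F"
      unfolding fst_sum by (rule trans[OF _ A.expand_linear[OF FG(1), symmetric]]) (simp add: sect_scale_def xs_def)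
    moreover have "snd (\<Sum>l\<in>L. sect_scale (nval L \<alpha> 1 1 l F) (xs l)) = G"
      unfolding snd_sum
      by (rule trans[OF _ B.expand_linear[OF FG(2), symmetric]]) (simp add: sect_scale_def xs_def FG(3)[simplified])
    ultimately show ?thesis by (simp add: v prod_eq_iff)
  qed
qed

text \<open>The vanishing of $K_{p,q}$ in coordinates.\<close>

definition kvan :: "nat \<Rightarrow> nat \<Rightarrow> bool" where
  "kvan p q \<longleftrightarrow> (\<forall>\<phi>\<^sub>1 \<phi>\<^sub>2. form L p \<phi>\<^sub>1 \<and> form L p \<phi>\<^sub>2 \<and> (\<forall>J. (\<phi>\<^sub>1 J, \<phi>\<^sub>2 J) \<in> secs L \<alpha> \<beta> q) \<and>
      (\<forall>J. kd L (bvar L \<alpha> 1) \<phi>\<^sub>1 J = 0) \<and> (\<forall>J. kd L (bvar L \<beta> (- 1)) \<phi>\<^sub>2 J = 0) \<longrightarrow>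
      (\<exists>\<psi>\<^sub>1 \<psi>\<^sub>2. form L (Suc p) \<psi>\<^sub>1 \<and> form L (Suc p) \<psi>\<^sub>2 \<and> (\<forall>J. (\<psi>\<^sub>1 J, \<psi>\<^sub>2 J) \<in> secs L \<alpha> \<beta> (q - 1)) \<and>
        (\<forall>J. kd L (bvar L \<alpha> 1) \<psi>\<^sub>1 J = \<phi>\<^sub>1 J) \<and> (\<forall>J. kd L (bvar L \<beta> (- 1)) \<psi>\<^sub>2 J = \<phi>\<^sub>2 J)))"

lemma koszul_vanishes_iff:
  assumes "q \<ge> 1"
  shows "koszul_vanishes (secs L \<alpha> \<beta>) p q \<longleftrightarrow> kvan p q"
proof -
  interpret frame L "secs L \<alpha> \<beta> 1" xs "\<lambda>l v. nval L \<alpha> 1 1 l (fst v)" by (rule frame_xs)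
  have "koszul_exact (secs L \<alpha> \<beta> 1) (secs L \<alpha> \<beta> (q - 1)) (secs L \<alpha> \<beta> q) (secs L \<alpha> \<beta> (q + 1)) p
    \<longleftrightarrow> (\<forall>\<phi>. form L p \<phi> \<and> (\<forall>J. \<phi> J \<in> secs L \<alpha> \<beta> q) \<and> (\<forall>J. skd L xs \<phi> J = 0) \<longrightarrow>
      (\<exists>\<psi>. form L (Suc p) \<psi> \<and> (\<forall>J. \<psi> J \<in> secs L \<alpha> \<beta> (q - 1)) \<and> (\<forall>J. skd L xs \<psi> J = \<phi> J)))"
    using secs_mult[of _ L \<alpha> \<beta> 1 _ "q - 1"] secs_mult[of _ L \<alpha> \<beta> 1 _ q] assms
    by (intro koszul_exact_iff secs_subspace) auto
  also have "\<dots> \<longleftrightarrow> kvan p q"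
  proof
    assume *: "\<forall>\<phi>. form L p \<phi> \<and> (\<forall>J. \<phi> J \<in> secs L \<alpha> \<beta> q) \<and> (\<forall>J. skd L xs \<phi> J = 0) \<longrightarrow>
      (\<exists>\<psi>. form L (Suc p) \<psi> \<and> (\<forall>J. \<psi> J \<in> secs L \<alpha> \<beta> (q - 1)) \<and> (\<forall>J. skd L xs \<psi> J = \<phi> J))"
    show "kvan p q"
      unfolding kvan_def
    proof (intro allI impI)
      fix \<phi>\<^sub>1 \<phi>\<^sub>2 :: "nat set \<Rightarrow> complex poly"
      assume a: "form L p \<phi>\<^sub>1 \<and> form L p \<phi>\<^sub>2 \<and> (\<forall>J. (\<phi>\<^sub>1 J, \<phi>\<^sub>2 J) \<in> secs L \<alpha> \<beta> q) \<and>
        (\<forall>J. kd L (bvar L \<alpha> 1) \<phi>\<^sub>1 J = 0) \<and> (\<forall>J. kd L (bvar L \<beta> (- 1)) \<phi>\<^sub>2 J = 0)"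
      have "form L p (\<lambda>J. (\<phi>\<^sub>1 J, \<phi>\<^sub>2 J))" using a by (auto simp: form_def zero_prod_def)
      moreover have "skd L xs (\<lambda>J. (\<phi>\<^sub>1 J, \<phi>\<^sub>2 J)) J = 0" for J
        using a by (simp add: skd_def xs_def zero_prod_def)
      ultimately obtain \<psi> where \<psi>: "form L (Suc p) \<psi>" "\<And>J. \<psi> J \<in> secs L \<alpha> \<beta> (q - 1)"
        "\<And>J. skd L xs \<psi> J = (\<phi>\<^sub>1 J, \<phi>\<^sub>2 J)"
        using *[rule_format, of "\<lambda>J. (\<phi>\<^sub>1 J, \<phi>\<^sub>2 J)"] a by auto
      show "\<exists>\<psi>\<^sub>1 \<psi>\<^sub>2. form L (Suc p) \<psi>\<^sub>1 \<and> form L (Suc p) \<psi>\<^sub>2 \<and> (\<forall>J. (\<psi>\<^sub>1 J, \<psi>\<^sub>2 J) \<in> secs L \<alpha> \<beta> (q - 1)) \<and>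
        (\<forall>J. kd L (bvar L \<alpha> 1) \<psi>\<^sub>1 J = \<phi>\<^sub>1 J) \<and> (\<forall>J. kd L (bvar L \<beta> (- 1)) \<psi>\<^sub>2 J = \<phi>\<^sub>2 J)"
        using \<psi> by (intro exI[of _ "\<lambda>J. fst (\<psi> J)"] exI[of _ "\<lambda>J. snd (\<psi> J)"])
          (auto simp: form_def skd_def xs_def)
    qed
  next
    assume *: "kvan p q"
    show "\<forall>\<phi>. form L p \<phi> \<and> (\<forall>J. \<phi> J \<in> secs L \<alpha> \<beta> q) \<and> (\<forall>J. skd L xs \<phi> J = 0) \<longrightarrow>
      (\<exists>\<psi>. form L (Suc p) \<psi> \<and> (\<forall>J. \<psi> J \<in> secs L \<alpha> \<beta> (q - 1)) \<and> (\<forall>J. skd L xs \<psi> J = \<phi> J))"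
    proof (intro allI impI)
      fix \<phi> :: "nat set \<Rightarrow> sect"
      assume a: "form L p \<phi> \<and> (\<forall>J. \<phi> J \<in> secs L \<alpha> \<beta> q) \<and> (\<forall>J. skd L xs \<phi> J = 0)"
      have "form L p (\<lambda>J. fst (\<phi> J))" "form L p (\<lambda>J. snd (\<phi> J))" using a by (auto simp: form_def)
      then obtain \<psi>\<^sub>1 \<psi>\<^sub>2 where \<psi>: "form L (Suc p) \<psi>\<^sub>1" "form L (Suc p) \<psi>\<^sub>2"
        "\<And>J. (\<psi>\<^sub>1 J, \<psi>\<^sub>2 J) \<in> secs L \<alpha> \<beta> (q - 1)"
        "\<And>J. kd L (bvar L \<alpha> 1) \<psi>\<^sub>1 J = fst (\<phi> J)" "\<And>J. kd L (bvar L \<beta> (- 1)) \<psi>\<^sub>2 J = snd (\<phi> J)"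
        using *[unfolded kvan_def, rule_format, of "\<lambda>J. fst (\<phi> J)" "\<lambda>J. snd (\<phi> J)"] a
        by (auto simp: skd_def xs_def zero_prod_def)
      show "\<exists>\<psi>. form L (Suc p) \<psi> \<and> (\<forall>J. \<psi> J \<in> secs L \<alpha> \<beta> (q - 1)) \<and> (\<forall>J. skd L xs \<psi> J = \<phi> J)"
        using \<psi> by (intro exI[of _ "\<lambda>J. (\<psi>\<^sub>1 J, \<psi>\<^sub>2 J)"])
          (auto simp: form_def skd_def xs_def zero_prod_def)
    qed
  qed
  finally show ?thesis using assms by (simp add: koszul_vanishes_def)
qed

end

section \<open>Syzygies of the components and of the nodes\<close>

text \<open>Elements of $\Lambda^p V \otimes V$ are families \<open>y\<close>, where \<open>y i\<close> is the coefficient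
  of the \<open>i\<close>-th coordinate in the second factor.  Those in \<open>tame\<close> are the combinations of the
  tensors $x_I \otimes (x_m - x_{m'})$ with $m, m' \notin I$; they are cycles for the coordinate ring
  of the set of nodes, and up to boundaries they are all such cycles.\<close>

definition tensor :: "nat set \<Rightarrow> (nat \<Rightarrow> complex poly) \<Rightarrow> (nat \<Rightarrow> nat set \<Rightarrow> complex) \<Rightarrow> nat set \<Rightarrow> complex poly" where
  "tensor L x y J = (\<Sum>i\<in>L. smult (y i J) (x i))"

definition cycles :: "nat set \<Rightarrow> (nat \<Rightarrow> complex) \<Rightarrow> nat \<Rightarrow> (nat \<Rightarrow> nat set \<Rightarrow> complex) set" where
  "cycles L \<alpha> p = {y. (\<forall>i\<in>L. form L p (y i)) \<and> (\<forall>J. kd L (lag L \<alpha>) (tensor L (lag L \<alpha>) y) J = 0)}"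

definition tame :: "nat set \<Rightarrow> nat \<Rightarrow> (nat \<Rightarrow> nat set \<Rightarrow> complex) set" where
  "tame L p = {y. (\<forall>i\<in>L. form L p (y i)) \<and> (\<forall>i\<in>L. \<forall>I. i \<in> I \<longrightarrow> y i I = 0) \<and> (\<forall>I. (\<Sum>i\<in>L. y i I) = 0)}"

definition splits :: "nat set \<Rightarrow> (nat \<Rightarrow> complex) \<Rightarrow> (nat \<Rightarrow> complex) \<Rightarrow> nat \<Rightarrow> (nat \<Rightarrow> nat set \<Rightarrow> complex) \<Rightarrow> bool" where
  "splits L \<alpha> \<beta> p y \<longleftrightarrow> (\<exists>y\<^sub>1\<in>cycles L \<alpha> p. \<exists>y\<^sub>2\<in>cycles L \<beta> p. \<forall>i\<in>L. \<forall>I. y i I = y\<^sub>1 i I + y\<^sub>2 i I)"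

definition tame_split :: "nat set \<Rightarrow> (nat \<Rightarrow> complex) \<Rightarrow> (nat \<Rightarrow> complex) \<Rightarrow> nat \<Rightarrow> bool" where
  "tame_split L \<alpha> \<beta> p \<longleftrightarrow> (\<forall>y\<in>tame L p. splits L \<alpha> \<beta> p y)"

lemma tensor_scale_add:
  "tensor L x (\<lambda>i I. c * y i I + z i I) = (\<lambda>J. [:c:] * tensor L x y J + tensor L x z J)"
  by (auto simp: tensor_def smult_add_left sum.distrib smult_sum_right)

lemma cycles_scale_add:
  assumes "y \<in> cycles L \<alpha> p" "z \<in> cycles L \<alpha> p"
  shows "(\<lambda>i I. c * y i I + z i I) \<in> cycles L \<alpha> p"
  using assms unfolding cycles_def
  by (auto simp: tensor_scale_add kd_add kd_mult simp del: mult_pCons_left intro!: form_add form_mult)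

lemma cycles_zero: "(\<lambda>i I. 0) \<in> cycles L \<alpha> p"
proof -
  have "tensor L (lag L \<alpha>) (\<lambda>i I. 0) = (\<lambda>J. 0)" by (auto simp: tensor_def)
  then show ?thesis by (simp add: cycles_def)
qed

lemma splits_scale_add:
  assumes "splits L \<alpha> \<beta> p y" "splits L \<alpha> \<beta> p z"
  shows "splits L \<alpha> \<beta> p (\<lambda>i I. c * y i I + z i I)"
proof -
  obtain y1 y2 z1 z2 where *: "y1 \<in> cycles L \<alpha> p" "y2 \<in> cycles L \<beta> p" "\<And>i I. i \<in> L \<Longrightarrow> y i I = y1 i I + y2 i I"
    "z1 \<in> cycles L \<alpha> p" "z2 \<in> cycles L \<beta> p" "\<And>i I. i \<in> L \<Longrightarrow> z i I = z1 i I + z2 i I"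
    using assms by (auto simp: splits_def)
  show ?thesis unfolding splits_def
    by (rule bexI[OF _ cycles_scale_add[OF *(1,4), of c]], rule bexI[OF _ cycles_scale_add[OF *(2,5), of c]])
      (auto simp: * algebra_simps)
qed

lemma splits_zero: "splits L \<alpha> \<beta> p (\<lambda>i I. 0)"
  unfolding splits_def by (intro bexI[of _ "\<lambda>i I. 0"] cycles_zero) auto

lemma splits_cong: "splits L \<alpha> \<beta> p y \<Longrightarrow> (\<And>i I. i \<in> L \<Longrightarrow> y i I = z i I) \<Longrightarrow> splits L \<alpha> \<beta> p z"
  unfolding splits_def by auto

lemma splits_sum:
  "finite A \<Longrightarrow> (\<And>a. a \<in> A \<Longrightarrow> splits L \<alpha> \<beta> p (y a)) \<Longrightarrow> splits L \<alpha> \<beta> p (\<lambda>i I. \<Sum>a\<in>A. c a * y a i I)"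
proof (induction A rule: finite_induct)
  case empty
  then show ?case by (simp add: splits_zero)
next
  case (insert a A)
  then show ?case using splits_scale_add[of L \<alpha> \<beta> p "y a" "\<lambda>i I. \<Sum>a\<in>A. c a * y a i I" "c a"] by simp
qed

text \<open>The contractions of \<open>e\<close> form the boundary of \<open>e \<otimes> 1\<close>, a cycle for every choice of points.\<close>

lemma boundary_cycle:
  assumes "finite L" "form L (Suc p) e"
  shows "(\<lambda>i. contract i e) \<in> cycles L \<alpha> p"
proof -
  have "tensor L (lag L \<alpha>) (\<lambda>i. contract i e) = kd L (lag L \<alpha>) (\<lambda>J. [:e J:])"
  proof
    fix J
    have "contract i (\<lambda>J. [:e J:]) J = [:contract i e J:]" for i
      by (auto simp: contract_def pos_sign_def minus_one_power_iff)
    then show "tensor L (lag L \<alpha>) (\<lambda>i. contract i e) J = kd L (lag L \<alpha>) (\<lambda>J. [:e J:]) J"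
      by (simp add: tensor_def kd_def)
  qed
  then show ?thesis using assms kd_kd[of L "lag L \<alpha>"] form_contract
    by (auto simp: cycles_def)
qed

text \<open>A cycle for the coordinate ring of the nodes.  At infinity the sum of its coefficients is
  closed, hence the contraction of some \<open>e\<close> with all coordinates; subtracting the boundary of
  \<open>e \<otimes> 1\<close> makes this sum zero, and the cycle tame.\<close>

definition node_cycle :: "nat set \<Rightarrow> nat \<Rightarrow> (nat \<Rightarrow> nat set \<Rightarrow> complex) \<Rightarrow> bool" where
  "node_cycle L p y \<longleftrightarrow> (\<forall>i\<in>L. form L p (y i)) \<and> (\<forall>i\<in>L. \<forall>J. contract i (y i) J = 0) \<and>
     (\<forall>J. kd L (\<lambda>_. 1) (\<lambda>I. \<Sum>i\<in>L. y i I) J = 0)"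

definition tame_part :: "nat set \<Rightarrow> nat \<Rightarrow> (nat \<Rightarrow> nat set \<Rightarrow> complex) \<Rightarrow> nat \<Rightarrow> nat set \<Rightarrow> complex" where
  "tame_part L l0 y i J = (- 1) * contract i (extend l0 (\<lambda>I. \<Sum>k\<in>L. y k I)) J + y i J"

lemma form_tame_boundary:
  assumes "finite L" "l0 \<in> L" "node_cycle L p y"
  shows "form L (Suc p) (extend l0 (\<lambda>I. \<Sum>k\<in>L. y k I))"
  using assms by (intro form_extend form_sum) (auto simp: node_cycle_def)

lemma tame_part_tame:
  assumes "finite L" "l0 \<in> L" "node_cycle L p y"
  shows "tame_part L l0 y \<in> tame L p"
proof -
  define w where "w I = (\<Sum>k\<in>L. y k I)" for I
  have y: "\<And>i. i \<in> L \<Longrightarrow> form L p (y i)" "\<And>i J. i \<in> L \<Longrightarrow> contract i (y i) J = 0"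
    and dw: "kd L (\<lambda>_. 1) w = (\<lambda>J. 0)"
    using assms(3) by (auto simp: node_cycle_def w_def[abs_def])
  have de: "kd L (\<lambda>_. 1) (extend l0 w) J = w J" for J
    using kd_extend[OF assms(1,2), of "\<lambda>_. 1" w J] dw by simp
  have t: "tame_part L l0 y i J = (- 1) * contract i (extend l0 w) J + y i J" for i J
    by (simp add: tame_part_def w_def[abs_def])
  show ?thesis
    unfolding tame_def
  proof (intro CollectI conjI ballI allI impI)
    fix i assume i: "i \<in> L"
    have "form L (Suc p) (extend l0 w)" unfolding w_def by (rule form_tame_boundary[OF assms])
    then show "form L p (tame_part L l0 y i)"
      unfolding t by (intro form_add form_mult form_contract assms y i)
    show "tame_part L l0 y i I = 0" if "i \<in> I" for I
      using y(2)[OF i, of "I - {i}"] that by (simp add: t contract_def insert_absorb pos_sign_def)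
  next
    fix I
    show "(\<Sum>i\<in>L. tame_part L l0 y i I) = 0"
      using de[of I] by (simp add: t sum_subtractf w_def kd_def)
  qed
qed

context component
begin

lemma tensor_bvar: "tensor L (bvar L \<alpha> \<epsilon>) y J = smult \<epsilon> (tensor L (lag L \<alpha>) y J)"
  by (auto simp: tensor_def bvar_def smult_sum_right mult.commute)

lemma cycles_iff:
  "y \<in> cycles L \<alpha> p \<longleftrightarrow> (\<forall>i\<in>L. form L p (y i)) \<and>
     (\<forall>J. kd L (bvar L \<alpha> \<epsilon>) (tensor L (bvar L \<alpha> \<epsilon>) y) J = 0)"
proof -
  have "tensor L (bvar L \<alpha> \<epsilon>) y = (\<lambda>J. [:\<epsilon>:] * tensor L (lag L \<alpha>) y J)"
    by (auto simp: tensor_bvar)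
  then have "kd L (bvar L \<alpha> \<epsilon>) (tensor L (bvar L \<alpha> \<epsilon>) y) J = kd L (lag L \<alpha>) (tensor L (lag L \<alpha>) y) J" for J
    using eps kd_mult[of L "lag L \<alpha>" "[:\<epsilon>:]"] by (simp add: kd_bvar)
  then show ?thesis by (simp add: cycles_def)
qed

lemma degree_tensor: "degree (tensor L (bvar L \<alpha> \<epsilon>) y J) \<le> card L - 1"
  unfolding tensor_def using degree_bvar
  by (intro degree_sum_le finite_L) (metis degree_smult_le order_trans)

lemma nval_tensor: "m \<in> L \<Longrightarrow> nval L \<alpha> \<epsilon> 1 m (tensor L (bvar L \<alpha> \<epsilon>) y J) = y m J"
  using nval_interp[of 1 m "\<lambda>i. y i J"] by (simp add: interp_def tensor_def)

lemma ninf_tensor: "ninf L \<epsilon> 1 (tensor L (bvar L \<alpha> \<epsilon>) y J) = (\<Sum>i\<in>L. y i J)"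
  using ninf_interp[of 1 "\<lambda>i. y i J"] by (simp add: interp_def tensor_def)

lemma form_tensor: "(\<And>i. i \<in> L \<Longrightarrow> form L p (y i)) \<Longrightarrow> form L p (tensor L (bvar L \<alpha> \<epsilon>) y)"
  by (auto simp: form_def tensor_def intro!: sum.neutral)

lemma tensor_coordinates:
  assumes "\<And>J. degree (\<psi> J) \<le> card L - 1"
  shows "tensor L (bvar L \<alpha> \<epsilon>) (\<lambda>i J. nval L \<alpha> \<epsilon> 1 i (\<psi> J)) = \<psi>"
  using expand_linear[OF assms] by (auto simp: tensor_def)

lemma form_nval: "form L p \<phi> \<Longrightarrow> form L p (\<lambda>J. nval L \<alpha> \<epsilon> q i (\<phi> J))"
  by (erule form_map) (simp add: nval_linear)

lemma form_ninf: "form L p \<phi> \<Longrightarrow> form L p (\<lambda>J. ninf L \<epsilon> q (\<phi> J))"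
  by (erule form_map) (simp add: ninf_linear)

end

context two_components
begin

text \<open>The differential of a tame element on the first component, extended by zero to the second
  one, is a cycle of the curve.  A primitive of it is a cycle on the second component, and differs
  from the tame element by a cycle on the first one.\<close>

theorem tame_split_if_vanishing:
  assumes "kvan p 2"
  shows "tame_split L \<alpha> \<beta> (Suc p)"
  unfolding tame_split_def
proof
  fix y assume "y \<in> tame L (Suc p)"
  then have y: "\<And>i. i \<in> L \<Longrightarrow> form L (Suc p) (y i)" "\<And>i I. i \<in> L \<Longrightarrow> i \<in> I \<Longrightarrow> y i I = 0"
    "\<And>I. (\<Sum>i\<in>L. y i I) = 0"
    by (auto simp: tame_def)
  define \<psi> where "\<psi> = tensor L (bvar L \<alpha> 1) y"
  define \<phi> where "\<phi> = kd L (bvar L \<alpha> 1) \<psi>"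
  have form\<psi>: "form L (Suc p) \<psi>" unfolding \<psi>_def by (rule A.form_tensor[OF y(1)])
  then have form\<phi>: "form L p \<phi>" unfolding \<phi>_def using finite_L by (intro form_kd)
  have deg\<psi>: "degree (\<psi> J) \<le> 1 * (card L - 1)" for J using A.degree_tensor by (simp add: \<psi>_def)
  have deg\<phi>: "degree (\<phi> J) \<le> 2 * (card L - 1)" for J
    using A.degree_kd_bvar[OF deg\<psi>] by (simp add: \<phi>_def numeral_2_eq_2)
  have van: "nval L \<alpha> 1 2 m (\<phi> J) = 0" if "m \<in> L" for m J
  proof -
    have "nval L \<alpha> 1 (Suc 1) m (\<phi> J) = contract m (y m) J"
      unfolding \<phi>_def A.nval_kd[OF that] \<psi>_def A.nval_tensor[OF that] ..
    also have "\<dots> = 0" using y(2)[OF that] by (simp add: contract_def)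
    finally show ?thesis by (simp add: numeral_2_eq_2)
  qed
  have vinf: "ninf L 1 2 (\<phi> J) = 0" for J
  proof -
    have "ninf L 1 (Suc 1) (\<phi> J) = kd L (\<lambda>_. 1) (\<lambda>J. 0) J"
      unfolding \<phi>_def A.ninf_kd[OF deg\<psi>] unfolding \<psi>_def A.ninf_tensor y(3) ..
    then show ?thesis by (simp add: numeral_2_eq_2)
  qed
  have "(\<phi> J, 0) \<in> secs L \<alpha> \<beta> 2" for J
    using deg\<phi> van vinf by (auto simp: secs_def nval_linear ninf_linear)
  moreover have "kd L (bvar L \<alpha> 1) \<phi> J = 0" for J unfolding \<phi>_def using finite_L by (rule kd_kd)
  ultimately obtain \<psi>\<^sub>1 \<psi>\<^sub>2 where \<psi>': "form L (Suc p) \<psi>\<^sub>1" "form L (Suc p) \<psi>\<^sub>2"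
    "\<And>J. (\<psi>\<^sub>1 J, \<psi>\<^sub>2 J) \<in> secs L \<alpha> \<beta> 1"
    "\<And>J. kd L (bvar L \<alpha> 1) \<psi>\<^sub>1 J = \<phi> J" "\<And>J. kd L (bvar L \<beta> (- 1)) \<psi>\<^sub>2 J = 0"
    using assms[unfolded kvan_def, rule_format, of \<phi> "\<lambda>J. 0"] form\<phi> by auto
  define z where "z i J = nval L \<alpha> 1 1 i (\<psi>\<^sub>1 J)" for i J
  have z2: "z i J = nval L \<beta> (- 1) 1 i (\<psi>\<^sub>2 J)" if "i \<in> L" for i J
    using secsD(3)[OF \<psi>'(3) that] by (simp add: z_def)
  have "degree (\<psi>\<^sub>1 J) \<le> card L - 1" "degree (\<psi>\<^sub>2 J) \<le> card L - 1" for J using secsD(1,2)[OF \<psi>'(3)] by auto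
  then have t1: "tensor L (bvar L \<alpha> 1) z = \<psi>\<^sub>1"
    and t2: "tensor L (bvar L \<beta> (- 1)) (\<lambda>i J. nval L \<beta> (- 1) 1 i (\<psi>\<^sub>2 J)) = \<psi>\<^sub>2"
    unfolding z_def by (intro A.tensor_coordinates B.tensor_coordinates; blast)+
  have formz: "form L (Suc p) (z i)" for i unfolding z_def by (rule A.form_nval[OF \<psi>'(1)])
  have "(\<lambda>i J. nval L \<beta> (- 1) 1 i (\<psi>\<^sub>2 J)) \<in> cycles L \<beta> (Suc p)"
    unfolding B.cycles_iff t2 using \<psi>' B.form_nval by auto
  moreover have "(\<lambda>i J. (- 1) * z i J + y i J) \<in> cycles L \<alpha> (Suc p)"
    unfolding A.cycles_iff tensor_scale_add kd_add kd_mult t1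
    using \<psi>' y formz by (auto simp: \<phi>_def \<psi>_def intro!: form_add form_mult form_diff)
  ultimately show "splits L \<alpha> \<beta> (Suc p) y"
    unfolding splits_def by (intro bexI) (auto simp: z2)
qed

text \<open>Conversely, a cycle of the curve is a boundary on each component, and the difference of the
  two primitives is a cycle for the nodes.  Splitting it into cycles of the components and subtracting
  these from the primitives makes the primitives agree.\<close>

theorem vanishing_if_tame_split:
  assumes "tame_split L \<alpha> \<beta> (Suc p)"
  shows "kvan p 2"
  unfolding kvan_def
proof (intro allI impI, elim conjE)
  fix \<phi>\<^sub>1 \<phi>\<^sub>2 :: "nat set \<Rightarrow> complex poly"
  assume \<phi>: "form L p \<phi>\<^sub>1" "form L p \<phi>\<^sub>2" "\<forall>J. (\<phi>\<^sub>1 J, \<phi>\<^sub>2 J) \<in> secs L \<alpha> \<beta> 2"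
    "\<forall>J. kd L (bvar L \<alpha> 1) \<phi>\<^sub>1 J = 0" "\<forall>J. kd L (bvar L \<beta> (- 1)) \<phi>\<^sub>2 J = 0"
  obtain \<psi>\<^sub>1 where \<psi>1: "form L (Suc p) \<psi>\<^sub>1" "\<And>J. degree (\<psi>\<^sub>1 J) \<le> (2 - 1) * (card L - 1)"
    "\<And>J. kd L (bvar L \<alpha> 1) \<psi>\<^sub>1 J = \<phi>\<^sub>1 J"
    using A.component_exact[of 2 p \<phi>\<^sub>1] \<phi> secsD(1) by (metis order_refl)
  obtain \<psi>\<^sub>2 where \<psi>2: "form L (Suc p) \<psi>\<^sub>2" "\<And>J. degree (\<psi>\<^sub>2 J) \<le> (2 - 1) * (card L - 1)"
    "\<And>J. kd L (bvar L \<beta> (- 1)) \<psi>\<^sub>2 J = \<phi>\<^sub>2 J"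
    using B.component_exact[of 2 p \<phi>\<^sub>2] \<phi> secsD(2) by (metis order_refl)
  have deg: "degree (\<psi>\<^sub>1 J) \<le> 1 * (card L - 1)" "degree (\<psi>\<^sub>2 J) \<le> 1 * (card L - 1)" for J
    using \<psi>1(2)[of J] \<psi>2(2)[of J] by auto
  define y1 where "y1 i J = nval L \<alpha> 1 1 i (\<psi>\<^sub>1 J)" for i J
  define y2 where "y2 i J = nval L \<beta> (- 1) 1 i (\<psi>\<^sub>2 J)" for i J
  have t1: "tensor L (bvar L \<alpha> 1) y1 = \<psi>\<^sub>1" unfolding y1_def by (rule A.tensor_coordinates) (use deg in simp)
  have t2: "tensor L (bvar L \<beta> (- 1)) y2 = \<psi>\<^sub>2" unfolding y2_def by (rule B.tensor_coordinates) (use deg in simp)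
  define y where "y i J = y1 i J - y2 i J" for i J
  have formy: "form L (Suc p) (y i)" for i
    unfolding y_def y1_def y2_def by (intro form_diff A.form_nval B.form_nval \<psi>1 \<psi>2)
  have cy: "contract i (y i) J = 0" if "i \<in> L" for i J
  proof -
    have "contract i (y1 i) J = nval L \<alpha> 1 (Suc 1) i (\<phi>\<^sub>1 J)"
      unfolding y1_def using A.nval_kd[OF that, of 1 \<psi>\<^sub>1 J] \<psi>1(3) by simp
    moreover have "contract i (y2 i) J = nval L \<beta> (- 1) (Suc 1) i (\<phi>\<^sub>2 J)"
      unfolding y2_def using B.nval_kd[OF that, of 1 \<psi>\<^sub>2 J] \<psi>2(3) by simp
    moreover have "nval L \<alpha> 1 2 i (\<phi>\<^sub>1 J) = nval L \<beta> (- 1) 2 i (\<phi>\<^sub>2 J)" using secsD(3) \<phi>(3) that by blast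
    ultimately show ?thesis unfolding y_def contract_diff by (simp add: numeral_2_eq_2)
  qed
  have dw: "kd L (\<lambda>_. 1) (\<lambda>J. \<Sum>i\<in>L. y i J) J = 0" for J
  proof -
    have "(\<lambda>J. \<Sum>i\<in>L. y i J) = (\<lambda>J. ninf L 1 1 (\<psi>\<^sub>1 J) - ninf L (- 1) 1 (\<psi>\<^sub>2 J))"
      unfolding t1[symmetric] t2[symmetric] A.ninf_tensor B.ninf_tensor
      by (auto simp: y_def sum_subtractf)
    then have "kd L (\<lambda>_. 1) (\<lambda>J. \<Sum>i\<in>L. y i J) J = ninf L 1 (Suc 1) (\<phi>\<^sub>1 J) - ninf L (- 1) (Suc 1) (\<phi>\<^sub>2 J)"
      using A.ninf_kd[of \<psi>\<^sub>1 1 J, OF deg(1)] B.ninf_kd[of \<psi>\<^sub>2 1 J, OF deg(2)] \<psi>1(3) \<psi>2(3)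
      by (simp add: kd_diff)
    also have "\<dots> = 0" using secsD(4) \<phi>(3) by (simp add: numeral_2_eq_2)
    finally show ?thesis .
  qed
  have nc: "node_cycle L (Suc p) y" using formy cy dw by (simp add: node_cycle_def)
  obtain l0 where l0: "l0 \<in> L" using L_ne by auto
  define e where "e = extend l0 (\<lambda>I. \<Sum>k\<in>L. y k I)"
  have forme: "form L (Suc (Suc p)) e" unfolding e_def by (rule form_tame_boundary[OF finite_L l0 nc])
  define y' where "y' = tame_part L l0 y"
  have y': "y' i J = (- 1) * contract i e J + y i J" for i J by (simp add: y'_def tame_part_def e_def)
  have "y' \<in> tame L (Suc p)" unfolding y'_def by (rule tame_part_tame[OF finite_L l0 nc])
  then obtain c1 c2 where c: "c1 \<in> cycles L \<alpha> (Suc p)" "c2 \<in> cycles L \<beta> (Suc p)"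
    "\<And>i I. i \<in> L \<Longrightarrow> y' i I = c1 i I + c2 i I"
    using assms by (auto simp: tame_split_def splits_def)
  define d1 where "d1 i J = 1 * contract i e J + c1 i J" for i J
  have d1: "d1 \<in> cycles L \<alpha> (Suc p)" unfolding d1_def
    by (rule cycles_scale_add[OF boundary_cycle[OF finite_L forme] c(1)])
  define z1 where "z1 i J = (- 1) * d1 i J + y1 i J" for i J
  define z2 where "z2 i J = 1 * c2 i J + y2 i J" for i J
  have z: "z1 i J = z2 i J" if "i \<in> L" for i J
    using c(3)[OF that, of J] by (simp add: z1_def z2_def d1_def y' y_def algebra_simps)
  have z1: "kd L (bvar L \<alpha> 1) (tensor L (bvar L \<alpha> 1) z1) J = \<phi>\<^sub>1 J" for J
    using d1 \<psi>1(3) unfolding z1_def tensor_scale_add kd_add kd_mult t1 A.cycles_iff by simp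
  have z2: "kd L (bvar L \<beta> (- 1)) (tensor L (bvar L \<beta> (- 1)) z2) J = \<phi>\<^sub>2 J" for J
    using c(2) \<psi>2(3) unfolding z2_def tensor_scale_add kd_add kd_mult t2 B.cycles_iff by simp
  have f1: "form L (Suc p) (z1 i)" if "i \<in> L" for i
    unfolding z1_def y1_def using d1 that
    by (intro form_add form_mult A.form_nval \<psi>1) (auto simp: cycles_def)
  have f2: "form L (Suc p) (z2 i)" if "i \<in> L" for i
    unfolding z2_def y2_def using c(2) that
    by (intro form_add form_mult B.form_nval \<psi>2) (auto simp: cycles_def)
  show "\<exists>\<psi>\<^sub>1 \<psi>\<^sub>2. form L (Suc p) \<psi>\<^sub>1 \<and> form L (Suc p) \<psi>\<^sub>2 \<and> (\<forall>J. (\<psi>\<^sub>1 J, \<psi>\<^sub>2 J) \<in> secs L \<alpha> \<beta> (2 - 1)) \<and>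
        (\<forall>J. kd L (bvar L \<alpha> 1) \<psi>\<^sub>1 J = \<phi>\<^sub>1 J) \<and> (\<forall>J. kd L (bvar L \<beta> (- 1)) \<psi>\<^sub>2 J = \<phi>\<^sub>2 J)"
  proof (intro exI conjI allI)
    show "form L (Suc p) (tensor L (bvar L \<alpha> 1) z1)" by (rule A.form_tensor[OF f1])
    show "form L (Suc p) (tensor L (bvar L \<beta> (- 1)) z2)" by (rule B.form_tensor[OF f2])
    show "(tensor L (bvar L \<alpha> 1) z1 J, tensor L (bvar L \<beta> (- 1)) z2 J) \<in> secs L \<alpha> \<beta> (2 - 1)" for J
    proof -
      have "(tensor L (bvar L \<alpha> 1) z1 J, tensor L (bvar L \<beta> (- 1)) z2 J) \<in> secs L \<alpha> \<beta> 1"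
        unfolding linear_secs using A.degree_tensor B.degree_tensor
        by (auto simp: A.nval_tensor[simplified] B.nval_tensor[simplified] z)
      then show ?thesis by simp
    qed
  qed (use z1 z2 in auto)
qed

text \<open>For $q \ge 3$ the two primitives on the components differ at the nodes by a cycle \<open>y\<close> of the
  coordinate ring of the nodes, evaluated in degree $q - 1 \ge 2$.  Node by node \<open>y\<close> has a
  primitive.  It must come from sections on the first component, that is, the primitive at infinity
  must be the sum of the others.  This can be arranged since each index set of size $p + 2$ misses
  an index \<open>l\<close>, so that the primitive at the node \<open>l\<close> can be changed at will on that index set.\<close>

theorem vanishing_high_degree:
  assumes q: "3 \<le> q" and p: "p + 3 \<le> card L"
  shows "kvan p q"
  unfolding kvan_def
proof (intro allI impI, elim conjE)
  fix \<phi>\<^sub>1 \<phi>\<^sub>2 :: "nat set \<Rightarrow> complex poly"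
  assume \<phi>: "form L p \<phi>\<^sub>1" "form L p \<phi>\<^sub>2" "\<forall>J. (\<phi>\<^sub>1 J, \<phi>\<^sub>2 J) \<in> secs L \<alpha> \<beta> q"
    "\<forall>J. kd L (bvar L \<alpha> 1) \<phi>\<^sub>1 J = 0" "\<forall>J. kd L (bvar L \<beta> (- 1)) \<phi>\<^sub>2 J = 0"
  have q2: "2 \<le> q" using q by simp
  obtain \<psi>\<^sub>1 where \<psi>1: "form L (Suc p) \<psi>\<^sub>1" "\<And>J. degree (\<psi>\<^sub>1 J) \<le> (q - 1) * (card L - 1)"
    "\<And>J. kd L (bvar L \<alpha> 1) \<psi>\<^sub>1 J = \<phi>\<^sub>1 J"
    using A.component_exact[of q p \<phi>\<^sub>1] \<phi> secsD(1) q2 by metis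
  obtain \<psi>\<^sub>2 where \<psi>2: "form L (Suc p) \<psi>\<^sub>2" "\<And>J. degree (\<psi>\<^sub>2 J) \<le> (q - 1) * (card L - 1)"
    "\<And>J. kd L (bvar L \<beta> (- 1)) \<psi>\<^sub>2 J = \<phi>\<^sub>2 J"
    using B.component_exact[of q p \<phi>\<^sub>2] \<phi> secsD(2) q2 by metis
  have Sq: "Suc (q - 1) = q" "Suc (q - 2) = q - 1" using q by auto
  define y where "y l J = nval L \<alpha> 1 (q - 1) l (\<psi>\<^sub>1 J) - nval L \<beta> (- 1) (q - 1) l (\<psi>\<^sub>2 J)" for l J
  define yi where "yi J = ninf L 1 (q - 1) (\<psi>\<^sub>1 J) - ninf L (- 1) (q - 1) (\<psi>\<^sub>2 J)" for J
  have formy: "form L (Suc p) (y l)" for l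
    unfolding y_def by (intro form_diff A.form_nval B.form_nval \<psi>1 \<psi>2)
  have formyi: "form L (Suc p) yi"
    unfolding yi_def by (intro form_diff A.form_ninf B.form_ninf \<psi>1 \<psi>2)
  have cy: "contract l (y l) = (\<lambda>J. 0)" if "l \<in> L" for l
  proof
    fix J
    have "contract l (y l) J = nval L \<alpha> 1 (Suc (q - 1)) l (\<phi>\<^sub>1 J) - nval L \<beta> (- 1) (Suc (q - 1)) l (\<phi>\<^sub>2 J)"
      unfolding y_def contract_diff using A.nval_kd[OF that, of "q - 1" \<psi>\<^sub>1 J] B.nval_kd[OF that, of "q - 1" \<psi>\<^sub>2 J] \<psi>1(3) \<psi>2(3) by simp
    also have "\<dots> = 0" using secsD(3) \<phi>(3) that unfolding Sq by simp
    finally show "contract l (y l) J = 0" .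
  qed
  have dyi: "kd L (\<lambda>_. 1) yi = (\<lambda>J. 0)"
  proof
    fix J
    have "kd L (\<lambda>_. 1) yi J = ninf L 1 (Suc (q - 1)) (\<phi>\<^sub>1 J) - ninf L (- 1) (Suc (q - 1)) (\<phi>\<^sub>2 J)"
      unfolding yi_def kd_diff using A.ninf_kd[of \<psi>\<^sub>1 "q - 1" J, OF \<psi>1(2)] B.ninf_kd[of \<psi>\<^sub>2 "q - 1" J, OF \<psi>2(2)] \<psi>1(3) \<psi>2(3) by simp
    also have "\<dots> = 0" using secsD(4) \<phi>(3) unfolding Sq by simp
    finally show "kd L (\<lambda>_. 1) yi J = 0" .
  qed
  obtain l0 where l0: "l0 \<in> L" using L_ne by auto
  define ei where "ei = extend l0 yi"
  have dei: "kd L (\<lambda>_. 1) ei J = yi J" for J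
    unfolding ei_def using kd_extend[OF finite_L l0, of "\<lambda>_. 1" yi J] dyi by simp
  define r where "r J = ei J - (\<Sum>l\<in>L. extend l (y l) J)" for J
  have formr: "form L (Suc (Suc p)) r"
    unfolding r_def ei_def using formy formyi finite_L l0 by (intro form_diff form_sum form_extend)
  have "\<exists>l. l \<in> L - J" if "J \<subseteq> L" "card J = Suc (Suc p)" for J
  proof -
    have "J \<noteq> L" using that p by auto
    then show ?thesis using that by auto
  qed
  then obtain pick where pick: "\<And>J. J \<subseteq> L \<Longrightarrow> card J = Suc (Suc p) \<Longrightarrow> pick J \<in> L - J" by metis
  define e where "e l J = extend l (y l) J + (if pick J = l then r J else 0)" for l J
  have forme: "form L (Suc (Suc p)) (e l)" if "l \<in> L" for l
    unfolding e_def using form_extend[OF formy finite_L that] formr by (auto simp: form_def)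
  have ce: "contract l (e l) J = y l J" if "l \<in> L" for l J
  proof -
    have "contract l (\<lambda>J. if pick J = l then r J else 0) J = 0"
    proof (cases "l \<in> J \<or> r (insert l J) = 0")
      case True
      then show ?thesis by (auto simp: contract_def)
    next
      case False
      then have "insert l J \<subseteq> L \<and> card (insert l J) = Suc (Suc p)" using formD[OF formr] by blast
      then have "pick (insert l J) \<noteq> l" using pick by blast
      then show ?thesis by (simp add: contract_def)
    qed
    then show ?thesis unfolding e_def contract_add contract_extend_same cy[OF that] by simp
  qed
  have se: "(\<Sum>l\<in>L. e l J) = ei J" for J
  proof (cases "J \<subseteq> L \<and> card J = Suc (Suc p)")
    case True
    then have "pick J \<in> L" using pick by auto
    then have "(\<Sum>l\<in>L. if pick J = l then r J else 0) = r J" using finite_L by simp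
    then show ?thesis by (simp add: e_def sum.distrib r_def)
  next
    case False
    then have r0: "r J = 0" using formD[OF formr] by blast
    then have "e l J = extend l (y l) J" for l by (simp add: e_def)
    then show ?thesis using r0 by (simp add: r_def)
  qed
  define \<xi> where "\<xi> J = A.interp (q - 2) (\<lambda>l. e l J)" for J
  have form\<xi>: "form L (Suc (Suc p)) \<xi>"
    using forme by (auto simp: form_def \<xi>_def A.interp_def intro!: sum.neutral)
  have deg\<xi>: "degree (\<xi> J) \<le> (q - 2) * (card L - 1)" for J unfolding \<xi>_def by (rule A.degree_interp)
  define \<psi> where "\<psi> J = \<psi>\<^sub>1 J - kd L (bvar L \<alpha> 1) \<xi> J" for J
  have "(\<psi> J, \<psi>\<^sub>2 J) \<in> secs L \<alpha> \<beta> (q - 1)" for J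
  proof -
    have "degree (kd L (bvar L \<alpha> 1) \<xi> J) \<le> (q - 1) * (card L - 1)"
      using A.degree_kd_bvar[of \<xi> "q - 2" J, OF deg\<xi>] unfolding Sq .
    then have "degree (\<psi> J) \<le> (q - 1) * (card L - 1)" 
      unfolding \<psi>_def by (intro degree_diff_le \<psi>1(2))
    moreover have "nval L \<alpha> 1 (q - 1) l (\<psi> J) = nval L \<beta> (- 1) (q - 1) l (\<psi>\<^sub>2 J)" if "l \<in> L" for l
    proof -
      have "(\<lambda>J. nval L \<alpha> 1 (q - 2) l (\<xi> J)) = e l"
        using A.nval_interp[of "q - 2" l] that q by (auto simp: \<xi>_def)
      then have "nval L \<alpha> 1 (q - 1) l (kd L (bvar L \<alpha> 1) \<xi> J) = y l J"
        using A.nval_kd[OF that, of "q - 2" \<xi> J] ce[OF that] unfolding Sq by simp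
      then show ?thesis by (simp add: \<psi>_def nval_linear y_def)
    qed
    moreover have "ninf L 1 (q - 1) (\<psi> J) = ninf L (- 1) (q - 1) (\<psi>\<^sub>2 J)"
    proof -
      have "(\<lambda>J. ninf L 1 (q - 2) (\<xi> J)) = ei" by (simp add: \<xi>_def A.ninf_interp se)
      then have "ninf L 1 (q - 1) (kd L (bvar L \<alpha> 1) \<xi> J) = yi J"
        using A.ninf_kd[of \<xi> "q - 2" J, OF deg\<xi>] dei unfolding Sq by simp
      then show ?thesis by (simp add: \<psi>_def ninf_linear yi_def)
    qed
    ultimately show ?thesis using \<psi>2(2) by (simp add: secs_def)
  qed
  moreover have "kd L (bvar L \<alpha> 1) \<psi> J = \<phi>\<^sub>1 J" for J
    unfolding \<psi>_def kd_diff using \<psi>1(3) kd_kd[OF finite_L] by simp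
  moreover have "form L (Suc p) \<psi>" unfolding \<psi>_def
    by (intro form_diff \<psi>1 form_kd[OF form\<xi> finite_L])
  ultimately show "\<exists>\<psi>\<^sub>1 \<psi>\<^sub>2. form L (Suc p) \<psi>\<^sub>1 \<and> form L (Suc p) \<psi>\<^sub>2 \<and> (\<forall>J. (\<psi>\<^sub>1 J, \<psi>\<^sub>2 J) \<in> secs L \<alpha> \<beta> (q - 1)) \<and>
        (\<forall>J. kd L (bvar L \<alpha> 1) \<psi>\<^sub>1 J = \<phi>\<^sub>1 J) \<and> (\<forall>J. kd L (bvar L \<beta> (- 1)) \<psi>\<^sub>2 J = \<phi>\<^sub>2 J)"
    using \<psi>2 by blast
qed

text \<open>On a curve of genus \<open>n\<close>, the group $K_{n-2,3}$ is dual to $K_{0,0}$, the constants.  A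
  nonzero class comes from the volume form: on the first component, the differential of the volume form
  at the point at infinity is multiplied by a quadric \<open>u\<close> that vanishes at the other nodes.  A
  primitive over the whole curve would give linear forms on the two components that are opposite at
  all nodes but the one at infinity, and hence there as well, so that the differential of the volume
  form would vanish there.\<close>

theorem top_nonvanishing:
  assumes n: "2 \<le> card L"
  shows "\<not> kvan (card L - 2) 3"
proof
  assume "kvan (card L - 2) 3"
  have SS: "Suc (Suc (card L - 2)) = card L" using n by simp
  obtain l1 where l1: "l1 \<in> L" using L_ne by auto
  have "L \<noteq> {l1}" using n by auto
  then obtain l2 where l2: "l2 \<in> L" "l2 \<noteq> l1" using l1 by auto
  define u where "u = bvar L \<alpha> 1 l1 * bvar L \<alpha> 1 l2"
  have d1: "degree (bvar L \<alpha> 1 l) \<le> 1 * (card L - 1)" if "l \<in> L" for l using A.degree_bvar[OF that] by simp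
  have degu: "degree u \<le> 2 * (card L - 1)"
    unfolding u_def by (rule degree_mult_bound[OF d1[OF l1] d1[OF l2(1)]]) simp
  have ul: "nval L \<alpha> 1 2 m u = 0" if "m \<in> L" for m
    using nval_mult[of L \<alpha> 1 1 1 m "bvar L \<alpha> 1 l1" "bvar L \<alpha> 1 l2"] A.nval_bvar[OF l1 that]
      A.nval_bvar[OF l2(1) that] l2(2) by (simp add: u_def numeral_2_eq_2 split: if_splits)
  have ui: "ninf L 1 2 u = 1"
    using ninf_mult[OF d1[OF l1] d1[OF l2(1)], of 1] A.ninf_bvar[OF l1] A.ninf_bvar[OF l2(1)]
    by (simp add: u_def numeral_2_eq_2)
  define vol :: "nat set \<Rightarrow> complex" where "vol J = (if J = L then 1 else 0)" for J
  define dv where "dv = kd L (\<lambda>_. 1) vol"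
  have formdv: "form L (Suc (card L - 2)) dv"
    unfolding dv_def by (rule form_kd[OF _ finite_L]) (auto simp: form_def vol_def SS)
  define h where "h J = smult (dv J) u" for J
  define \<phi> where "\<phi> = kd L (bvar L \<alpha> 1) h"
  have formh: "form L (Suc (card L - 2)) h" unfolding h_def by (rule form_map[OF formdv, of "\<lambda>c. smult c u"]) simp
  then have form\<phi>: "form L (card L - 2) \<phi>" unfolding \<phi>_def using finite_L by (rule form_kd)
  have degh: "degree (h J) \<le> 2 * (card L - 1)" for J
    unfolding h_def using degu degree_smult_le order_trans by blast
  have hl: "nval L \<alpha> 1 2 m (h J) = 0" if "m \<in> L" for m J by (simp add: h_def nval_linear ul[OF that])
  have hi: "ninf L 1 2 (h J) = dv J" for J by (simp add: h_def ninf_linear ui)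
  have "(\<phi> J, 0) \<in> secs L \<alpha> \<beta> 3" for J
  proof -
    have "degree (\<phi> J) \<le> 3 * (card L - 1)"
      using A.degree_kd_bvar[of h 2 J, OF degh] by (simp add: \<phi>_def numeral_3_eq_3 numeral_2_eq_2)
    moreover have "nval L \<alpha> 1 (Suc 2) m (\<phi> J) = 0" if "m \<in> L" for m
      unfolding \<phi>_def A.nval_kd[OF that] hl[OF that] by simp
    moreover have "ninf L 1 (Suc 2) (\<phi> J) = 0"
      unfolding \<phi>_def A.ninf_kd[OF degh] hi unfolding dv_def using finite_L by (rule kd_kd)
    ultimately show ?thesis by (simp add: secs_def nval_linear ninf_linear)
  qed
  moreover have "kd L (bvar L \<alpha> 1) \<phi> J = 0" for J unfolding \<phi>_def using finite_L by (rule kd_kd)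
  ultimately obtain \<psi>\<^sub>1 \<psi>\<^sub>2 where \<psi>: "form L (Suc (card L - 2)) \<psi>\<^sub>1" "form L (Suc (card L - 2)) \<psi>\<^sub>2"
    "\<And>J. (\<psi>\<^sub>1 J, \<psi>\<^sub>2 J) \<in> secs L \<alpha> \<beta> 2"
    "\<And>J. kd L (bvar L \<alpha> 1) \<psi>\<^sub>1 J = \<phi> J" "\<And>J. kd L (bvar L \<beta> (- 1)) \<psi>\<^sub>2 J = 0"
    using \<open>kvan (card L - 2) 3\<close>[unfolded kvan_def, rule_format, of \<phi> "\<lambda>J. 0"] form\<phi> by auto
  define \<eta> where "\<eta> J = h J - \<psi>\<^sub>1 J" for J
  have "form L (Suc (card L - 2)) \<eta>" unfolding \<eta>_def by (intro form_diff formh \<psi>)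
  moreover have "degree (\<eta> J) \<le> 2 * (card L - 1)" for J
    unfolding \<eta>_def using degh secsD(1)[OF \<psi>(3)] by (intro degree_diff_le)
  moreover have "kd L (bvar L \<alpha> 1) \<eta> J = 0" for J unfolding \<eta>_def kd_diff \<psi>(4) \<phi>_def by simp
  ultimately obtain \<omega>\<^sub>1 where \<omega>1: "form L (card L) \<omega>\<^sub>1" "\<And>J. degree (\<omega>\<^sub>1 J) \<le> 1 * (card L - 1)"
    "\<And>J. kd L (bvar L \<alpha> 1) \<omega>\<^sub>1 J = \<eta> J"
    using A.component_exact[of 2 "Suc (card L - 2)" \<eta>] unfolding SS by auto
  obtain \<omega>\<^sub>2 where \<omega>2: "form L (card L) \<omega>\<^sub>2" "\<And>J. degree (\<omega>\<^sub>2 J) \<le> 1 * (card L - 1)"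
    "\<And>J. kd L (bvar L \<beta> (- 1)) \<omega>\<^sub>2 J = \<psi>\<^sub>2 J"
    using B.component_exact[of 2 "Suc (card L - 2)" \<psi>\<^sub>2] secsD(2)[OF \<psi>(3)] \<psi> unfolding SS by auto
  have opp: "nval L \<alpha> 1 1 l (\<omega>\<^sub>1 L) + nval L \<beta> (- 1) 1 l (\<omega>\<^sub>2 L) = 0" if "l \<in> L" for l
  proof -
    let ?s = "\<lambda>J. nval L \<alpha> 1 1 l (\<omega>\<^sub>1 J) + nval L \<beta> (- 1) 1 l (\<omega>\<^sub>2 J)"
    have "contract l ?s (L - {l}) = nval L \<alpha> 1 (Suc 1) l (\<eta> (L - {l})) + nval L \<beta> (- 1) (Suc 1) l (\<psi>\<^sub>2 (L - {l}))"
      unfolding contract_add using A.nval_kd[OF that, of 1 \<omega>\<^sub>1] B.nval_kd[OF that, of 1 \<omega>\<^sub>2] \<omega>1(3) \<omega>2(3) by simp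
    also have "\<dots> = 0"
      using secsD(3)[OF \<psi>(3) that] hl[OF that] by (simp add: \<eta>_def nval_linear numeral_2_eq_2)
    finally have "pos_sign l (L - {l}) * ?s L = 0" using that by (simp add: contract_def insert_absorb)
    then show ?thesis by (simp add: pos_sign_def)
  qed
  have "ninf L 1 1 (\<omega>\<^sub>1 L) + ninf L (- 1) 1 (\<omega>\<^sub>2 L) = 0"
    using A.ninf_sum_nval[of "\<omega>\<^sub>1 L"] B.ninf_sum_nval[of "\<omega>\<^sub>2 L"] \<omega>1(2) \<omega>2(2) opp
    by (simp add: sum.distrib[symmetric])
  moreover have "ninf L 1 1 (\<omega>\<^sub>1 J) + ninf L (- 1) 1 (\<omega>\<^sub>2 J) = 0" if "J \<noteq> L" for J
  proof -
    have "\<not> (J \<subseteq> L \<and> card J = card L)" using that card_subset_eq[OF finite_L] by blast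
    then have "\<omega>\<^sub>1 J = 0" "\<omega>\<^sub>2 J = 0" using formD[OF \<omega>1(1)] formD[OF \<omega>2(1)] by blast+
    then show ?thesis by (simp add: ninf_linear)
  qed
  ultimately have z: "(\<lambda>J. ninf L 1 1 (\<omega>\<^sub>1 J) + ninf L (- 1) 1 (\<omega>\<^sub>2 J)) = (\<lambda>J. 0)" by metis
  have "dv J = 0" for J
  proof -
    have "dv J = ninf L 1 2 (\<eta> J) + ninf L (- 1) 2 (\<psi>\<^sub>2 J)"
      using secsD(4)[OF \<psi>(3), of J] hi[of J] by (simp add: \<eta>_def ninf_linear)
    also have "\<dots> = kd L (\<lambda>_. 1) (\<lambda>J. ninf L 1 1 (\<omega>\<^sub>1 J) + ninf L (- 1) 1 (\<omega>\<^sub>2 J)) J"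
      unfolding kd_add using A.ninf_kd[of \<omega>\<^sub>1 1 J, OF \<omega>1(2)] B.ninf_kd[of \<omega>\<^sub>2 1 J, OF \<omega>2(2)] \<omega>1(3) \<omega>2(3)
      by (simp add: numeral_2_eq_2)
    finally show ?thesis unfolding z by simp
  qed
  moreover have "dv (L - {l1}) = pos_sign l1 (L - {l1})"
  proof -
    have "contract l vol (L - {l1}) = (if l = l1 then pos_sign l1 (L - {l1}) else 0)" if "l \<in> L" for l
      using that l1 by (auto simp: contract_def vol_def insert_absorb)
    then show ?thesis unfolding dv_def kd_def using l1 finite_L by (simp cong: sum.cong)
  qed
  ultimately show False using pos_sign_sq[of l1 "L - {l1}", where ?'a=complex] by simp
qed

end

section \<open>Omitting nodes\<close>

text \<open>Restricted to one component, the coordinates other than \<open>l\<close> are $t - \alpha_l$ times the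
  coordinates of the projection from the node \<open>l\<close>.\<close>

lemma cycles_omit:
  assumes "finite L" "l \<in> L" "y \<in> cycles (L - {l}) \<alpha> p"
  shows "(\<lambda>i I. if i = l then 0 else y i I) \<in> cycles L \<alpha> p"
proof -
  let ?L = "L - {l}" and ?\<tau> = "[:- \<alpha> l, 1:]" and ?y = "\<lambda>i I. if i = l then 0 else y i I"
  have L: "insert l ?L = L" using assms(2) by auto
  have lag: "lag L \<alpha> i = ?\<tau> * lag ?L \<alpha> i" if "i \<in> ?L" for i
    using lag_insert[of ?L l i \<alpha>] that assms(1) unfolding L by simp
  have form: "form ?L p (y i)" if "i \<in> ?L" for i using assms(3) that by (simp add: cycles_def)
  have t: "tensor L (lag L \<alpha>) ?y = (\<lambda>J. ?\<tau> * tensor ?L (lag ?L \<alpha>) y J)"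
  proof
    fix J
    have "tensor L (lag L \<alpha>) ?y J = (\<Sum>i\<in>?L. smult (y i J) (lag L \<alpha> i))"
      unfolding tensor_def using assms by (intro sum.mono_neutral_cong_right) auto
    also have "\<dots> = ?\<tau> * tensor ?L (lag ?L \<alpha>) y J"
      unfolding tensor_def sum_distrib_left by (intro sum.cong refl) (simp only: lag mult_smult_right)
    finally show "tensor L (lag L \<alpha>) ?y J = ?\<tau> * tensor ?L (lag ?L \<alpha>) y J" .
  qed
  have supp: "supported ?L (tensor ?L (lag ?L \<alpha>) y)"
    using form by (auto simp: supported_def tensor_def form_def intro!: sum.neutral)
  have "kd L (lag L \<alpha>) (tensor L (lag L \<alpha>) ?y) J = 0" for J
  proof -
    have "kd L (lag L \<alpha>) (tensor L (lag L \<alpha>) ?y) J = ?\<tau> * kd L (lag L \<alpha>) (tensor ?L (lag ?L \<alpha>) y) J"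
      unfolding t by (rule kd_mult)
    also have "kd L (lag L \<alpha>) (tensor ?L (lag ?L \<alpha>) y) J = kd ?L (lag L \<alpha>) (tensor ?L (lag ?L \<alpha>) y) J"
      using assms by (intro kd_subset[OF supp]) auto
    also have "\<dots> = kd ?L (\<lambda>i. ?\<tau> * lag ?L \<alpha> i) (tensor ?L (lag ?L \<alpha>) y) J"
      by (rule kd_cong[OF lag])
    also have "\<dots> = 0" unfolding kd_scale_vars using assms(3) by (simp add: cycles_def)
    finally show ?thesis by simp
  qed
  moreover have "form L p (?y i)" if "i \<in> L" for i
    using form[of i] that by (auto simp: form_def)
  ultimately show ?thesis by (simp add: cycles_def)
qed

lemma splits_omit:
  assumes "finite L" "l \<in> L" "splits (L - {l}) \<alpha> \<beta> p y" "\<And>I. y l I = 0"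
  shows "splits L \<alpha> \<beta> p y"
proof -
  obtain y1 y2 where y: "y1 \<in> cycles (L - {l}) \<alpha> p" "y2 \<in> cycles (L - {l}) \<beta> p"
    "\<And>i I. i \<in> L - {l} \<Longrightarrow> y i I = y1 i I + y2 i I"
    using assms(3) by (auto simp: splits_def)
  show ?thesis unfolding splits_def
    by (rule bexI[OF _ cycles_omit[OF assms(1,2) y(1)]], rule bexI[OF _ cycles_omit[OF assms(1,2) y(2)]])
      (auto simp: y assms(4))
qed

text \<open>The tensor $x_I \otimes (x_m - x_{m_0(I)})$.\<close>

definition elementary :: "(nat set \<Rightarrow> nat) \<Rightarrow> nat set \<times> nat \<Rightarrow> nat \<Rightarrow> nat set \<Rightarrow> complex" where
  "elementary m0 = (\<lambda>(I, m) i K. if K = I then (if i = m then 1 else 0) - (if i = m0 I then 1 else 0) else 0)"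

definition elementary_index :: "nat set \<Rightarrow> nat \<Rightarrow> (nat set \<times> nat) set" where
  "elementary_index L p = (SIGMA I:{I. I \<subseteq> L \<and> card I = p}. L - I)"

lemma finite_elementary_index: "finite L \<Longrightarrow> finite (elementary_index L p)"
  unfolding elementary_index_def by (intro finite_SigmaI) (auto intro: finite_subset[of _ "Pow L"])

lemma tame_expand:
  assumes "finite L" and m0: "\<And>I. I \<subseteq> L \<Longrightarrow> card I = p \<Longrightarrow> m0 I \<in> L - I"
    and y: "y \<in> tame L p" and i: "i \<in> L"
  shows "y i K = (\<Sum>\<tau>\<in>elementary_index L p. y (snd \<tau>) (fst \<tau>) * elementary m0 \<tau> i K)"
proof -
  have fin: "finite {I. I \<subseteq> L \<and> card I = p}" by (rule finite_subset[of _ "Pow L"]) (use assms in auto)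
  have "(\<Sum>\<tau>\<in>elementary_index L p. y (snd \<tau>) (fst \<tau>) * elementary m0 \<tau> i K)
    = (\<Sum>I\<in>{I. I \<subseteq> L \<and> card I = p}. \<Sum>m\<in>L - I. y m I * elementary m0 (I, m) i K)"
    unfolding elementary_index_def using assms(1) fin by (subst sum.Sigma) (auto simp: case_prod_beta)
  also have "\<dots> = (\<Sum>I\<in>{I. I \<subseteq> L \<and> card I = p}. if I = K then y i K else 0)"
  proof (rule sum.cong[OF refl])
    fix I assume "I \<in> {I. I \<subseteq> L \<and> card I = p}"
    show "(\<Sum>m\<in>L - I. y m I * elementary m0 (I, m) i K) = (if I = K then y i K else 0)"
    proof (cases "I = K")
      case True
      have "(\<Sum>m\<in>L - I. y m I) = (\<Sum>m\<in>L. y m I)"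
        using y assms(1) by (intro sum.mono_neutral_left) (auto simp: tame_def)
      also have "\<dots> = 0" using y by (simp add: tame_def)
      finally have z: "(\<Sum>m\<in>L - I. y m I) = 0" .
      have "(\<Sum>m\<in>L - I. y m I * elementary m0 (I, m) i K)
        = (\<Sum>m\<in>L - I. (if m = i then y i I else 0)) - (\<Sum>m\<in>L - I. y m I) * (if i = m0 I then 1 else 0)"
        unfolding sum_distrib_right sum_subtractf[symmetric] using True
        by (intro sum.cong) (auto simp: elementary_def)
      also have "\<dots> = y i I" using y i assms(1) unfolding z by (auto simp: tame_def)
      finally show ?thesis using True by simp
    qed (simp add: elementary_def)
  qed
  also have "\<dots> = y i K"
  proof (cases "K \<subseteq> L \<and> card K = p")
    case False
    then have "y i K = 0" using y i formD[of L p "y i" K] by (auto simp: tame_def)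
    then show ?thesis by (auto intro!: sum.neutral)
  qed (use fin in simp)
  finally show ?thesis by simp
qed

lemma elementary_tame:
  assumes "finite L" "I \<subseteq> L" "card I = p" "m \<in> L - I" "m0 I \<in> L - I"
  shows "elementary m0 (I, m) \<in> tame L p"
  unfolding tame_def
proof (intro CollectI conjI allI ballI impI)
  show "(\<Sum>i\<in>L. elementary m0 (I, m) i K) = 0" for K
    using assms by (cases "K = I") (auto simp: elementary_def sum_subtractf)
qed (use assms in \<open>auto simp: elementary_def form_def\<close>)

text \<open>The tame elements are spanned by tensors that involve at most $p + 2$ of the coordinates.
  Such a tensor lives on the curve that is projected from a node whose coordinate it does not
  involve.\<close>

theorem tame_split_from_projections:
  assumes "finite L" "p + 3 \<le> card L" "\<And>l. l \<in> L \<Longrightarrow> tame_split (L - {l}) \<alpha> \<beta> p"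
  shows "tame_split L \<alpha> \<beta> p"
  unfolding tame_split_def
proof
  fix y assume y: "y \<in> tame L p"
  have "\<exists>m. m \<in> L - I" if "I \<subseteq> L" "card I = p" for I
  proof -
    have "I \<noteq> L" using that assms(2) by auto
    then show ?thesis using that by auto
  qed
  then obtain m0 where m0: "\<And>I. I \<subseteq> L \<Longrightarrow> card I = p \<Longrightarrow> m0 I \<in> L - I" by metis
  have "splits L \<alpha> \<beta> p (elementary m0 \<tau>)" if "\<tau> \<in> elementary_index L p" for \<tau>
  proof -
    obtain I m where \<tau>: "\<tau> = (I, m)" by (cases \<tau>)
    have I: "I \<subseteq> L" "card I = p" "m \<in> L - I" using that by (auto simp: \<tau> elementary_index_def)
    have finI: "finite I" using I assms(1) finite_subset by blast
    have "card (insert m (insert (m0 I) I)) \<le> p + 2"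
      using I finI by (simp add: card_insert_if)
    then have "insert m (insert (m0 I) I) \<noteq> L" using assms(2) by auto
    moreover have "insert m (insert (m0 I) I) \<subseteq> L" using I m0[of I] by auto
    ultimately obtain l where l: "l \<in> L" "l \<notin> I" "l \<noteq> m" "l \<noteq> m0 I" by auto
    have "elementary m0 \<tau> \<in> tame (L - {l}) p"
      unfolding \<tau> using I l m0[of I] assms(1) by (intro elementary_tame) auto
    then have "splits (L - {l}) \<alpha> \<beta> p (elementary m0 \<tau>)"
      using assms(3)[OF l(1)] by (simp add: tame_split_def)
    then show ?thesis
      by (rule splits_omit[OF assms(1) l(1)]) (use l in \<open>auto simp: \<tau> elementary_def\<close>)
  qed
  then have "splits L \<alpha> \<beta> p (\<lambda>i K. \<Sum>\<tau>\<in>elementary_index L p. y (snd \<tau>) (fst \<tau>) * elementary m0 \<tau> i K)"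
    by (rule splits_sum[OF finite_elementary_index[OF assms(1)],
          where c = "\<lambda>\<tau>. y (snd \<tau>) (fst \<tau>)" and y = "elementary m0"])
  then show "splits L \<alpha> \<beta> p y"
    by (rule splits_cong) (rule tame_expand[OF assms(1) m0 y, symmetric])
qed

section \<open>Regular functions of the parameters\<close>

inductive_set polyf :: "(nat \<times> nat) set \<Rightarrow> (params \<Rightarrow> complex) set" for X where
  const: "(\<lambda>a. c) \<in> polyf X"
| var: "v \<in> X \<Longrightarrow> (\<lambda>a. a v) \<in> polyf X"
| add: "f \<in> polyf X \<Longrightarrow> h \<in> polyf X \<Longrightarrow> (\<lambda>a. f a + h a) \<in> polyf X"
| mult: "f \<in> polyf X \<Longrightarrow> h \<in> polyf X \<Longrightarrow> (\<lambda>a. f a * h a) \<in> polyf X"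

definition separated :: "(nat \<times> nat) set \<Rightarrow> params \<Rightarrow> bool" where
  "separated X a \<longleftrightarrow> (\<forall>i k j. (i, j) \<in> X \<and> (k, j) \<in> X \<and> i \<noteq> k \<longrightarrow> a (i, j) \<noteq> a (k, j))"

text \<open>The denominators do not vanish at separated parameters.\<close>

inductive_set regf :: "(nat \<times> nat) set \<Rightarrow> (params \<Rightarrow> complex) set" for X where
  const: "(\<lambda>a. c) \<in> regf X"
| var: "v \<in> X \<Longrightarrow> (\<lambda>a. a v) \<in> regf X"
| add: "f \<in> regf X \<Longrightarrow> h \<in> regf X \<Longrightarrow> (\<lambda>a. f a + h a) \<in> regf X"
| mult: "f \<in> regf X \<Longrightarrow> h \<in> regf X \<Longrightarrow> (\<lambda>a. f a * h a) \<in> regf X"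
| inv: "(i, j) \<in> X \<Longrightarrow> (k, j) \<in> X \<Longrightarrow> i \<noteq> k \<Longrightarrow> (\<lambda>a. inverse (a (i, j) - a (k, j))) \<in> regf X"

lemma polyf_minus: "f \<in> polyf X \<Longrightarrow> h \<in> polyf X \<Longrightarrow> (\<lambda>a. f a - h a) \<in> polyf X"
  using polyf.add[of f X "\<lambda>a. (- 1) * h a"] polyf.mult[OF polyf.const[of "- 1" X]] by simp

lemma regf_minus: "f \<in> regf X \<Longrightarrow> h \<in> regf X \<Longrightarrow> (\<lambda>a. f a - h a) \<in> regf X"
  using regf.add[of f X "\<lambda>a. (- 1) * h a"] regf.mult[OF regf.const[of "- 1" X]] by simp

lemma regf_sum: "(\<And>i. i \<in> A \<Longrightarrow> f i \<in> regf X) \<Longrightarrow> (\<lambda>a. \<Sum>i\<in>A. f i a) \<in> regf X"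
  by (induction A rule: infinite_finite_induct) (auto intro: regf.intros)

lemma regf_prod: "(\<And>i. i \<in> A \<Longrightarrow> f i \<in> regf X) \<Longrightarrow> (\<lambda>a. \<Prod>i\<in>A. f i a) \<in> regf X"
  by (induction A rule: infinite_finite_induct) (auto intro: regf.intros)

lemma polyf_prod: "(\<And>i. i \<in> A \<Longrightarrow> f i \<in> polyf X) \<Longrightarrow> (\<lambda>a. \<Prod>i\<in>A. f i a) \<in> polyf X"
  by (induction A rule: infinite_finite_induct) (auto intro: polyf.intros)

lemma polyf_mono: "f \<in> polyf X \<Longrightarrow> X \<subseteq> Y \<Longrightarrow> f \<in> polyf Y"
  by (induction rule: polyf.induct) (auto intro: polyf.intros)

lemma regf_poly: "f \<in> regf X \<Longrightarrow> (\<lambda>a. poly F (f a)) \<in> regf X"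
  by (induction F) (auto intro: regf.intros)

lemma regf_fraction:
  assumes "f \<in> regf X"
  shows "\<exists>P\<in>polyf X. \<exists>Q\<in>polyf X. \<forall>a. separated X a \<longrightarrow> Q a \<noteq> 0 \<and> f a * Q a = P a"
  using assms
proof (induction rule: regf.induct)
  case (const c)
  show ?case by (rule bexI[OF _ polyf.const[of c]], rule bexI[OF _ polyf.const[of 1]]) auto
next
  case (var v)
  show ?case by (rule bexI[OF _ polyf.var[OF var]], rule bexI[OF _ polyf.const[of 1]]) auto
next
  case (add f h)
  then obtain P Q P' Q' where *: "P \<in> polyf X" "Q \<in> polyf X" "P' \<in> polyf X" "Q' \<in> polyf X"
    "\<And>a. separated X a \<Longrightarrow> Q a \<noteq> 0 \<and> f a * Q a = P a"
    "\<And>a. separated X a \<Longrightarrow> Q' a \<noteq> 0 \<and> h a * Q' a = P' a" by blast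
  show ?case
  proof (rule bexI[of _ "\<lambda>a. P a * Q' a + P' a * Q a"], rule bexI[of _ "\<lambda>a. Q a * Q' a"], intro allI impI)
    fix a assume "separated X a"
    then show "Q a * Q' a \<noteq> 0 \<and> (f a + h a) * (Q a * Q' a) = P a * Q' a + P' a * Q a"
      using *(5,6)[of a] by (auto simp: algebra_simps)
  qed (intro polyf.intros *)+
next
  case (mult f h)
  then obtain P Q P' Q' where *: "P \<in> polyf X" "Q \<in> polyf X" "P' \<in> polyf X" "Q' \<in> polyf X"
    "\<And>a. separated X a \<Longrightarrow> Q a \<noteq> 0 \<and> f a * Q a = P a"
    "\<And>a. separated X a \<Longrightarrow> Q' a \<noteq> 0 \<and> h a * Q' a = P' a" by blast
  show ?case
  proof (rule bexI[of _ "\<lambda>a. P a * P' a"], rule bexI[of _ "\<lambda>a. Q a * Q' a"], intro allI impI)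
    fix a assume "separated X a"
    then have "Q a \<noteq> 0" "Q' a \<noteq> 0" "P a = f a * Q a" "P' a = h a * Q' a" using *(5,6)[of a] by auto
    then show "Q a * Q' a \<noteq> 0 \<and> (f a * h a) * (Q a * Q' a) = P a * P' a" by simp
  qed (intro polyf.intros *)+
next
  case (inv i j k)
  show ?case
    by (rule bexI[OF _ polyf.const[of 1]], rule bexI[of _ "\<lambda>a. a (i, j) - a (k, j)"])
      (use inv in \<open>auto simp: separated_def intro!: polyf_minus polyf.var\<close>)
qed

text \<open>Elimination: the Schur complement of a diagonal entry, multiplied by this entry, is a smaller
  matrix of regular functions that is again the identity at \<open>b\<close>.  The function \<open>d\<close> is the product of
  the pivots.\<close>

lemma regf_matrix_left_inverse:
  fixes M :: "'t \<Rightarrow> 't \<Rightarrow> params \<Rightarrow> complex"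
  assumes "finite T" "\<And>\<sigma> \<tau>. \<sigma> \<in> T \<Longrightarrow> \<tau> \<in> T \<Longrightarrow> M \<sigma> \<tau> \<in> regf X"
    and "\<And>\<sigma> \<tau>. \<sigma> \<in> T \<Longrightarrow> \<tau> \<in> T \<Longrightarrow> M \<sigma> \<tau> b = (if \<sigma> = \<tau> then 1 else 0)"
  shows "\<exists>d\<in>regf X. d b = 1 \<and> (\<forall>a. d a \<noteq> 0 \<longrightarrow>
    (\<forall>\<rho>\<in>T. \<exists>n. \<forall>\<tau>\<in>T. (\<Sum>\<sigma>\<in>T. n \<sigma> * M \<sigma> \<tau> a) = (if \<rho> = \<tau> then 1 else 0)))"
  using assms
proof (induction T arbitrary: M rule: finite_induct)
  case empty
  show ?case by (intro bexI[OF _ regf.const[of 1]]) auto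
next
  case (insert t T)
  define M' where "M' \<sigma> \<tau> a = M t t a * M \<sigma> \<tau> a - M \<sigma> t a * M t \<tau> a" for \<sigma> \<tau> a
  have "M' \<sigma> \<tau> \<in> regf X" if "\<sigma> \<in> T" "\<tau> \<in> T" for \<sigma> \<tau>
    unfolding M'_def by (intro regf_minus regf.mult insert.prems) (use that in auto)
  moreover have "M' \<sigma> \<tau> b = (if \<sigma> = \<tau> then 1 else 0)" if "\<sigma> \<in> T" "\<tau> \<in> T" for \<sigma> \<tau>
    using that insert.hyps by (auto simp: M'_def insert.prems)
  ultimately obtain d' where d': "d' \<in> regf X" "d' b = 1"
    "\<And>a \<rho>. d' a \<noteq> 0 \<Longrightarrow> \<rho> \<in> T \<Longrightarrow> \<exists>n. \<forall>\<tau>\<in>T. (\<Sum>\<sigma>\<in>T. n \<sigma> * M' \<sigma> \<tau> a) = (if \<rho> = \<tau> then 1 else 0)"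
    using insert.IH[of M'] by blast
  define hit where "hit a v \<longleftrightarrow> (\<exists>n. \<forall>\<tau>\<in>insert t T. (\<Sum>\<sigma>\<in>insert t T. n \<sigma> * M \<sigma> \<tau> a) = v \<tau>)" for a v
  have hit_scale_add: "hit a (\<lambda>\<tau>. c * v \<tau> + w \<tau>)" if vw: "hit a v" "hit a w" for a c v w
  proof -
    obtain n n' where "\<forall>\<tau>\<in>insert t T. (\<Sum>\<sigma>\<in>insert t T. n \<sigma> * M \<sigma> \<tau> a) = v \<tau>"
      "\<forall>\<tau>\<in>insert t T. (\<Sum>\<sigma>\<in>insert t T. n' \<sigma> * M \<sigma> \<tau> a) = w \<tau>"
      using vw unfolding hit_def by blast
    then show ?thesis unfolding hit_def
      by (intro exI[of _ "\<lambda>\<sigma>. c * n \<sigma> + n' \<sigma>"])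
        (simp del: sum.insert add: distrib_right sum.distrib mult.assoc flip: sum_distrib_left)
  qed
  have hit_sum: "hit a (\<lambda>\<tau>. (\<Sum>i\<in>A. c i * v i \<tau>) + w \<tau>)"
    if "hit a w" "finite A" "\<And>i. i \<in> A \<Longrightarrow> hit a (v i)" for a w c v and A :: "'t set"
    using that(2,3)
  proof (induction A rule: finite_induct)
    case empty
    then show ?case using that(1) by simp
  next
    case (insert i A)
    then show ?case using hit_scale_add[of a "v i" "\<lambda>\<tau>. (\<Sum>i\<in>A. c i * v i \<tau>) + w \<tau>" "c i"]
      by (simp add: add.assoc)
  qed
  have hit_cong: "hit a w" if "hit a v" "\<And>\<tau>. \<tau> \<in> insert t T \<Longrightarrow> v \<tau> = w \<tau>" for a v w
    using that unfolding hit_def by auto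
  have row: "hit a (\<lambda>\<tau>. M \<sigma> \<tau> a)" if "\<sigma> \<in> insert t T" for a \<sigma>
  proof -
    have "(\<Sum>\<sigma>'\<in>insert t T. (if \<sigma>' = \<sigma> then 1 else 0) * M \<sigma>' \<tau> a) = M \<sigma> \<tau> a" for \<tau>
    proof -
      have "(\<Sum>\<sigma>'\<in>insert t T. (if \<sigma>' = \<sigma> then 1 else 0) * M \<sigma>' \<tau> a)
        = (\<Sum>\<sigma>'\<in>insert t T. if \<sigma>' = \<sigma> then M \<sigma> \<tau> a else 0)" by (rule sum.cong) auto
      then show ?thesis using that insert.hyps by (simp del: sum.insert)
    qed
    then show ?thesis unfolding hit_def by (intro exI[of _ "\<lambda>\<sigma>'. if \<sigma>' = \<sigma> then 1 else 0"]) auto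
  qed
  have main: "hit a (\<lambda>\<tau>. if \<rho> = \<tau> then 1 else 0)"
    if nz: "M t t a * d' a \<noteq> 0" and \<rho>: "\<rho> \<in> insert t T" for a \<rho>
  proof -
    have row': "hit a (\<lambda>\<tau>. M t t a * M \<sigma> \<tau> a + (- M \<sigma> t a) * M t \<tau> a)" if "\<sigma> \<in> T" for \<sigma>
      using hit_scale_add[OF row[of \<sigma> a] hit_scale_add[OF row[of t a] row[of t a], of "- M \<sigma> t a - 1"], of "M t t a"] that
      by (auto elim!: hit_cong simp: algebra_simps)
    have zero: "hit a (\<lambda>\<tau>. 0)" unfolding hit_def by (intro exI[of _ "\<lambda>_. 0"]) auto
    have small: "hit a (\<lambda>\<tau>. if \<rho> = \<tau> then 1 else 0)" if \<rho>T: "\<rho> \<in> T" for \<rho>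
    proof -
      obtain n where n: "\<forall>\<tau>\<in>T. (\<Sum>\<sigma>\<in>T. n \<sigma> * M' \<sigma> \<tau> a) = (if \<rho> = \<tau> then 1 else 0)"
        using d'(3)[OF _ \<rho>T, of a] nz by auto
      have "hit a (\<lambda>\<tau>. (\<Sum>\<sigma>\<in>T. n \<sigma> * (M t t a * M \<sigma> \<tau> a + (- M \<sigma> t a) * M t \<tau> a)) + 0)"
        by (rule hit_sum[OF zero insert.hyps(1) row'])
      then show ?thesis
      proof (rule hit_cong)
        fix \<tau> assume "\<tau> \<in> insert t T"
        then show "(\<Sum>\<sigma>\<in>T. n \<sigma> * (M t t a * M \<sigma> \<tau> a + (- M \<sigma> t a) * M t \<tau> a)) + 0 = (if \<rho> = \<tau> then 1 else 0)"
          using n \<rho>T insert.hyps(2) by (cases "\<tau> = t") (auto simp: M'_def)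
      qed
    qed
    show ?thesis
    proof (cases "\<rho> = t")
      case True
      have "hit a (\<lambda>\<tau>. (\<Sum>i\<in>T. (- M t i a) * (if i = \<tau> then 1 else 0)) + M t \<tau> a)"
        by (rule hit_sum[OF row insert.hyps(1) small]) auto
      from hit_scale_add[OF this zero, of "inverse (M t t a)"] show ?thesis
      proof (rule hit_cong)
        fix \<tau> assume \<tau>: "\<tau> \<in> insert t T"
        have "(\<Sum>i\<in>T. (- M t i a) * (if i = \<tau> then 1 else 0)) = (\<Sum>i\<in>T. if i = \<tau> then - M t \<tau> a else 0)"
          by (rule sum.cong) auto
        then show "inverse (M t t a) * ((\<Sum>i\<in>T. (- M t i a) * (if i = \<tau> then 1 else 0)) + M t \<tau> a) + 0
            = (if \<rho> = \<tau> then 1 else 0)"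
          using \<tau> insert.hyps nz True by auto
      qed
    qed (use small \<rho> in auto)
  qed
  show ?case
  proof (rule bexI[of _ "\<lambda>a. M t t a * d' a"], intro conjI allI impI ballI)
    show "M t t b * d' b = 1" by (simp add: d' insert.prems)
    show "(\<lambda>a. M t t a * d' a) \<in> regf X" by (intro regf.mult d' insert.prems) auto
  qed (use main in \<open>simp only: hit_def\<close>)
qed

section \<open>Moving the points on a component\<close>

text \<open>The cycles on one component form a subspace of $\Lambda^p P \otimes P$, where $P$ is the space
  of polynomials of degree at most $n - 1$, and this subspace does not depend on the points; only
  the basis of $P$ does.  Hence a cycle can be carried along when the points move.  To say this
  without choosing a basis, polynomials are viewed as sections with second component zero.\<close>

definition first_secs :: "nat \<Rightarrow> sect set" where
  "first_secs m = {(F, G). degree F \<le> m \<and> G = 0}"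

definition first_coord :: "nat set \<Rightarrow> (nat \<Rightarrow> complex) \<Rightarrow> nat \<Rightarrow> sect \<Rightarrow> complex" where
  "first_coord L \<alpha> l v = nval L \<alpha> 1 1 l (fst v)"

definition first_basis :: "nat set \<Rightarrow> (nat \<Rightarrow> complex) \<Rightarrow> nat \<Rightarrow> sect" where
  "first_basis L \<alpha> l = (lag L \<alpha> l, 0)"

lemma first_secs_subspace: "sect.subspace (first_secs m)"
  unfolding sect.subspace_def first_secs_def sect_scale_def
  by (auto simp: zero_prod_def intro: degree_add_le intro!: order_trans[OF degree_smult_le])

lemma first_secs_mult: "v \<in> first_secs m \<Longrightarrow> u \<in> first_secs m' \<Longrightarrow> sect_mult v u \<in> first_secs (m + m')"
  unfolding first_secs_def sect_mult_def by (auto intro: degree_mult_bound)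

lemma bvar_one: "bvar L \<alpha> 1 = lag L \<alpha>"
  by (auto simp: bvar_def)

lemma frame_first:
  assumes "component L \<alpha> 1"
  shows "frame L (first_secs (card L - 1)) (first_basis L \<alpha>) (first_coord L \<alpha>)"
proof -
  interpret component L \<alpha> 1 by fact
  show ?thesis
  proof
    show "finite L" by (rule finite_L)
    show "sect.subspace (first_secs (card L - 1))" by (rule first_secs_subspace)
    show "first_basis L \<alpha> l \<in> first_secs (card L - 1)" if "l \<in> L" for l
      using degree_bvar[OF that] by (simp add: first_basis_def first_secs_def bvar_one)
    show "first_coord L \<alpha> l (v + w) = first_coord L \<alpha> l v + first_coord L \<alpha> l w" for l v w
      by (simp add: first_coord_def nval_linear)
    show "first_coord L \<alpha> l (sect_scale r v) = r * first_coord L \<alpha> l v" for l r v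
      by (simp add: first_coord_def nval_linear sect_scale_def)
    show "first_coord L \<alpha> l (first_basis L \<alpha> m) = (if l = m then 1 else 0)" if "l \<in> L" "m \<in> L" for l m
      using nval_bvar[OF that(2,1)] by (auto simp: first_coord_def first_basis_def bvar_one)
    show "v = (\<Sum>l\<in>L. sect_scale (first_coord L \<alpha> l v) (first_basis L \<alpha> l))"
      if "v \<in> first_secs (card L - 1)" for v
    proof -
      obtain F G where "v = (F, G)" by (cases v)
      then have v: "v = (F, 0)" "degree F \<le> card L - 1" using that by (auto simp: first_secs_def)
      have "fst (\<Sum>l\<in>L. sect_scale (first_coord L \<alpha> l v) (first_basis L \<alpha> l)) = F"
        unfolding fst_sum
        by (rule trans[OF _ expand_linear[OF v(2), symmetric]])
          (simp add: sect_scale_def first_coord_def first_basis_def v bvar_one)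
      moreover have "snd (\<Sum>l\<in>L. sect_scale (first_coord L \<alpha> l v) (first_basis L \<alpha> l)) = 0"
        unfolding snd_sum by (simp add: sect_scale_def first_basis_def)
      ultimately show ?thesis by (simp add: v prod_eq_iff)
    qed
  qed
qed

text \<open>The coordinates for the points \<open>\<alpha>'\<close> of the tensor of polynomials with coordinates \<open>y\<close> for
  the points \<open>\<alpha>\<close>.\<close>

definition transport :: "nat set \<Rightarrow> (nat \<Rightarrow> complex) \<Rightarrow> (nat \<Rightarrow> complex) \<Rightarrow> nat \<Rightarrow>
    (nat \<Rightarrow> nat set \<Rightarrow> complex) \<Rightarrow> nat \<Rightarrow> nat set \<Rightarrow> complex" where
  "transport L \<alpha> \<alpha>' p y i J = (\<Sum>K\<in>{K. K \<subseteq> L \<and> card K = p}.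
     wedge L (first_coord L \<alpha>') (map (first_basis L \<alpha>) (sorted_list_of_set K)) J
       * nval L \<alpha>' 1 1 i (tensor L (lag L \<alpha>) y K))"

text \<open>Whether a chain is a cycle is expressed by the relations between polynomials, in which the
  points do not occur.\<close>

lemma transport_cycles:
  assumes \<alpha>: "component L \<alpha> 1" and \<alpha>': "component L \<alpha>' 1" and y: "y \<in> cycles L \<alpha> p"
  shows "transport L \<alpha> \<alpha>' p y \<in> cycles L \<alpha>' p"
proof -
  interpret F: frame L "first_secs (card L - 1)" "first_basis L \<alpha>" "first_coord L \<alpha>"
    by (rule frame_first[OF \<alpha>])
  interpret F': frame L "first_secs (card L - 1)" "first_basis L \<alpha>'" "first_coord L \<alpha>'"
    by (rule frame_first[OF \<alpha>'])
  interpret A: component L \<alpha> 1 by fact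
  interpret A': component L \<alpha>' 1 by fact
  let ?V = "first_secs (card L - 1)" and ?W = "first_secs ((card L - 1) + (card L - 1))"
  define \<psi> where "\<psi> K = (tensor L (lag L \<alpha>) y K, 0 :: complex poly)" for K
  have formt: "form L p (tensor L (lag L \<alpha>) y)"
    using A.form_tensor[of p y] y by (simp add: bvar_one cycles_def)
  then have form\<psi>: "form L p \<psi>" by (auto simp: form_def \<psi>_def zero_prod_def)
  have \<psi>V: "\<psi> K \<in> ?V" for K using A.degree_tensor[of y K] by (simp add: \<psi>_def first_secs_def bvar_one)
  define f where "f = F.normal_chain p \<psi>"
  have f: "f \<in> chains ?V ?V p" unfolding f_def by (rule F.normal_chain_in_chains[OF \<psi>V])
  have mult: "v \<in> ?V \<Longrightarrow> u \<in> ?V \<Longrightarrow> sect_mult v u \<in> ?W" for v u by (rule first_secs_mult)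
  have "coords L (first_coord L \<alpha>) f = \<psi>" unfolding f_def using F.coords_normal_chain[OF form\<psi>] by blast
  then have "\<forall>J. skd L (first_basis L \<alpha>) (coords L (first_coord L \<alpha>) f) J = 0"
    using y by (simp add: skd_def \<psi>_def first_basis_def cycles_def zero_prod_def)
  then have "koszul_d f \<in> relations ?V ?W (p - 1)"
    using F.koszul_d_relations_iff[OF f first_secs_subspace mult] by blast
  then have skd: "skd L (first_basis L \<alpha>') (coords L (first_coord L \<alpha>') f) J = 0" for J
    using F'.koszul_d_relations_iff[OF f first_secs_subspace mult] by blast
  define \<Psi> where "\<Psi> J = fst (coords L (first_coord L \<alpha>') f J)" for J
  have "kd L (lag L \<alpha>') \<Psi> J = 0" for J
    using skd[of J] by (simp add: skd_def \<Psi>_def[abs_def] first_basis_def zero_prod_def)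
  moreover have deg\<Psi>: "degree (\<Psi> J) \<le> card L - 1" for J
    using F'.coords_chains(1)[OF f first_secs_subspace, of J] by (auto simp: \<Psi>_def first_secs_def)
  moreover have form\<Psi>: "form L p \<Psi>"
    using F'.coords_chains(2)[OF f first_secs_subspace] by (auto simp: form_def \<Psi>_def)
  moreover have tr: "transport L \<alpha> \<alpha>' p y = (\<lambda>i J. nval L \<alpha>' 1 1 i (\<Psi> J))"
  proof (intro ext)
    fix i J
    have "\<Psi> J = (\<Sum>K\<in>{K. K \<subseteq> L \<and> card K = p}.
      smult (wedge L (first_coord L \<alpha>') (map (first_basis L \<alpha>) (sorted_list_of_set K)) J) (tensor L (lag L \<alpha>) y K))"
      unfolding \<Psi>_def f_def F.normal_chain_def coords_def lin_sect fst_sum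
      by (simp add: sect_scale_def \<psi>_def)
    then show "transport L \<alpha> \<alpha>' p y i J = nval L \<alpha>' 1 1 i (\<Psi> J)"
      by (simp add: transport_def nval_linear)
  qed
  ultimately show ?thesis
    using A'.tensor_coordinates[of \<Psi>] A'.form_nval[OF form\<Psi>] by (simp add: cycles_def bvar_one)
qed

lemma transport_refl:
  assumes \<alpha>: "component L \<alpha> 1" and i: "i \<in> L" and y: "form L p (y i)"
  shows "transport L \<alpha> \<alpha> p y i J = y i J"
proof -
  interpret F: frame L "first_secs (card L - 1)" "first_basis L \<alpha>" "first_coord L \<alpha>"
    by (rule frame_first[OF \<alpha>])
  interpret A: component L \<alpha> 1 by fact
  have "transport L \<alpha> \<alpha> p y i J = (\<Sum>K\<in>{K. K \<subseteq> L \<and> card K = p}. if K = J then y i J else 0)"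
    unfolding transport_def
  proof (rule sum.cong[OF refl])
    fix K assume "K \<in> {K. K \<subseteq> L \<and> card K = p}"
    then have "K \<subseteq> L" "finite K" using finite_subset[OF _ A.finite_L] by auto
    then show "wedge L (first_coord L \<alpha>) (map (first_basis L \<alpha>) (sorted_list_of_set K)) J
       * nval L \<alpha> 1 1 i (tensor L (lag L \<alpha>) y K) = (if K = J then y i J else 0)"
      using A.nval_tensor[OF i, of y K] by (auto simp: F.wedge_basis bvar_one)
  qed
  also have "\<dots> = y i J"
  proof (cases "J \<subseteq> L \<and> card J = p")
    case False
    then have "y i J = 0" using formD[OF y] by blast
    then show ?thesis by (auto intro!: sum.neutral)
  qed (use F.index_sets_finite in simp)
  finally show ?thesis .
qed

lemma component_if_separated:
  assumes "finite L" "L \<noteq> {}" "separated (L \<times> {1, 2}) a" "j \<in> {1, 2}"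
  shows "component L (\<lambda>i. a (i, j)) 1"
  using assms by unfold_locales (auto simp: separated_def inj_on_def)

lemma regf_coord:
  assumes "finite L" "l \<in> L" "L \<times> {j} \<subseteq> X"
  shows "(\<lambda>a. nval L (\<lambda>i. a (i, j)) 1 1 l F) \<in> regf X"
proof -
  have "(\<lambda>a. nval L (\<lambda>i. a (i, j)) 1 1 l F)
     = (\<lambda>a. poly F (a (l, j)) * (\<Prod>r\<in>L - {l}. inverse (a (l, j) - a (r, j))))"
    by (auto simp: nval_def wt_def divide_inverse prod_inversef[symmetric, unfolded o_def])
  also have "\<dots> \<in> regf X"
    using assms by (intro regf.mult regf_poly regf.var regf_prod regf.inv) auto
  finally show ?thesis .
qed

lemma regf_contract: "(\<And>J. (\<lambda>a. f a J) \<in> regf X) \<Longrightarrow> (\<lambda>a. contract l (f a) J) \<in> regf X"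
  by (cases "l \<in> J") (auto simp: contract_def intro: regf.intros)

lemma regf_extend: "(\<And>J. (\<lambda>a. f a J) \<in> regf X) \<Longrightarrow> (\<lambda>a. extend l (f a) J) \<in> regf X"
  by (cases "l \<in> J") (auto simp: extend_def intro: regf.intros)

lemma regf_wedge:
  assumes "finite L" "L \<times> {j} \<subseteq> X"
  shows "(\<lambda>a. wedge L (first_coord L (\<lambda>i. a (i, j))) ss J) \<in> regf X"
proof (induction ss arbitrary: J)
  case Nil
  then show ?case by (simp add: regf.const)
next
  case (Cons s ss)
  then show ?case unfolding wedge.simps first_coord_def
    by (intro regf_sum regf.mult regf_coord regf_extend assms) auto
qed

lemma regf_transport:
  assumes "finite L" "L \<times> {j} \<subseteq> X" "i \<in> L"
  shows "(\<lambda>a. transport L \<alpha> (\<lambda>i. a (i, j)) p y i J) \<in> regf X"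
  unfolding transport_def by (intro regf_sum regf.mult regf_wedge regf_coord assms)

lemma cycles_node_cycle:
  assumes "component L \<alpha> 1" "y \<in> cycles L \<alpha> p"
  shows "node_cycle L p y"
proof -
  interpret component L \<alpha> 1 by fact
  have y: "\<And>i. i \<in> L \<Longrightarrow> form L p (y i)" "\<And>J. kd L (bvar L \<alpha> 1) (tensor L (bvar L \<alpha> 1) y) J = 0"
    using assms(2) cycles_iff by blast+
  have "contract i (y i) J = 0" if "i \<in> L" for i J
    using nval_kd[OF that, of 1 "tensor L (bvar L \<alpha> 1) y" J] unfolding y(2) nval_tensor[OF that]
    by (simp add: nval_linear)
  moreover have "kd L (\<lambda>_. 1) (\<lambda>I. \<Sum>i\<in>L. y i I) J = 0" for J
    using ninf_kd[of "tensor L (bvar L \<alpha> 1) y" 1 J] degree_tensor unfolding y(2) ninf_tensor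
    by (simp add: ninf_linear)
  ultimately show ?thesis using y(1) by (simp add: node_cycle_def)
qed

lemma node_cycle_add:
  assumes "node_cycle L p y" "node_cycle L p z"
  shows "node_cycle L p (\<lambda>i J. y i J + z i J)"
  using assms unfolding node_cycle_def
  by (auto simp: contract_add sum.distrib kd_add intro!: form_add)

text \<open>Splittings of the elementary tensors at \<open>b\<close> are moved to other parameters, made tame by
  subtracting boundaries, and expressed in the elementary tensors again.  The resulting
  square matrix depends regularly on the parameters and is the identity at \<open>b\<close>.\<close>

theorem tame_split_open:
  assumes L: "finite L" "p < card L" and b: "separated (L \<times> {1, 2}) b"
    and split: "tame_split L (\<lambda>i. b (i, 1)) (\<lambda>i. b (i, 2)) p"
  shows "\<exists>\<delta>\<in>polyf (L \<times> {1, 2}). \<delta> b \<noteq> 0 \<and>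
    (\<forall>a. separated (L \<times> {1, 2}) a \<and> \<delta> a \<noteq> 0 \<longrightarrow> tame_split L (\<lambda>i. a (i, 1)) (\<lambda>i. a (i, 2)) p)"
proof -
  let ?X = "L \<times> {1 :: nat, 2 :: nat}"
  have ne: "L \<noteq> {}" using L by auto
  then obtain l0 where l0: "l0 \<in> L" by auto
  note comp = component_if_separated[OF L(1) ne]
  have "\<exists>m. m \<in> L - I" if "I \<subseteq> L" "card I = p" for I
  proof -
    have "I \<noteq> L" using that L by auto
    then show ?thesis using that by auto
  qed
  then obtain m0 where m0: "\<And>I. I \<subseteq> L \<Longrightarrow> card I = p \<Longrightarrow> m0 I \<in> L - I" by metis
  define T where "T = {\<tau>\<in>elementary_index L p. snd \<tau> \<noteq> m0 (fst \<tau>)}"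
  have finT: "finite T" using finite_elementary_index[OF L(1)] by (simp add: T_def)
  have Tin: "fst \<tau> \<subseteq> L" "card (fst \<tau>) = p" "snd \<tau> \<in> L - fst \<tau>" if "\<tau> \<in> T" for \<tau>
    using that by (auto simp: T_def elementary_index_def)
  have "\<exists>y1 y2. y1 \<in> cycles L (\<lambda>i. b (i, 1)) p \<and> y2 \<in> cycles L (\<lambda>i. b (i, 2)) p \<and>
      (\<forall>i\<in>L. \<forall>J. elementary m0 \<tau> i J = y1 i J + y2 i J)" if "\<tau> \<in> T" for \<tau>
  proof -
    obtain I m where \<tau>: "\<tau> = (I, m)" by (cases \<tau>)
    have "elementary m0 \<tau> \<in> tame L p"
      unfolding \<tau> using Tin[OF that] m0[of I] by (intro elementary_tame L) (auto simp: \<tau>)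
    then show ?thesis using split unfolding tame_split_def splits_def by blast
  qed
  then obtain y1 y2 where y1: "\<And>\<tau>. \<tau> \<in> T \<Longrightarrow> y1 \<tau> \<in> cycles L (\<lambda>i. b (i, 1)) p"
    and y2: "\<And>\<tau>. \<tau> \<in> T \<Longrightarrow> y2 \<tau> \<in> cycles L (\<lambda>i. b (i, 2)) p"
    and y12: "\<And>\<tau> i J. \<tau> \<in> T \<Longrightarrow> i \<in> L \<Longrightarrow> elementary m0 \<tau> i J = y1 \<tau> i J + y2 \<tau> i J"
    by metis
  define u1 where "u1 \<sigma> a = transport L (\<lambda>i. b (i, 1)) (\<lambda>i. a (i, 1)) p (y1 \<sigma>)" for \<sigma> and a :: params
  define u2 where "u2 \<sigma> a = transport L (\<lambda>i. b (i, 2)) (\<lambda>i. a (i, 2)) p (y2 \<sigma>)" for \<sigma> and a :: params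
  define u where "u \<sigma> a i J = u1 \<sigma> a i J + u2 \<sigma> a i J" for \<sigma> a i J
  define v where "v \<sigma> a = tame_part L l0 (u \<sigma> a)" for \<sigma> a
  define M where "M \<sigma> \<tau> a = v \<sigma> a (snd \<tau>) (fst \<tau>)" for \<sigma> \<tau> :: "nat set \<times> nat" and a

  have "M \<sigma> \<tau> \<in> regf ?X" if "\<tau> \<in> T" for \<sigma> \<tau>
  proof -
    have reg: "(\<lambda>a. u \<sigma> a i J) \<in> regf ?X" if "i \<in> L" for i J
      unfolding u_def u1_def u2_def using that L(1) by (intro regf.add regf_transport) auto
    have "(\<lambda>a. contract i (extend l0 (\<lambda>I. \<Sum>k\<in>L. u \<sigma> a k I)) J) \<in> regf ?X" for i J
      by (intro regf_contract regf_extend regf_sum reg)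
    then show ?thesis using Tin(3)[OF that] reg unfolding M_def v_def tame_part_def
      by (intro regf.add regf.mult regf.const) auto
  qed
  moreover have "M \<sigma> \<tau> b = (if \<sigma> = \<tau> then 1 else 0)" if "\<sigma> \<in> T" "\<tau> \<in> T" for \<sigma> \<tau>
  proof -
    have ub: "u \<sigma> b i J = elementary m0 \<sigma> i J" if "i \<in> L" for i J
    proof -
      have "u1 \<sigma> b i J = y1 \<sigma> i J" unfolding u1_def
        using y1[OF \<open>\<sigma> \<in> T\<close>] that by (intro transport_refl comp b) (auto simp: cycles_def)
      moreover have "u2 \<sigma> b i J = y2 \<sigma> i J" unfolding u2_def
        using y2[OF \<open>\<sigma> \<in> T\<close>] that by (intro transport_refl comp b) (auto simp: cycles_def)
      ultimately show ?thesis using y12[OF \<open>\<sigma> \<in> T\<close> that] by (simp add: u_def)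
    qed
    obtain I m where \<sigma>: "\<sigma> = (I, m)" by (cases \<sigma>)
    have "elementary m0 \<sigma> \<in> tame L p"
      unfolding \<sigma> using Tin[OF \<open>\<sigma> \<in> T\<close>] m0[of I] by (intro elementary_tame L) (auto simp: \<sigma>)
    then have "(\<Sum>k\<in>L. u \<sigma> b k J) = 0" for J using ub by (simp add: tame_def)
    then have "v \<sigma> b i J = elementary m0 \<sigma> i J" if "i \<in> L" for i J
      using ub[OF that] by (simp add: v_def tame_part_def contract_def extend_def)
    then have "M \<sigma> \<tau> b = elementary m0 \<sigma> (snd \<tau>) (fst \<tau>)" using Tin(3)[OF \<open>\<tau> \<in> T\<close>] by (simp add: M_def)
    also have "\<dots> = (if \<sigma> = \<tau> then 1 else 0)"
      using \<open>\<tau> \<in> T\<close> by (auto simp: elementary_def T_def \<sigma> prod_eq_iff)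
    finally show ?thesis .
  qed
  ultimately obtain d where d: "d \<in> regf ?X" "d b = 1"
    "\<And>a \<rho>. d a \<noteq> 0 \<Longrightarrow> \<rho> \<in> T \<Longrightarrow> \<exists>n. \<forall>\<tau>\<in>T. (\<Sum>\<sigma>\<in>T. n \<sigma> * M \<sigma> \<tau> a) = (if \<rho> = \<tau> then 1 else 0)"
    using regf_matrix_left_inverse[of T M ?X b, OF finT] by blast

  have generic: "tame_split L (\<lambda>i. a (i, 1)) (\<lambda>i. a (i, 2)) p" if a: "separated ?X a" "d a \<noteq> 0" for a
  proof -
    let ?sp = "splits L (\<lambda>i. a (i, 1)) (\<lambda>i. a (i, 2)) p"
    have vexp: "v \<sigma> a i K = (\<Sum>\<tau>\<in>T. M \<sigma> \<tau> a * elementary m0 \<tau> i K)"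
      and vsp: "?sp (v \<sigma> a)" if "\<sigma> \<in> T" "i \<in> L" for \<sigma> i K
    proof -
      have c1: "u1 \<sigma> a \<in> cycles L (\<lambda>i. a (i, 1)) p" unfolding u1_def
        by (rule transport_cycles[OF comp[OF b] comp[OF a(1)] y1[OF that(1)]]) auto
      have c2: "u2 \<sigma> a \<in> cycles L (\<lambda>i. a (i, 2)) p" unfolding u2_def
        by (rule transport_cycles[OF comp[OF b] comp[OF a(1)] y2[OF that(1)]]) auto
      have "node_cycle L p (u1 \<sigma> a)" by (rule cycles_node_cycle[OF comp[OF a(1)] c1]) auto
      moreover have "node_cycle L p (u2 \<sigma> a)" by (rule cycles_node_cycle[OF comp[OF a(1)] c2]) auto
      ultimately have nc: "node_cycle L p (u \<sigma> a)"
        unfolding u_def[abs_def] by (rule node_cycle_add)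
      have vt: "v \<sigma> a \<in> tame L p" unfolding v_def by (rule tame_part_tame[OF L(1) l0 nc])
      have "v \<sigma> a i K = (\<Sum>\<tau>\<in>elementary_index L p. M \<sigma> \<tau> a * elementary m0 \<tau> i K)"
        unfolding M_def by (rule tame_expand[OF L(1) m0 vt that(2)])
      also have "\<dots> = (\<Sum>\<tau>\<in>T. M \<sigma> \<tau> a * elementary m0 \<tau> i K)"
        unfolding T_def using finite_elementary_index[OF L(1)]
        by (intro sum.mono_neutral_right) (auto simp: elementary_def split: if_splits)
      finally show "v \<sigma> a i K = (\<Sum>\<tau>\<in>T. M \<sigma> \<tau> a * elementary m0 \<tau> i K)" .
      have "?sp (u \<sigma> a)" unfolding splits_def
        by (rule bexI[OF _ c1], rule bexI[OF _ c2]) (auto simp: u_def)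
      moreover have "?sp (\<lambda>i. contract i (extend l0 (\<lambda>I. \<Sum>k\<in>L. u \<sigma> a k I)))"
        unfolding splits_def
        by (rule bexI[OF _ boundary_cycle[OF L(1) form_tame_boundary[OF L(1) l0 nc]]],
            rule bexI[OF _ cycles_zero]) auto
      ultimately show "?sp (v \<sigma> a)"
        unfolding v_def tame_part_def[abs_def] by (intro splits_scale_add)
    qed
    have esp: "?sp (elementary m0 \<rho>)" if "\<rho> \<in> T" for \<rho>
    proof -
      obtain n where n: "\<forall>\<tau>\<in>T. (\<Sum>\<sigma>\<in>T. n \<sigma> * M \<sigma> \<tau> a) = (if \<rho> = \<tau> then 1 else 0)"
        using d(3)[OF a(2) \<open>\<rho> \<in> T\<close>] by blast
      have "?sp (\<lambda>i K. \<Sum>\<sigma>\<in>T. n \<sigma> * v \<sigma> a i K)"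
        by (rule splits_sum[OF finT, where c = n and y = "\<lambda>\<sigma>. v \<sigma> a"]) (rule vsp[OF _ l0])
      then show ?thesis
      proof (rule splits_cong)
        fix i K assume i: "i \<in> L"
        have "(\<Sum>\<sigma>\<in>T. n \<sigma> * v \<sigma> a i K) = (\<Sum>\<sigma>\<in>T. \<Sum>\<tau>\<in>T. n \<sigma> * M \<sigma> \<tau> a * elementary m0 \<tau> i K)"
          by (intro sum.cong refl) (simp add: vexp[OF _ i] sum_distrib_left mult.assoc)
        also have "\<dots> = (\<Sum>\<tau>\<in>T. (\<Sum>\<sigma>\<in>T. n \<sigma> * M \<sigma> \<tau> a) * elementary m0 \<tau> i K)"
          by (subst sum.swap) (simp add: sum_distrib_right)
        also have "\<dots> = (\<Sum>\<tau>\<in>T. if \<tau> = \<rho> then elementary m0 \<rho> i K else 0)"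
          using n by (intro sum.cong) auto
        also have "\<dots> = elementary m0 \<rho> i K" using finT \<open>\<rho> \<in> T\<close> by simp
        finally show "(\<Sum>\<sigma>\<in>T. n \<sigma> * v \<sigma> a i K) = elementary m0 \<rho> i K" .
      qed
    qed
    have "?sp (elementary m0 \<tau>)" if "\<tau> \<in> elementary_index L p" for \<tau>
    proof (cases "\<tau> \<in> T")
      case False
      then have "elementary m0 \<tau> = (\<lambda>i J. 0)"
        using that by (auto simp: T_def elementary_def case_prod_beta fun_eq_iff)
      then show ?thesis by (simp add: splits_zero)
    qed (rule esp)
    then have "?sp (\<lambda>i K. \<Sum>\<tau>\<in>elementary_index L p. y (snd \<tau>) (fst \<tau>) * elementary m0 \<tau> i K)" for y
      by (rule splits_sum[OF finite_elementary_index[OF L(1)],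
            where c = "\<lambda>\<tau>. y (snd \<tau>) (fst \<tau>)" and y = "elementary m0"])
    then show ?thesis unfolding tame_split_def
      using tame_expand[OF L(1) m0, symmetric] by (blast intro: splits_cong)
  qed
  obtain P Q where PQ: "P \<in> polyf ?X" "\<And>a. separated ?X a \<Longrightarrow> Q a \<noteq> 0 \<and> d a * Q a = P a"
    using regf_fraction[OF d(1)] by blast
  show ?thesis
  proof (rule bexI[OF _ PQ(1)], intro conjI allI impI)
    show "P b \<noteq> 0" using PQ(2)[OF b] d(2) by auto
    fix a assume a: "separated ?X a \<and> P a \<noteq> 0"
    then have "d a * Q a \<noteq> 0" using PQ(2)[of a] by metis
    then have "d a \<noteq> 0" by auto
    then show "tame_split L (\<lambda>i. a (i, 1)) (\<lambda>i. a (i, 2)) p"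
      using a by (intro generic) auto
  qed
qed

section \<open>General parameters give canonical binary curves\<close>

lemma proj_point_eq_iff:
  "proj_point g v = proj_point g w \<longleftrightarrow> (\<exists>c. c \<noteq> 0 \<and> (\<forall>i\<in>{1..g}. v i = c * w i))"
proof
  assume eq: "proj_point g v = proj_point g w"
  have "(\<lambda>i\<in>{1..g}. 1 * v i) \<in> proj_point g v"
    unfolding proj_point_def by (rule CollectI, rule exI[of _ 1]) simp
  then obtain c where c: "c \<noteq> 0" "(\<lambda>i\<in>{1..g}. 1 * v i) = (\<lambda>i\<in>{1..g}. c * w i)"
    unfolding eq unfolding proj_point_def by (elim CollectE exE conjE)
  have "v i = c * w i" if "i \<in> {1..g}" for i using fun_cong[OF c(2), of i] that by simp
  then show "\<exists>c. c \<noteq> 0 \<and> (\<forall>i\<in>{1..g}. v i = c * w i)" using c(1) by (intro exI[of _ c]) simp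
next
  assume "\<exists>c. c \<noteq> 0 \<and> (\<forall>i\<in>{1..g}. v i = c * w i)"
  then obtain c where c: "c \<noteq> 0" "\<forall>i\<in>{1..g}. v i = c * w i" by (elim exE conjE)
  have 1: "(\<lambda>i\<in>{1..g}. d * v i) = (\<lambda>i\<in>{1..g}. (d * c) * w i)" for d
    using c(2) by (intro restrict_ext) simp
  have 2: "(\<lambda>i\<in>{1..g}. d * w i) = (\<lambda>i\<in>{1..g}. (d / c) * v i)" for d
    using c by (intro restrict_ext) simp
  have "\<exists>e. (\<lambda>i\<in>{1..g}. d * v i) = (\<lambda>i\<in>{1..g}. e * w i) \<and> e \<noteq> 0" if "d \<noteq> 0" for d
    using that c(1) by (intro exI[of _ "d * c"] conjI 1) simp
  moreover have "\<exists>e. (\<lambda>i\<in>{1..g}. d * w i) = (\<lambda>i\<in>{1..g}. e * v i) \<and> e \<noteq> 0" if "d \<noteq> 0" for d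
    using that c(1) by (intro exI[of _ "d / c"] conjI 2) simp
  ultimately show "proj_point g v = proj_point g w"
    unfolding proj_point_def by (intro equalityI subsetI) (elim CollectE exE conjE, simp)+
qed

locale rational_component =
  fixes g :: nat and a :: params and j :: nat
  assumes g3: "3 \<le> g"
    and distinct: "i \<in> {1..g} \<Longrightarrow> k \<in> {1..g} \<Longrightarrow> i \<noteq> k \<Longrightarrow> a (i, j) \<noteq> a (k, j)"
begin

definition factor :: "complex \<times> complex \<Rightarrow> nat \<Rightarrow> complex" where
  "factor z r = fst z - a (r, j) * snd z"

lemma phi_eq: "i \<in> {1..g} \<Longrightarrow> phi g a j z i = (\<Prod>r\<in>{1..g} - {i}. factor z r)"
  by (simp add: phi_def factor_def)

lemma phi_times_factor: "i \<in> {1..g} \<Longrightarrow> phi g a j z i * factor z i = (\<Prod>r\<in>{1..g}. factor z r)"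
  by (simp add: phi_eq prod.remove[of "{Suc 0..g}" i] mult.commute)

lemma zero_factor:
  assumes "z \<noteq> (0, 0)" "l \<in> {1..g}" "factor z l = 0"
  shows "snd z \<noteq> 0" "fst z = a (l, j) * snd z"
    "\<And>r. factor z r = (a (l, j) - a (r, j)) * snd z"
    "\<And>r. r \<in> {1..g} \<Longrightarrow> r \<noteq> l \<Longrightarrow> factor z r \<noteq> 0"
    "phi g a j z l \<noteq> 0" "\<And>i. i \<in> {1..g} \<Longrightarrow> i \<noteq> l \<Longrightarrow> phi g a j z i = 0"
proof -
  show t: "fst z = a (l, j) * snd z" using assms(3) by (simp add: factor_def)
  then show u: "snd z \<noteq> 0" using assms(1) by (auto simp: prod_eq_iff)
  show f: "factor z r = (a (l, j) - a (r, j)) * snd z" for r by (simp add: factor_def t algebra_simps)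
  show nz: "factor z r \<noteq> 0" if "r \<in> {1..g}" "r \<noteq> l" for r
    using f distinct[of l r] that assms(2) u by auto
  show "phi g a j z l \<noteq> 0" unfolding phi_eq[OF assms(2)] using nz by auto
  show "phi g a j z i = 0" if "i \<in> {1..g}" "i \<noteq> l" for i
    unfolding phi_eq[OF that(1)] using assms(2,3) that(2) by (intro prod_zero) auto
qed

lemma no_zero_factor: "(\<And>r. r \<in> {1..g} \<Longrightarrow> factor z r \<noteq> 0) \<Longrightarrow> (\<Prod>r\<in>{1..g}. factor z r) \<noteq> 0"
  by auto

lemma phi_nonzero:
  assumes "z \<noteq> (0, 0)" shows "\<exists>i\<in>{1..g}. phi g a j z i \<noteq> 0"
proof (cases "\<exists>l\<in>{1..g}. factor z l = 0")
  case True
  then show ?thesis using zero_factor(5)[OF assms] by blast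
next
  case False
  then have "phi g a j z 1 \<noteq> 0" using g3 by (auto simp: phi_eq)
  then show ?thesis using g3 by (intro bexI[of _ 1]) auto
qed

lemma tangent_vector:
  assumes "i \<in> {1..g}"
  shows "A * phi_dt g a j z i + B * phi_du g a j z i
     = (\<Sum>r\<in>{1..g} - {i}. (A - a (r, j) * B) * (\<Prod>s\<in>{1..g} - {i} - {r}. factor z s))"
proof -
  have "phi_dt g a j z i = (\<Sum>r\<in>{1..g} - {i}. 1 * (\<Prod>s\<in>{1..g} - {i} - {r}. factor z s))"
    unfolding phi_dt_def restrict_apply'[OF assms] factor_def
  proof (rule DERIV_imp_deriv)
    have "((\<lambda>t. \<Prod>r\<in>{1..g} - {i}. t - a (r, j) * snd z) has_field_derivative
       (\<Sum>r\<in>{1..g} - {i}. 1 * (\<Prod>s\<in>{1..g} - {i} - {r}. fst z - a (s, j) * snd z))) (at (fst z))"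
      by (rule has_field_derivative_prod) (auto intro!: derivative_eq_intros)
    then show "((\<lambda>t. phi g a j (t, snd z) i) has_field_derivative
       (\<Sum>r\<in>{1..g} - {i}. 1 * (\<Prod>s\<in>{1..g} - {i} - {r}. fst z - a (s, j) * snd z))) (at (fst z))"
      using assms by (simp add: phi_def)
  qed
  moreover have "phi_du g a j z i = (\<Sum>r\<in>{1..g} - {i}. (- a (r, j)) * (\<Prod>s\<in>{1..g} - {i} - {r}. factor z s))"
    unfolding phi_du_def restrict_apply'[OF assms] factor_def
  proof (rule DERIV_imp_deriv)
    have "((\<lambda>u. \<Prod>r\<in>{1..g} - {i}. fst z - a (r, j) * u) has_field_derivative
       (\<Sum>r\<in>{1..g} - {i}. (- a (r, j)) * (\<Prod>s\<in>{1..g} - {i} - {r}. fst z - a (s, j) * snd z))) (at (snd z))"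
      by (rule has_field_derivative_prod) (auto intro!: derivative_eq_intros)
    then show "((\<lambda>u. phi g a j (fst z, u) i) has_field_derivative
       (\<Sum>r\<in>{1..g} - {i}. (- a (r, j)) * (\<Prod>s\<in>{1..g} - {i} - {r}. fst z - a (s, j) * snd z))) (at (snd z))"
      using assms by (simp add: phi_def)
  qed
  ultimately show ?thesis
    by (simp add: sum_distrib_left sum.distrib[symmetric] algebra_simps)
qed

text \<open>The derivative of $\phi_i \cdot (t - a_i u) = M$, where \<open>M\<close> is the product of all factors.\<close>

lemma tangent_vector_times_factor:
  assumes "i \<in> {1..g}"
  shows "(A * phi_dt g a j z i + B * phi_du g a j z i) * factor z i
     = (\<Sum>r\<in>{1..g}. (A - a (r, j) * B) * phi g a j z r) - (A - a (i, j) * B) * phi g a j z i"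
proof -
  have "(\<Prod>s\<in>{1..g} - {i} - {r}. factor z s) * factor z i = phi g a j z r" if "r \<in> {1..g} - {i}" for r
  proof -
    have "{1..g} - {r} - {i} = {1..g} - {i} - {r}" by auto
    then have "phi g a j z r = factor z i * (\<Prod>s\<in>{1..g} - {i} - {r}. factor z s)"
      using that assms by (subst phi_eq) (auto simp: prod.remove[of _ i])
    then show ?thesis by simp
  qed
  then have "(A * phi_dt g a j z i + B * phi_du g a j z i) * factor z i
    = (\<Sum>r\<in>{1..g} - {i}. (A - a (r, j) * B) * phi g a j z r)"
    unfolding tangent_vector[OF assms] sum_distrib_right mult.assoc by (intro sum.cong) auto
  then show ?thesis using assms by (simp add: sum.remove[of "{Suc 0..g}" i])
qed

lemma affine_unique:
  assumes "\<And>i. i \<in> {1..g} \<Longrightarrow> x - a (i, j) * y = x' - a (i, j) * y'"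
  shows "x = x'" "y = y'"
proof -
  have "(a (1, j) - a (2, j)) * (y - y')
      = ((x - a (2, j) * y) - (x' - a (2, j) * y')) - ((x - a (1, j) * y) - (x' - a (1, j) * y'))"
    by (simp add: algebra_simps)
  also have "\<dots> = 0" using assms[of 1] assms[of 2] g3 by simp
  finally have "(a (1, j) - a (2, j)) * (y - y') = 0" .
  then show "y = y'" using distinct[of 1 2] g3 by simp
  then show "x = x'" using assms[of 1] g3 by simp
qed

text \<open>If $(A, B)$ is a tangent vector killed at a point with no zero factor, then $A - a_i B$ is
  proportional to $t - a_i u$, so $(A, B) = K \cdot (t, u)$, and Euler's formula gives
  $(g - 1) K = 0$.  At a node, the coordinate of the node is treated separately.\<close>

lemma immersion:
  assumes z: "z \<noteq> (0, 0)" and 0: "\<And>i. i \<in> {1..g} \<Longrightarrow> A * phi_dt g a j z i + B * phi_du g a j z i = 0"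
  shows "A = 0 \<and> B = 0"
proof -
  define S where "S = (\<Sum>r\<in>{1..g}. (A - a (r, j) * B) * phi g a j z r)"
  have gc: "of_nat (g - 1) \<noteq> (0 :: complex)" unfolding of_nat_eq_0_iff using g3 by simp
  have S: "S = (A - a (i, j) * B) * phi g a j z i" if "i \<in> {1..g}" for i
    using tangent_vector_times_factor[OF that, of A z B] 0[OF that] by (simp add: S_def)
  show ?thesis
  proof (cases "\<exists>l\<in>{1..g}. factor z l = 0")
    case True
    then obtain l where l: "l \<in> {1..g}" "factor z l = 0" by blast
    note zf = zero_factor[OF z l]
    obtain i where i: "i \<in> {1..g}" "i \<noteq> l" using g3 by (cases "l = 1") (force intro: that[of 2], force intro: that[of 1])
    have "S = 0" using S[OF i(1)] zf(6)[OF i] by simp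
    then have A: "A = a (l, j) * B" using S[OF l(1)] zf(5) by simp
    have "0 = (\<Sum>r\<in>{1..g} - {l}. (A - a (r, j) * B) * (\<Prod>s\<in>{1..g} - {l} - {r}. factor z s)) * snd z"
      using 0[OF l(1)] tangent_vector[OF l(1), of A z B] by simp
    also have "\<dots> = (\<Sum>r\<in>{1..g} - {l}. B * phi g a j z l)"
      unfolding sum_distrib_right
    proof (rule sum.cong[OF refl])
      fix r assume r: "r \<in> {1..g} - {l}"
      have "phi g a j z l = factor z r * (\<Prod>s\<in>{1..g} - {l} - {r}. factor z s)"
        using r l by (subst phi_eq) (auto simp: prod.remove[of _ r])
      have "(A - a (r, j) * B) * (\<Prod>s\<in>{1..g} - {l} - {r}. factor z s) * snd z
          = B * ((a (l, j) - a (r, j)) * snd z * (\<Prod>s\<in>{1..g} - {l} - {r}. factor z s))"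
        by (simp only: A) (simp add: algebra_simps)
      then show "(A - a (r, j) * B) * (\<Prod>s\<in>{1..g} - {l} - {r}. factor z s) * snd z = B * phi g a j z l"
        by (simp only: \<open>phi g a j z l = _\<close> zf(3)[of r])
    qed
    also have "\<dots> = of_nat (g - 1) * (B * phi g a j z l)" using l by simp
    finally have "B = 0" using zf(5) gc by simp
    then show ?thesis using A by simp
  next
    case False
    define M where "M = (\<Prod>r\<in>{1..g}. factor z r)"
    have M: "M \<noteq> 0" using False no_zero_factor by (simp add: M_def)
    define K where "K = S / M"
    have K: "A - a (i, j) * B = K * factor z i" if "i \<in> {1..g}" for i
    proof -
      have "S * factor z i = (A - a (i, j) * B) * M"
        using S[OF that] phi_times_factor[OF that, of z] by (simp add: M_def mult.assoc)
      then show ?thesis using M by (simp add: K_def field_simps)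
    qed
    have "A = K * fst z" "B = K * snd z"
      using affine_unique[of A B "K * fst z" "K * snd z"] K by (auto simp: factor_def algebra_simps)
    moreover have "K = 0"
    proof -
      have "S = (\<Sum>r\<in>{1..g}. K * M)"
        unfolding S_def
      proof (rule sum.cong[OF refl])
        fix r assume r: "r \<in> {1..g}"
        have "(A - a (r, j) * B) * phi g a j z r = K * (phi g a j z r * factor z r)"
          unfolding K[OF r] by (simp only: mult_ac)
        then show "(A - a (r, j) * B) * phi g a j z r = K * M"
          unfolding phi_times_factor[OF r] M_def .
      qed
      then have "K * M = of_nat g * (K * M)" using M by (simp add: K_def)
      then show ?thesis using M g3 by simp
    qed
    ultimately show ?thesis by simp
  qed
qed

lemma point_at_node:
  assumes "z \<noteq> (0, 0)" "l \<in> {1..g}" "factor z l = 0"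
  shows "proj_point g (phi g a j z) = node g l"
proof -
  have "phi g a j z i = phi g a j z l * (if l = g + 1 \<or> i = l then 1 else 0)" if "i \<in> {1..g}" for i
    using zero_factor(6)[OF assms that] assms(2) by (cases "i = l") auto
  then show ?thesis unfolding node_def proj_point_eq_iff
    using zero_factor(5)[OF assms] by (intro exI[of _ "phi g a j z l"] conjI ballI)
qed

lemma point_at_infinity:
  assumes "z \<noteq> (0, 0)" "snd z = 0"
  shows "proj_point g (phi g a j z) = node g (g + 1)"
proof -
  have t: "fst z \<noteq> 0" using assms by (cases z) auto
  have "phi g a j z i = fst z ^ (g - 1)" if "i \<in> {1..g}" for i
    using that assms(2) by (simp add: phi_eq factor_def)
  then have "\<forall>i\<in>{1..g}. phi g a j z i = fst z ^ (g - 1) * (if g + 1 = g + 1 \<or> i = g + 1 then 1 else 0)"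
    by simp
  then show ?thesis unfolding node_def proj_point_eq_iff
    using t by (intro exI[of _ "fst z ^ (g - 1)"]) simp
qed

lemma nodes_on_curve: "node g ` {1..g + 1} \<subseteq> curve g a j"
proof
  fix P assume "P \<in> node g ` {1..g + 1}"
  then obtain l where l: "l \<in> {1..g + 1}" "P = node g l" by auto
  show "P \<in> curve g a j"
  proof (cases "l = g + 1")
    case True
    have "P = proj_point g (phi g a j (1, 0))" using l True point_at_infinity[of "(1, 0)"] by simp
    then show ?thesis unfolding curve_def by (intro CollectI exI[of _ "(1, 0)"]) simp
  next
    case False
    then have "l \<in> {1..g}" using l by auto
    then have "P = proj_point g (phi g a j (a (l, j), 1))"
      using l point_at_node[of "(a (l, j), 1)" l] by (simp add: factor_def)
    then show ?thesis unfolding curve_def by (intro CollectI exI[of _ "(a (l, j), 1)"]) simp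
  qed
qed

lemma tangent_at_node:
  assumes "z \<noteq> (0, 0)" "l \<in> {1..g}" "factor z l = 0" "v \<in> tangent_plane g a j z"
  obtains \<kappa> where "\<And>i. i \<in> {1..g} \<Longrightarrow> v i * ((a (l, j) - a (i, j)) * snd z) = (if i = l then 0 else \<kappa>)"
proof -
  obtain A B where v: "v = (\<lambda>i\<in>{1..g}. A * phi_dt g a j z i + B * phi_du g a j z i)"
    using assms(4) by (auto simp: tangent_plane_def)
  note zf = zero_factor[OF assms(1-3)]
  have S: "(\<Sum>r\<in>{1..g}. (A - a (r, j) * B) * phi g a j z r) = (A - a (l, j) * B) * phi g a j z l"
    using zf(6) assms(2) by (subst sum.remove[of _ l]) (auto intro!: sum.neutral)
  have "v i * ((a (l, j) - a (i, j)) * snd z) = (if i = l then 0 else (A - a (l, j) * B) * phi g a j z l)"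
    if i: "i \<in> {1..g}" for i
    using tangent_vector_times_factor[OF i, of A z B] zf(3)[of i] zf(6)[OF i] S i by (auto simp: v)
  then show ?thesis by (rule that)
qed

lemma tangent_at_node_nonzero:
  assumes "z \<noteq> (0, 0)" "l \<in> {1..g}" "factor z l = 0"
  shows "\<exists>v\<in>tangent_plane g a j z. \<exists>\<kappa>\<noteq>0. \<forall>i\<in>{1..g} - {l}. v i * ((a (l, j) - a (i, j)) * snd z) = \<kappa>"
proof -
  define v where "v = (\<lambda>i\<in>{1..g}. 1 * phi_dt g a j z i + 0 * phi_du g a j z i)"
  note zf = zero_factor[OF assms]
  have S: "(\<Sum>r\<in>{1..g}. (1 - a (r, j) * 0) * phi g a j z r) = phi g a j z l"
    using zf(6) assms(2) by (subst sum.remove[of _ l]) (auto intro!: sum.neutral)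
  have "v i * ((a (l, j) - a (i, j)) * snd z) = phi g a j z l" if i: "i \<in> {1..g} - {l}" for i
    using tangent_vector_times_factor[of i 1 z 0] zf(3)[of i] zf(6)[of i] S i by (auto simp: v_def)
  moreover have "v \<in> tangent_plane g a j z" unfolding tangent_plane_def v_def by blast
  ultimately show ?thesis using zf(5) by blast
qed

lemma tangent_at_infinity:
  assumes "snd z = 0" "i \<in> {1..g}"
  shows "A * phi_dt g a j z i + B * phi_du g a j z i
     = fst z ^ (g - 2) * (of_nat (g - 1) * A - B * (\<Sum>r\<in>{1..g}. a (r, j))) + fst z ^ (g - 2) * B * a (i, j)"
proof -
  have "(\<Prod>s\<in>{1..g} - {i} - {r}. factor z s) = fst z ^ (g - 2)" if "r \<in> {1..g} - {i}" for r
    using that assms by (simp add: factor_def numeral_2_eq_2)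
  then have "A * phi_dt g a j z i + B * phi_du g a j z i
    = (\<Sum>r\<in>{1..g} - {i}. (A - a (r, j) * B) * fst z ^ (g - 2))"
    unfolding tangent_vector[OF assms(2)] by (intro sum.cong) auto
  also have "\<dots> = fst z ^ (g - 2) * (of_nat (g - 1) * A - B * (\<Sum>r\<in>{1..g} - {i}. a (r, j)))"
    using assms(2) by (simp add: sum_distrib_right[symmetric] sum_distrib_left[symmetric] sum_subtractf mult.commute)
  also have "(\<Sum>r\<in>{1..g} - {i}. a (r, j)) = (\<Sum>r\<in>{1..g}. a (r, j)) - a (i, j)"
    using assms(2) by (simp add: sum.remove[of "{Suc 0..g}" i])
  finally show ?thesis by (simp add: algebra_simps)
qed

end

text \<open>The next two lemmas compare points with the same image.  They are used for two points of the
  same component, to see that it is embedded, and for points of different components.\<close>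

lemma same_zero_factor:
  assumes "rational_component g a j" "rational_component g a k" "z \<noteq> (0, 0)" "w \<noteq> (0, 0)" "c \<noteq> 0"
    and eq: "\<And>i. i \<in> {1..g} \<Longrightarrow> phi g a j z i = c * phi g a k w i"
    and l: "l \<in> {1..g}" "rational_component.factor a j z l = 0"
  shows "rational_component.factor a k w l = 0"
proof -
  interpret P: rational_component g a j by fact
  interpret Q: rational_component g a k by fact
  note zf = P.zero_factor[OF assms(3) l]
  obtain i where i: "i \<in> {1..g}" "i \<noteq> l" using P.g3 by (cases "l = 1") (force intro: that[of 2], force intro: that[of 1])
  have "phi g a k w i = 0" using eq[OF i(1)] zf(6)[OF i] assms(5) by simp
  then have "(\<Prod>r\<in>{1..g} - {i}. Q.factor w r) = 0" unfolding Q.phi_eq[OF i(1)] .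
  then have "\<exists>r\<in>{1..g} - {i}. Q.factor w r = 0" by (subst (asm) prod_zero_iff) auto
  then obtain r where r: "r \<in> {1..g}" "Q.factor w r = 0" by blast
  have "phi g a k w l \<noteq> 0" using eq[OF l(1)] zf(5) by auto
  then have "r = l" using Q.zero_factor(6)[OF assms(4) r] l by blast
  then show ?thesis using r by simp
qed

lemma proportional_factors:
  assumes "rational_component g a j" "rational_component g a k"
    and eq: "\<And>i. i \<in> {1..g} \<Longrightarrow> phi g a j z i = c * phi g a k w i" and i: "i \<in> {1..g}"
  shows "(\<Prod>r\<in>{1..g}. rational_component.factor a j z r) * rational_component.factor a k w i
    = c * (\<Prod>r\<in>{1..g}. rational_component.factor a k w r) * rational_component.factor a j z i"
proof -
  interpret P: rational_component g a j by fact
  interpret Q: rational_component g a k by fact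
  show ?thesis
    unfolding P.phi_times_factor[OF i, symmetric] Q.phi_times_factor[OF i, symmetric] eq[OF i] by simp
qed

lemma embeds:
  assumes "rational_component g a j" shows "embeds_P1 g a j"
proof -
  interpret rational_component g a j by fact
  have inj: "fst z * snd w = fst w * snd z"
    if zw: "z \<noteq> (0, 0)" "w \<noteq> (0, 0)" and pp: "proj_point g (phi g a j z) = proj_point g (phi g a j w)" for z w
  proof -
    obtain c where c: "c \<noteq> 0" "\<And>i. i \<in> {1..g} \<Longrightarrow> phi g a j z i = c * phi g a j w i"
      using pp by (auto simp: proj_point_eq_iff)
    show ?thesis
    proof (cases "\<exists>l\<in>{1..g}. factor z l = 0")
      case True
      then obtain l where l: "l \<in> {1..g}" "factor z l = 0" by blast
      then have "factor w l = 0" using same_zero_factor[OF assms assms zw c] by blast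
      then show ?thesis using l by (simp add: factor_def)
    next
      case False
      define M N where "M = (\<Prod>r\<in>{1..g}. factor z r)" and "N = c * (\<Prod>r\<in>{1..g}. factor w r)"
      have M: "M \<noteq> 0" using False no_zero_factor by (simp add: M_def)
      have "M * factor w i = N * factor z i" if "i \<in> {1..g}" for i
        using proportional_factors[OF assms assms c(2) that] by (simp add: M_def N_def)
      then have "M * fst w = N * fst z" "M * snd w = N * snd z"
        using affine_unique[of "M * fst w" "M * snd w" "N * fst z" "N * snd z"]
        by (auto simp: factor_def algebra_simps)
      then have "M * (fst z * snd w) = M * (fst w * snd z)" by (metis mult.left_commute mult.commute)
      then show ?thesis using M by simp
    qed
  qed
  show ?thesis unfolding embeds_P1_def using phi_nonzero inj immersion by blast
qed

text \<open>The points $(a_{i,1}, a_{i,2})$ of the affine plane decide everything: away from the nodes,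
  or along a common tangent at a node, the two components can only meet if these points
  lie on a line.\<close>

definition noncollinear :: "params \<Rightarrow> bool" where
  "noncollinear a \<longleftrightarrow> (a (2, 1) - a (1, 1)) * (a (3, 2) - a (1, 2)) \<noteq> (a (3, 1) - a (1, 1)) * (a (2, 2) - a (1, 2))"

lemma noncollinearD:
  assumes "noncollinear a" "3 \<le> g" "\<And>i. i \<in> {1..g} \<Longrightarrow> c * a (i, 1) + d * a (i, 2) = e"
  shows "c = 0" "d = 0"
proof -
  define x2 y2 x3 y3 where "x2 = a (2, 1) - a (1, 1)" and "y2 = a (2, 2) - a (1, 2)"
    and "x3 = a (3, 1) - a (1, 1)" and "y3 = a (3, 2) - a (1, 2)"
  have n: "x2 * y3 - x3 * y2 \<noteq> 0" using assms(1) by (simp add: noncollinear_def x2_def y2_def x3_def y3_def)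
  have e: "c * a (1, 1) + d * a (1, 2) = e" "c * a (2, 1) + d * a (2, 2) = e" "c * a (3, 1) + d * a (3, 2) = e"
    using assms(2,3) by auto
  have 2: "c * x2 + d * y2 = 0" using e(1,2) by (simp add: x2_def y2_def algebra_simps)
  have 3: "c * x3 + d * y3 = 0" using e(1,3) by (simp add: x3_def y3_def algebra_simps)
  have "c * (x2 * y3 - x3 * y2) = y3 * (c * x2 + d * y2) - y2 * (c * x3 + d * y3)" by (simp add: algebra_simps)
  then show "c = 0" using n 2 3 by simp
  have "d * (x2 * y3 - x3 * y2) = x2 * (c * x3 + d * y3) - x3 * (c * x2 + d * y2)" by (simp add: algebra_simps)
  then show "d = 0" using n 2 3 by simp
qed

lemma card_nodes:
  assumes "2 \<le> g" shows "card (node g ` {1..g + 1}) = g + 1"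
proof -
  have "l = m" if lm: "l \<in> {1..g + 1}" "m \<in> {1..g + 1}" "node g l = node g m" for l m
  proof (rule ccontr)
    assume ne: "l \<noteq> m"
    obtain c where c: "c \<noteq> 0" "\<And>i. i \<in> {1..g} \<Longrightarrow>
        (if l = g + 1 \<or> i = l then 1 else 0) = c * (if m = g + 1 \<or> i = m then 1 else (0::complex))"
      using lm(3) unfolding node_def proj_point_eq_iff by blast
    show False
    proof (cases "m = g + 1")
      case True
      then have "l \<in> {1..g}" using lm ne by auto
      then obtain i where "i \<in> {1..g}" "i \<noteq> l" using assms by (cases "l = 1") (force intro: that[of 2], force intro: that[of 1])
      then show ?thesis using c(2)[of i] c(1) True ne by auto
    next
      case m: False
      show ?thesis
      proof (cases "l = g + 1")
        case True
        have "m \<in> {1..g}" using lm m by auto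
        then obtain i where "i \<in> {1..g}" "i \<noteq> m" using assms by (cases "m = 1") (force intro: that[of 2], force intro: that[of 1])
        then show ?thesis using c(2)[of i] True m by auto
      next
        case False
        then show ?thesis using c(2)[of l] lm m ne by auto
      qed
    qed
  qed
  then have "inj_on (node g) {1..g + 1}" by (auto simp: inj_on_def)
  then show ?thesis by (simp add: card_image)
qed

lemma components_meet:
  assumes "rational_component g a 1" "rational_component g a 2" "noncollinear a"
    and zw: "z \<noteq> (0, 0)" "w \<noteq> (0, 0)" and pp: "proj_point g (phi g a 1 z) = proj_point g (phi g a 2 w)"
  shows "(\<exists>l\<in>{1..g}. rational_component.factor a 1 z l = 0 \<and> rational_component.factor a 2 w l = 0)
    \<or> (snd z = 0 \<and> snd w = 0)"
proof -
  interpret P: rational_component g a 1 by fact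
  interpret Q: rational_component g a 2 by fact
  obtain c where c: "c \<noteq> 0" "\<And>i. i \<in> {1..g} \<Longrightarrow> phi g a 1 z i = c * phi g a 2 w i"
    using pp by (auto simp: proj_point_eq_iff)
  have c': "inverse c \<noteq> 0" "\<And>i. i \<in> {1..g} \<Longrightarrow> phi g a 2 w i = inverse c * phi g a 1 z i"
    using c by auto
  consider l where "l \<in> {1..g}" "P.factor z l = 0" | l where "l \<in> {1..g}" "Q.factor w l = 0"
    | "\<And>l. l \<in> {1..g} \<Longrightarrow> P.factor z l \<noteq> 0" "\<And>l. l \<in> {1..g} \<Longrightarrow> Q.factor w l \<noteq> 0" by blast
  then show ?thesis
  proof cases
    case 1
    then show ?thesis using same_zero_factor[OF assms(1,2) zw c] by blast
  next
    case 2
    then show ?thesis using same_zero_factor[OF assms(2,1) zw(2,1) c'] by blast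
  next
    case 3
    define M N where "M = (\<Prod>r\<in>{1..g}. P.factor z r)" and "N = c * (\<Prod>r\<in>{1..g}. Q.factor w r)"
    have MN: "M \<noteq> 0" "N \<noteq> 0" using P.no_zero_factor[OF 3(1)] Q.no_zero_factor[OF 3(2)] c(1) by (auto simp: M_def N_def)
    have f: "M * Q.factor w i = N * P.factor z i" if "i \<in> {1..g}" for i
      using proportional_factors[OF assms(1,2) c(2) that] by (simp add: M_def N_def)
    have "(N * snd z) * a (i, 1) + (- (M * snd w)) * a (i, 2) = N * fst z - M * fst w" if "i \<in> {1..g}" for i
      using f[OF that] unfolding P.factor_def Q.factor_def by (simp add: algebra_simps)
    from noncollinearD[OF assms(3) P.g3 this] show ?thesis using MN by auto
  qed
qed

lemma tangents_differ:
  assumes "rational_component g a 1" "rational_component g a 2" "noncollinear a"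
    and zw: "z \<noteq> (0, 0)" "w \<noteq> (0, 0)" and pp: "proj_point g (phi g a 1 z) = proj_point g (phi g a 2 w)"
  shows "tangent_plane g a 1 z \<noteq> tangent_plane g a 2 w"
proof
  assume eq: "tangent_plane g a 1 z = tangent_plane g a 2 w"
  interpret P: rational_component g a 1 by fact
  interpret Q: rational_component g a 2 by fact
  from components_meet[OF assms] show False
  proof (elim disjE bexE conjE)
    fix l assume l: "l \<in> {1..g}" "P.factor z l = 0" "Q.factor w l = 0"
    obtain v \<kappa> where v: "v \<in> tangent_plane g a 1 z" "\<kappa> \<noteq> 0"
      "\<And>i. i \<in> {1..g} - {l} \<Longrightarrow> v i * ((a (l, 1) - a (i, 1)) * snd z) = \<kappa>"
      using P.tangent_at_node_nonzero[OF zw(1) l(1,2)] by blast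
    obtain \<mu> where \<mu>: "\<And>i. i \<in> {1..g} \<Longrightarrow> v i * ((a (l, 2) - a (i, 2)) * snd w) = (if i = l then 0 else \<mu>)"
      using Q.tangent_at_node[OF zw(2) l(1,3), of v] v(1) eq by blast
    have rel: "\<mu> * ((a (l, 1) - a (i, 1)) * snd z) = \<kappa> * ((a (l, 2) - a (i, 2)) * snd w)" if i: "i \<in> {1..g}" for i
    proof (cases "i = l")
      case False
      then have a: "v i * ((a (l, 1) - a (i, 1)) * snd z) = \<kappa>" "v i * ((a (l, 2) - a (i, 2)) * snd w) = \<mu>"
        using v(3)[of i] \<mu>[OF i] i by auto
      have "v i * (\<mu> * ((a (l, 1) - a (i, 1)) * snd z)) = v i * (\<kappa> * ((a (l, 2) - a (i, 2)) * snd w))"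
        using a by (metis mult.left_commute mult.commute)
      moreover have "v i \<noteq> 0" using a(1) v(2) by auto
      ultimately show ?thesis by simp
    qed simp
    have "(\<mu> * snd z) * a (i, 1) + (- (\<kappa> * snd w)) * a (i, 2)
        = \<mu> * snd z * a (l, 1) - \<kappa> * snd w * a (l, 2)" if "i \<in> {1..g}" for i
      using rel[OF that] by (simp add: algebra_simps)
    from noncollinearD(2)[OF assms(3) P.g3 this] show False
      using v(2) Q.zero_factor(1)[OF zw(2) l(1,3)] by simp
  next
    assume u: "snd z = 0" "snd w = 0"
    have t: "fst z \<noteq> 0" using u zw by (cases z) auto
    have "(\<lambda>i\<in>{1..g}. 0 * phi_dt g a 1 z i + 1 * phi_du g a 1 z i) \<in> tangent_plane g a 1 z"
      unfolding tangent_plane_def by blast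
    then have "(\<lambda>i\<in>{1..g}. 0 * phi_dt g a 1 z i + 1 * phi_du g a 1 z i) \<in> tangent_plane g a 2 w"
      unfolding eq .
    then obtain A B where AB: "(\<lambda>i\<in>{1..g}. 0 * phi_dt g a 1 z i + 1 * phi_du g a 1 z i)
        = (\<lambda>i\<in>{1..g}. A * phi_dt g a 2 w i + B * phi_du g a 2 w i)"
      unfolding tangent_plane_def by blast
    have D: "0 * phi_dt g a 1 z i + 1 * phi_du g a 1 z i = A * phi_dt g a 2 w i + B * phi_du g a 2 w i"
      if "i \<in> {1..g}" for i using fun_cong[OF AB, of i] that by simp
    have "fst z ^ (g - 2) * a (i, 1) + (- (fst w ^ (g - 2) * B)) * a (i, 2)
      = fst w ^ (g - 2) * (of_nat (g - 1) * A - B * (\<Sum>r\<in>{1..g}. a (r, 2)))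
        + fst z ^ (g - 2) * (\<Sum>r\<in>{1..g}. a (r, 1))" if "i \<in> {1..g}" for i
    proof -
      have solve: "f * x + (- (h * B)) * y = R + f * S"
        if "f * (n * 0 - 1 * S) + f * 1 * x = R + h * B * y" for f x h y R S n :: complex
        using that by (simp add: algebra_simps)
      show ?thesis
        by (rule solve) (rule D[OF that, unfolded P.tangent_at_infinity[OF u(1) that] Q.tangent_at_infinity[OF u(2) that]])
    qed
    from noncollinearD(1)[OF assms(3) P.g3 this] show False using t by simp
  qed
qed

lemma binary_curve_if_general:
  assumes "rational_component g a 1" "rational_component g a 2" "noncollinear a"
  shows "binary_curve g a"
proof -
  interpret P: rational_component g a 1 by fact
  interpret Q: rational_component g a 2 by fact
  have "curve g a 1 \<inter> curve g a 2 \<subseteq> node g ` {1..g + 1}"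
  proof
    fix X assume "X \<in> curve g a 1 \<inter> curve g a 2"
    then obtain z w where zw: "z \<noteq> (0, 0)" "w \<noteq> (0, 0)" "X = proj_point g (phi g a 1 z)" "X = proj_point g (phi g a 2 w)"
      unfolding curve_def by blast
    then have "(\<exists>l\<in>{1..g}. P.factor z l = 0) \<or> snd z = 0"
      using components_meet[OF assms zw(1,2)] by auto
    then show "X \<in> node g ` {1..g + 1}"
      using P.point_at_node[OF zw(1)] P.point_at_infinity[OF zw(1)] zw(3) by force
  qed
  moreover have "node g ` {1..g + 1} \<subseteq> curve g a 1 \<inter> curve g a 2"
    using P.nodes_on_curve Q.nodes_on_curve by blast
  moreover have "card (node g ` {1..g + 1}) = g + 1" using P.g3 by (intro card_nodes) simp
  ultimately show ?thesis
    unfolding binary_curve_def using embeds[OF assms(1)] embeds[OF assms(2)] tangents_differ[OF assms] by blast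
qed

lemma (in frame) basis_properties:
  "inj_on x L" "sect.independent (x ` L)" "sect.span (x ` L) = V"
proof -
  show inj: "inj_on x L"
  proof (rule inj_onI)
    fix l m assume lm: "l \<in> L" "m \<in> L" "x l = x m"
    have "c l (x l) = c l (x m)" by (simp only: lm(3))
    then show "l = m" unfolding c_x[OF lm(1) lm(1)] c_x[OF lm(1,2)] by (simp split: if_splits)
  qed
  have c0: "c l 0 = 0" for l using c_add[of l 0 0] by simp
  have csum: "c l (sum f A) = (\<Sum>i\<in>A. c l (f i))" for l f and A :: "nat set"
    by (induction A rule: infinite_finite_induct) (auto simp: c_add c0)
  show "sect.independent (x ` L)"
  proof
    assume "sect.dependent (x ` L)"
    then have "\<exists>u. (\<exists>v\<in>x ` L. u v \<noteq> 0) \<and> (\<Sum>v\<in>x ` L. sect_scale (u v) v) = 0"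
      using sect.dependent_finite[of "x ` L"] finite_L by blast
    then obtain u v where u: "v \<in> x ` L" "u v \<noteq> 0" "(\<Sum>v\<in>x ` L. sect_scale (u v) v) = 0" by blast
    obtain l where l: "l \<in> L" "v = x l" using u(1) by auto
    have "0 = c l (\<Sum>i\<in>L. sect_scale (u (x i)) (x i))"
      using u(3) by (simp add: sum.reindex[OF inj] c0)
    also have "\<dots> = (\<Sum>i\<in>L. if i = l then u v else 0)"
      unfolding csum using l c_x by (intro sum.cong) (auto simp: c_scale)
    also have "\<dots> = u v" using l finite_L by simp
    finally show False using u(2) by simp
  qed
  show "sect.span (x ` L) = V"
  proof
    show "sect.span (x ` L) \<subseteq> V" using x_in_V by (intro sect.span_minimal V_subspace) auto
    show "V \<subseteq> sect.span (x ` L)"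
    proof
      fix v assume "v \<in> V"
      moreover have "(\<Sum>l\<in>L. sect_scale (c l v) (x l)) \<in> sect.span (x ` L)"
        by (intro sect.span_sum sect.span_scale sect.span_base) auto
      ultimately show "v \<in> sect.span (x ` L)" using V_expand by metis
    qed
  qed
qed

lemma embedded_if_separated:
  assumes "two_components {1..g} (\<lambda>i. a (i, 1)) (\<lambda>i. a (i, 2))"
  shows "embedded_by_omega g a"
proof -
  interpret two_components "{1..g}" "\<lambda>i. a (i, 1)" "\<lambda>i. a (i, 2)" by fact
  let ?S = "secs {1..g} (\<lambda>i. a (i, 1)) (\<lambda>i. a (i, 2)) 1"
  interpret frame "{1..g}" ?S xs "\<lambda>l v. nval {1..g} (\<lambda>i. a (i, 1)) 1 1 l (fst v)" by (rule frame_xs)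
  have H0: "H0_omega g a 1 = ?S" using H0_omega_relabel[of id "{1..g}" g a 1] by simp
  have eq: "(\<lambda>i. (smult 1 (phi_poly g a 1 i), smult (- 1) (phi_poly g a 2 i))) = xs"
    by (rule ext) (simp only: xs_def bvar_def lag_def phi_poly_def)
  show ?thesis
    unfolding embedded_by_omega_def Let_def H0
  proof (intro exI conjI)
    show "inj_on (\<lambda>i. (smult 1 (phi_poly g a 1 i), smult (- 1) (phi_poly g a 2 i))) {1..g}"
      unfolding eq by (rule basis_properties)
    show "sect.independent ((\<lambda>i. (smult 1 (phi_poly g a 1 i), smult (- 1) (phi_poly g a 2 i))) ` {1..g})"
      unfolding eq by (rule basis_properties)
    show "sect.span ((\<lambda>i. (smult 1 (phi_poly g a 1 i), smult (- 1) (phi_poly g a 2 i))) ` {1..g}) = ?S"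
      unfolding eq by (rule basis_properties)
  qed simp_all
qed

lemma canonical_if_general:
  assumes "3 \<le> g" "a \<in> param_space g" "separated (param_index g) a" "noncollinear a"
  shows "canonical_binary_curve g a"
proof -
  have "rational_component g a j" if "j \<in> {1, 2}" for j
    using assms that by unfold_locales (auto simp: separated_def param_index_def)
  moreover have "inj_on (\<lambda>i. a (i, j)) {1..g}" if "j \<in> {1, 2}" for j
    using assms(3) that unfolding inj_on_def separated_def param_index_def by blast
  then have "two_components {1..g} (\<lambda>i. a (i, 1)) (\<lambda>i. a (i, 2))"
    using assms(1) by unfold_locales auto
  ultimately show ?thesis
    unfolding canonical_binary_curve_def
    using assms binary_curve_if_general embedded_if_separated by simp
qed

section \<open>Polynomial conditions on the parameters\<close>

definition monomial_eval :: "((nat \<times> nat) \<Rightarrow>\<^sub>0 nat) \<Rightarrow> params \<Rightarrow> complex" where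
  "monomial_eval m a = (\<Prod>v\<in>Poly_Mapping.keys m. a v ^ Poly_Mapping.lookup m v)"

lemma monomial_eval_superset:
  "finite A \<Longrightarrow> Poly_Mapping.keys m \<subseteq> A \<Longrightarrow> monomial_eval m a = (\<Prod>v\<in>A. a v ^ Poly_Mapping.lookup m v)"
  unfolding monomial_eval_def by (intro prod.mono_neutral_left) (auto simp: in_keys_iff)

lemma monomial_eval_add: "monomial_eval (m + m') a = monomial_eval m a * monomial_eval m' a"
proof -
  let ?A = "Poly_Mapping.keys m \<union> Poly_Mapping.keys m'"
  have "Poly_Mapping.keys (m + m') \<subseteq> ?A" by (rule Poly_Mapping.keys_add)
  then show ?thesis
    by (simp add: monomial_eval_superset[of ?A] lookup_add power_add prod.distrib)
qed

lemma mpoly_eval_superset: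
  "finite A \<Longrightarrow> Poly_Mapping.keys P \<subseteq> A \<Longrightarrow>
   mpoly_eval P a = (\<Sum>m\<in>A. Poly_Mapping.lookup P m * monomial_eval m a)"
  unfolding mpoly_eval_def monomial_eval_def[symmetric]
  by (intro sum.mono_neutral_left) (auto simp: in_keys_iff)

lemma mpoly_eval_add: "mpoly_eval (P + Q) a = mpoly_eval P a + mpoly_eval Q a"
proof -
  let ?A = "Poly_Mapping.keys P \<union> Poly_Mapping.keys Q"
  have "Poly_Mapping.keys (P + Q) \<subseteq> ?A" by (rule Poly_Mapping.keys_add)
  then show ?thesis
    by (simp add: mpoly_eval_superset[of ?A] lookup_add distrib_right sum.distrib)
qed

lemma mpoly_eval_single: "mpoly_eval (Poly_Mapping.single m c) a = c * monomial_eval m a"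
  by (subst mpoly_eval_superset[of "{m}"]) auto

lemma mpoly_eval_sum: "mpoly_eval (sum P A) a = (\<Sum>i\<in>A. mpoly_eval (P i) a)"
  by (induction A rule: infinite_finite_induct) (auto simp: mpoly_eval_add mpoly_eval_def[of 0])

lemma mpoly_monomials: "P = (\<Sum>m\<in>Poly_Mapping.keys P. Poly_Mapping.single m (Poly_Mapping.lookup P m))"
proof (rule poly_mapping_eqI)
  fix k
  have "Poly_Mapping.lookup (\<Sum>m\<in>Poly_Mapping.keys P. Poly_Mapping.single m (Poly_Mapping.lookup P m)) k
    = (\<Sum>m\<in>Poly_Mapping.keys P. if m = k then Poly_Mapping.lookup P k else 0)"
    unfolding lookup_sum by (rule sum.cong) (auto simp: lookup_single when_def)
  then show "Poly_Mapping.lookup P k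
      = Poly_Mapping.lookup (\<Sum>m\<in>Poly_Mapping.keys P. Poly_Mapping.single m (Poly_Mapping.lookup P m)) k"
    by (simp add: in_keys_iff)
qed

lemma mpoly_eval_mult: "mpoly_eval (P * Q) a = mpoly_eval P a * mpoly_eval Q a"
proof -
  let ?s = "\<lambda>P m. Poly_Mapping.single m (Poly_Mapping.lookup P m) :: mpolynomial"
  have "P * Q = (\<Sum>m\<in>Poly_Mapping.keys P. ?s P m) * (\<Sum>m\<in>Poly_Mapping.keys Q. ?s Q m)"
    by (intro arg_cong2[where f = "(*)"] mpoly_monomials)
  then have "mpoly_eval (P * Q) a
    = (\<Sum>m\<in>Poly_Mapping.keys P. \<Sum>m'\<in>Poly_Mapping.keys Q. mpoly_eval (?s P m * ?s Q m') a)"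
    by (simp only: sum_product mpoly_eval_sum)
  also have "\<dots> = (\<Sum>m\<in>Poly_Mapping.keys P. \<Sum>m'\<in>Poly_Mapping.keys Q. mpoly_eval (?s P m) a * mpoly_eval (?s Q m') a)"
    by (intro sum.cong refl) (simp add: mult_single mpoly_eval_single monomial_eval_add)
  also have "\<dots> = mpoly_eval (\<Sum>m\<in>Poly_Mapping.keys P. ?s P m) a * mpoly_eval (\<Sum>m\<in>Poly_Mapping.keys Q. ?s Q m) a"
    by (simp only: sum_product mpoly_eval_sum)
  finally show ?thesis by (simp only: mpoly_monomials[symmetric])
qed

lemma polyf_mpoly:
  assumes "f \<in> polyf X"
  shows "\<exists>P. mpoly_vars P \<subseteq> X \<and> (\<forall>a. mpoly_eval P a = f a)"
  using assms
proof (induction rule: polyf.induct)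
  case (const c)
  show ?case
    by (rule exI[of _ "Poly_Mapping.single 0 c"])
      (auto simp: mpoly_eval_single monomial_eval_def mpoly_vars_def split: if_splits)
next
  case (var v)
  show ?case
    by (rule exI[of _ "Poly_Mapping.single (Poly_Mapping.single v 1) 1"])
      (use var in \<open>auto simp: mpoly_eval_single monomial_eval_def mpoly_vars_def\<close>)
next
  case (add f h)
  then obtain P Q where "mpoly_vars P \<subseteq> X" "mpoly_vars Q \<subseteq> X"
    "\<forall>a. mpoly_eval P a = f a" "\<forall>a. mpoly_eval Q a = h a" by blast
  moreover have "mpoly_vars (P + Q) \<subseteq> mpoly_vars P \<union> mpoly_vars Q"
    using Poly_Mapping.keys_add[of P Q] unfolding mpoly_vars_def by blast
  ultimately show ?case by (intro exI[of _ "P + Q"]) (auto simp: mpoly_eval_add)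
next
  case (mult f h)
  then obtain P Q where PQ: "mpoly_vars P \<subseteq> X" "mpoly_vars Q \<subseteq> X"
    "\<forall>a. mpoly_eval P a = f a" "\<forall>a. mpoly_eval Q a = h a" by blast
  have "mpoly_vars (P * Q) \<subseteq> mpoly_vars P \<union> mpoly_vars Q"
  proof
    fix v assume "v \<in> mpoly_vars (P * Q)"
    then obtain m where m: "m \<in> Poly_Mapping.keys (P * Q)" "v \<in> Poly_Mapping.keys m"
      by (auto simp: mpoly_vars_def)
    then obtain k l where kl: "m = k + l" "k \<in> Poly_Mapping.keys P" "l \<in> Poly_Mapping.keys Q"
      using Poly_Mapping.keys_mult[of P Q] by blast
    then have "v \<in> Poly_Mapping.keys k \<union> Poly_Mapping.keys l"
      using m(2) Poly_Mapping.keys_add[of k l] by blast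
    then show "v \<in> mpoly_vars P \<union> mpoly_vars Q" using kl by (auto simp: mpoly_vars_def)
  qed
  then show ?case using PQ by (intro exI[of _ "P * Q"]) (auto simp: mpoly_eval_mult)
qed

lemma polyf_cong: "f \<in> polyf X \<Longrightarrow> (\<And>v. v \<in> X \<Longrightarrow> a v = a' v) \<Longrightarrow> f a = f a'"
  by (induction rule: polyf.induct) auto

lemma polyf_line:
  assumes "f \<in> polyf X"
  shows "\<exists>r. \<forall>s. poly r s = f (\<lambda>v. a v + s * (b v - a v))"
  using assms
proof (induction rule: polyf.induct)
  case (const c)
  show ?case by (rule exI[of _ "[:c:]"]) simp
next
  case (var v)
  show ?case by (rule exI[of _ "[:a v, b v - a v:]"]) simp
next
  case (add f h)
  then obtain r r' where "\<forall>s. poly r s = f (\<lambda>v. a v + s * (b v - a v))"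
    "\<forall>s. poly r' s = h (\<lambda>v. a v + s * (b v - a v))" by blast
  then show ?case by (intro exI[of _ "r + r'"]) simp
next
  case (mult f h)
  then obtain r r' where "\<forall>s. poly r s = f (\<lambda>v. a v + s * (b v - a v))"
    "\<forall>s. poly r' s = h (\<lambda>v. a v + s * (b v - a v))" by blast
  then show ?case by (intro exI[of _ "r * r'"]) simp
qed

text \<open>Affine space is irreducible: on the line through a point where the first and a point where
  the second function does not vanish, both are nonzero polynomials in one variable.\<close>

lemma polyf_mult_nonzero:
  assumes "f \<in> polyf X" "h \<in> polyf X" "f a \<noteq> 0" "h b \<noteq> 0"
  shows "\<exists>c. f c * h c \<noteq> 0"
proof -
  obtain r where r: "\<And>s. poly r s = f (\<lambda>v. a v + s * (b v - a v))" using polyf_line[OF assms(1)] by blast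
  obtain r' where r': "\<And>s. poly r' s = h (\<lambda>v. a v + s * (b v - a v))" using polyf_line[OF assms(2)] by blast
  have "poly r 0 \<noteq> 0" "poly r' 1 \<noteq> 0" using assms(3,4) by (auto simp: r r')
  then have "r * r' \<noteq> 0" by auto
  then have "\<exists>s. poly (r * r') s \<noteq> 0" using poly_all_0_iff_0 by blast
  then show ?thesis using r r' by (metis poly_mult)
qed

lemma polyf_prod_nonzero:
  assumes "finite A" "\<And>i. i \<in> A \<Longrightarrow> f i \<in> polyf X" "\<And>i. i \<in> A \<Longrightarrow> \<exists>a. f i a \<noteq> 0"
  shows "\<exists>c. (\<Prod>i\<in>A. f i c) \<noteq> 0"
  using assms
proof (induction A rule: finite_induct)
  case (insert i A)
  then obtain a c where "f i a \<noteq> 0" "(\<Prod>i\<in>A. f i c) \<noteq> 0" by blast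
  then show ?case
    using polyf_mult_nonzero[of "f i" X "\<lambda>c. \<Prod>i\<in>A. f i c" a c] polyf_prod[of A f X] insert by auto
qed auto

lemma zariski_open_nonvanishing:
  assumes "f \<in> polyf (param_index g)"
  shows "zariski_open g {a \<in> param_space g. f a \<noteq> 0}"
proof -
  obtain P where "mpoly_vars P \<subseteq> param_index g" "\<And>a. mpoly_eval P a = f a"
    using polyf_mpoly[OF assms] by blast
  then show ?thesis unfolding zariski_open_def by (intro exI[of _ "{P}"]) auto
qed

section \<open>The theorem\<close>

text \<open>If two of the points on a component coincided, all the coordinates would vanish there.\<close>

lemma separated_if_canonical:
  assumes "canonical_binary_curve n b"
  shows "separated (param_index n) b"
proof -
  have "b (i, j) \<noteq> b (k, j)" if ikj: "i \<in> {1..n}" "k \<in> {1..n}" "j \<in> {1, 2}" "i \<noteq> k" for i k j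
  proof
    assume eq: "b (i, j) = b (k, j)"
    have "embeds_P1 n b j" using assms ikj(3) by (auto simp: canonical_binary_curve_def binary_curve_def)
    then obtain l where l: "l \<in> {1..n}" "phi n b j (b (i, j), 1) l \<noteq> 0"
      unfolding embeds_P1_def by (metis prod.inject zero_neq_one)
    obtain r where "r \<in> {1..n} - {l}" "b (i, j) = b (r, j)"
      using ikj eq by (cases "l = i") (blast intro: that)+
    then have "(\<Prod>r\<in>{1..n} - {l}. (b (i, j) - b (r, j) * 1)) = 0" by (intro prod_zero) auto
    then show False using l by (simp add: phi_def)
  qed
  then show ?thesis unfolding separated_def param_index_def by blast
qed

lemma two_components_if_separated:
  assumes "finite L" "L \<noteq> {}" "separated (L \<times> {1, 2}) a"
  shows "two_components L (\<lambda>i. a (i, 1)) (\<lambda>i. a (i, 2))"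
proof -
  have "inj_on (\<lambda>i. a (i, j)) L" if "j \<in> {1, 2}" for j
    using assms(3) that unfolding inj_on_def separated_def by blast
  then show ?thesis using assms(1,2) by unfold_locales auto
qed

lemma separated_polyf:
  "\<exists>f\<in>polyf (param_index g). (\<exists>a. f a \<noteq> 0) \<and> (\<forall>a. f a \<noteq> 0 \<longrightarrow> separated (param_index g) a)"
proof -
  define D where "D = {(i, k, j). i \<in> {1..g} \<and> k \<in> {1..g} \<and> j \<in> {1 :: nat, 2} \<and> i \<noteq> k}"
  define d :: "nat \<times> nat \<times> nat \<Rightarrow> params \<Rightarrow> complex" where "d = (\<lambda>(i, k, j) a. a (i, j) - a (k, j))"
  have fin: "finite D" by (rule finite_subset[of _ "{1..g} \<times> {1..g} \<times> {1, 2}"]) (auto simp: D_def)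
  have poly: "d t \<in> polyf (param_index g)" if "t \<in> D" for t
    using that by (auto simp: D_def d_def param_index_def intro!: polyf_minus polyf.var)
  have "\<exists>a. d t a \<noteq> 0" if "t \<in> D" for t
    using that by (intro exI[of _ "\<lambda>v. of_nat (fst v)"]) (auto simp: D_def d_def)
  then have "\<exists>a. (\<Prod>t\<in>D. d t a) \<noteq> 0" by (intro polyf_prod_nonzero[OF fin poly])
  moreover have "separated (param_index g) a" if "(\<Prod>t\<in>D. d t a) \<noteq> 0" for a
  proof -
    have "d t a \<noteq> 0" if "t \<in> D" for t using \<open>(\<Prod>t\<in>D. d t a) \<noteq> 0\<close> fin that by auto
    then have "a (i, j) - a (k, j) \<noteq> 0" if "i \<in> {1..g}" "k \<in> {1..g}" "j \<in> {1, 2}" "i \<noteq> k" for i k j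
      using that by (force simp: D_def d_def)
    then show ?thesis unfolding separated_def param_index_def by force
  qed
  moreover have "(\<lambda>a. \<Prod>t\<in>D. d t a) \<in> polyf (param_index g)" by (intro polyf_prod poly)
  ultimately show ?thesis by (intro bexI[of _ "\<lambda>a. \<Prod>t\<in>D. d t a"]) auto
qed

lemma noncollinear_polyf:
  assumes "3 \<le> g"
  shows "\<exists>f\<in>polyf (param_index g). (\<exists>a. f a \<noteq> 0) \<and> (\<forall>a. f a \<noteq> 0 \<longrightarrow> noncollinear a)"
proof -
  define f where "f a = (a (2, 1) - a (1, 1)) * (a (3, 2) - a (1, 2)) - (a (3, 1) - a (1, 1)) * (a (2, 2) - a (1, 2))"
    for a :: params
  have "f \<in> polyf (param_index g)"
    unfolding f_def[abs_def] using assms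
    by (intro polyf_minus polyf.mult polyf.var) (auto simp: param_index_def)
  moreover have "f (\<lambda>v. if v = (2, 1) \<or> v = (3, 2) then 1 else 0) \<noteq> 0" by (simp add: f_def)
  moreover have "\<forall>a. f a \<noteq> 0 \<longrightarrow> noncollinear a" by (auto simp: f_def noncollinear_def)
  ultimately show ?thesis by blast
qed

theorem theorem4p2:
  fixes p g :: nat and b :: params
  assumes "4 \<le> g"
    and "canonical_binary_curve (g - 1) b"
    and "property_N p (g - 1) b"
  shows "\<exists>U. zariski_open g U \<and> U \<noteq> {} \<and>
           (\<forall>a\<in>U. canonical_binary_curve g a \<and> property_N p g a)"
proof -
  define n where "n = g - 1"
  have n: "3 \<le> n" "g = Suc n" using assms(1) by (auto simp: n_def)
  have sepb: "separated (param_index n) b"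
    using separated_if_canonical assms(2) by (simp add: n_def)
  have N: "koszul_vanishes (H0_omega n b) i q" if "i \<le> p" "2 \<le> q" for i q
    using assms(3) that by (simp add: property_N_def n_def)
  have transfer: "two_components L (\<lambda>i. b (\<tau> i, 1)) (\<lambda>i. b (\<tau> i, 2))"
    "\<And>i q. i \<le> p \<Longrightarrow> 2 \<le> q \<Longrightarrow> two_components.kvan L (\<lambda>i. b (\<tau> i, 1)) (\<lambda>i. b (\<tau> i, 2)) i q"
    "separated (L \<times> {1, 2}) (\<lambda>(i, j). b (\<tau> i, j))"
    if \<tau>: "bij_betw \<tau> L {1..n}" for L \<tau>
  proof -
    have im: "\<tau> i \<in> {1..n}" if "i \<in> L" for i using \<tau> that by (auto simp: bij_betw_def)
    have ne: "\<tau> i \<noteq> \<tau> k" if "i \<in> L" "k \<in> L" "i \<noteq> k" for i k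
      using \<tau> that by (auto simp: bij_betw_def inj_on_def)
    show sep: "separated (L \<times> {1, 2}) (\<lambda>(i, j). b (\<tau> i, j))"
      using sepb im ne unfolding separated_def param_index_def by simp
    have L: "finite L" "L \<noteq> {}" using \<tau> n bij_betw_finite[OF \<tau>] by (auto simp: bij_betw_def)
    show tc: "two_components L (\<lambda>i. b (\<tau> i, 1)) (\<lambda>i. b (\<tau> i, 2))"
      using two_components_if_separated[OF L sep] by simp
    show "two_components.kvan L (\<lambda>i. b (\<tau> i, 1)) (\<lambda>i. b (\<tau> i, 2)) i q" if "i \<le> p" "2 \<le> q" for i q
    proof -
      have "H0_omega n b = secs L (\<lambda>i. b (\<tau> i, 1)) (\<lambda>i. b (\<tau> i, 2))"
        by (rule ext) (rule H0_omega_relabel[OF \<tau>])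
      then show ?thesis using N[OF that] two_components.koszul_vanishes_iff[OF tc, of q i] that by simp
    qed
  qed

  \<comment> \<open>For larger \<open>p\<close> the hypothesis would contradict the nonvanishing of $K_{n-2,3}$.\<close>
  have p: "p + 3 \<le> n"
  proof (rule ccontr)
    assume "\<not> p + 3 \<le> n"
    then have "n - 2 \<le> p" using n by simp
    moreover have id: "bij_betw id {1..n} {1..n}" by simp
    ultimately show False
      using transfer(2)[OF id, of "n - 2" 3] two_components.top_nonvanishing[OF transfer(1)[OF id]] n by simp
  qed

  let ?split = "\<lambda>l i a. tame_split ({1..g} - {l}) (\<lambda>k. a (k, 1)) (\<lambda>k. a (k, 2)) (Suc i)"
  \<comment> \<open>The given curve, labelled by the nodes other than \<open>l\<close>, shows that the condition on the
     projection from the node \<open>l\<close> is generic.\<close>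
  have ex: "\<exists>\<delta>\<in>polyf (param_index g). (\<exists>a. \<delta> a \<noteq> 0) \<and>
      (\<forall>a. separated (param_index g) a \<and> \<delta> a \<noteq> 0 \<longrightarrow> ?split l i a)"
    if l: "l \<in> {1..g}" and i: "i \<le> p" for l i
  proof -
    let ?L = "{1..g} - {l}"
    have card: "card ?L = n" using l n by simp
    then obtain \<tau> where \<tau>: "bij_betw \<tau> ?L {1..n}"
      using finite_same_card_bij[of ?L "{1..n}"] by auto
    let ?b = "\<lambda>(i, j). b (\<tau> i, j)"
    have "tame_split ?L (\<lambda>k. b (\<tau> k, 1)) (\<lambda>k. b (\<tau> k, 2)) (Suc i)"
      using two_components.tame_split_if_vanishing[OF transfer(1)[OF \<tau>] transfer(2)[OF \<tau> i]] by simp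
    then obtain \<delta> where \<delta>: "\<delta> \<in> polyf (?L \<times> {1, 2})" "\<delta> ?b \<noteq> 0"
      "\<And>a. separated (?L \<times> {1, 2}) a \<Longrightarrow> \<delta> a \<noteq> 0 \<Longrightarrow> ?split l i a"
      using tame_split_open[of ?L "Suc i" ?b] transfer(3)[OF \<tau>] card p i by auto
    have sub: "?L \<times> {1, 2} \<subseteq> param_index g" by (auto simp: param_index_def)
    have "separated (?L \<times> {1, 2}) a" if "separated (param_index g) a" for a
      using that sub unfolding separated_def by blast
    then show ?thesis using \<delta> polyf_mono[OF \<delta>(1) sub] by blast
  qed
  define good where "good l i \<delta> \<longleftrightarrow> \<delta> \<in> polyf (param_index g) \<and> (\<exists>a. \<delta> a \<noteq> 0) \<and>
      (\<forall>a. separated (param_index g) a \<and> \<delta> a \<noteq> 0 \<longrightarrow> ?split l i a)" for l i \<delta>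
  define \<delta> where "\<delta> l i = (SOME \<delta>. good l i \<delta>)" for l i
  have \<delta>: "\<delta> l i \<in> polyf (param_index g) \<and> (\<exists>a. \<delta> l i a \<noteq> 0) \<and>
      (\<forall>a. separated (param_index g) a \<and> \<delta> l i a \<noteq> 0 \<longrightarrow> ?split l i a)"
    if "l \<in> {1..g}" "i \<le> p" for l i
  proof -
    have "\<exists>\<delta>. good l i \<delta>" using ex[OF that] unfolding good_def by blast
    then have "good l i (\<delta> l i)" unfolding \<delta>_def by (rule someI_ex[of "good l i"])
    then show ?thesis unfolding good_def .
  qed
  define f3 where "f3 a = (\<Prod>(l, i)\<in>{1..g} \<times> {..p}. \<delta> l i a)" for a
  have f3: "f3 \<in> polyf (param_index g)"
    unfolding f3_def[abs_def] case_prod_beta by (rule polyf_prod) (use \<delta> in auto)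
  have f3_nz: "\<exists>a. f3 a \<noteq> 0"
    unfolding f3_def case_prod_beta
    by (rule polyf_prod_nonzero[of _ "\<lambda>x. \<delta> (fst x) (snd x)" "param_index g"]) (use \<delta> in auto)
  have f3_split: "?split l i a" if "f3 a \<noteq> 0" "separated (param_index g) a" "l \<in> {1..g}" "i \<le> p" for a l i
  proof -
    have "\<delta> l i a \<noteq> 0" using that(1,3,4) by (auto simp: f3_def)
    then show ?thesis using \<delta>[OF that(3,4)] that(2) by blast
  qed
  obtain f1 where f1: "f1 \<in> polyf (param_index g)" "\<exists>a. f1 a \<noteq> 0"
    "\<And>a. f1 a \<noteq> 0 \<Longrightarrow> separated (param_index g) a" using separated_polyf by blast
  obtain f2 where f2: "f2 \<in> polyf (param_index g)" "\<exists>a. f2 a \<noteq> 0"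
    "\<And>a. f2 a \<noteq> 0 \<Longrightarrow> noncollinear a" using noncollinear_polyf[of g] assms(1) by auto
  define f where "f a = f1 a * f2 a * f3 a" for a
  have f: "f \<in> polyf (param_index g)" unfolding f_def[abs_def] by (intro polyf.mult f1 f2 f3)
  obtain a12 where "f1 a12 * f2 a12 \<noteq> 0" using polyf_mult_nonzero[OF f1(1) f2(1)] f1(2) f2(2) by blast
  then obtain a0 where a0: "f a0 \<noteq> 0"
    using polyf_mult_nonzero[OF polyf.mult[OF f1(1) f2(1)] f3] f3_nz unfolding f_def by blast
  define U where "U = {a \<in> param_space g. f a \<noteq> 0}"
  have "restrict a0 (param_index g) \<in> U"
  proof -
    have "f (restrict a0 (param_index g)) = f a0" by (rule polyf_cong[OF f]) simp
    then show ?thesis using a0 by (simp add: U_def param_space_def)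
  qed
  moreover have "canonical_binary_curve g a \<and> property_N p g a" if "a \<in> U" for a
  proof
    have a: "a \<in> param_space g" "separated (param_index g) a" "noncollinear a" "f3 a \<noteq> 0"
      using that f1(3) f2(3) by (auto simp: U_def f_def)
    show "canonical_binary_curve g a" using canonical_if_general[OF _ a(1-3)] assms(1) by simp
    have sep: "separated ({1..g} \<times> {1, 2}) a" using a(2) by (simp add: param_index_def)
    interpret two_components "{1..g}" "\<lambda>i. a (i, 1)" "\<lambda>i. a (i, 2)"
      using two_components_if_separated[OF _ _ sep] assms(1) by simp
    have H0: "H0_omega g a = secs {1..g} (\<lambda>i. a (i, 1)) (\<lambda>i. a (i, 2))"
    proof
      fix q
      have "bij_betw id {1..g} {1..g}" by simp
      from H0_omega_relabel[OF this, of a q]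
      show "H0_omega g a q = secs {1..g} (\<lambda>i. a (i, 1)) (\<lambda>i. a (i, 2)) q" unfolding id_apply .
    qed
    show "property_N p g a"
      unfolding property_N_def
    proof (intro allI impI)
      fix i q :: nat assume i: "i \<le> p" and q: "2 \<le> q"
      have "kvan i q"
      proof (cases "q = 2")
        case True
        have "tame_split {1..g} (\<lambda>i. a (i, 1)) (\<lambda>i. a (i, 2)) (Suc i)"
        proof (rule tame_split_from_projections)
          show "Suc i + 3 \<le> card {1..g}" using p i n by simp
          show "?split l i a" if "l \<in> {1..g}" for l by (rule f3_split[OF a(4,2) that i])
        qed simp
        then show ?thesis unfolding True by (rule vanishing_if_tame_split)
      next
        case False
        then show ?thesis using q p i n by (intro vanishing_high_degree) auto
      qed
      then show "koszul_vanishes (H0_omega g a) i q" using koszul_vanishes_iff[of q i] q by (simp add: H0)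
    qed
  qed
  moreover have "zariski_open g U" unfolding U_def by (rule zariski_open_nonvanishing[OF f])
  ultimately show ?thesis by blast
qed

end
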